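(* Let $Z\subseteq\mathbb{P}^n$ be a finite set of points, let $d\ge1$ be an integer, and let $Q$ be a general linear subspace of $\mathbb{P}^n$ of codimension $2$. Then $Z$ admits very unexpected $(d-1)Q$-hypersurfaces in degree $d$ if and only if $$\dim[I(Q)^{d-1}]_d-\dim[I(Q)^{d-1}\cap I(Z)]_d<\mathrm{Ex.C}(Z,d).$$
   Context: $\mathbb{K}$ is an algebraically closed field of arbitrary characteristic, $n\ge2$, $R=\mathbb{K}[X_0,\ldots,X_n]$ is the coordinate ring of $\mathbb{P}^n$, and $[M]_d$ is the degree $d$ part of a graded module $M$. Very unexpected hypersurfaces: let $Q\subseteq\mathbb{P}^n$ be a generic linear subspace of codimension $2$ (each condition below involving $Q$ is required to hold for $Q$ general). $Z$ admits very unexpected $(d-1)Q$-hypersurfaces in degree $d$ if there is a subset $U\subseteq Z$ such that (I) $[I(Z)\cap I(Q)^{d-1}]_d=[I(U)\cap I(Q)^{d-1}]_d$; (II) for every irreducible subvariety $X\subseteq\mathbb{P}^n$, $|U\cap X|\leq\dim[I(Q)^{d-1}/(I(X)\cap I(Q)^{d-1})]_d$; (III) $\dim[R/I(U)]_d>\dim[I(Q)^{d-1}/(I(U)\cap I(Q)^{d-1})]_d$. $\mathrm{Ex.C}(Z,d)$ is the minimum of $\sum_{i=0}^s(d\dim H_i+1)$ over all finite collections $\{H_0,\ldots,H_s\}$ of nonempty linear subspaces of $\mathbb{P}^n$ with $Z\subseteq\bigcup_{i=0}^sH_i$.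
   Formalization: For empty Z the empty collection of linear subspaces is admitted, so Ex.C(∅,d)=0; with at least one subspace required, Ex.C(∅,d)=1 and the equivalence fails for Z=∅ (condition (III) reads 0>0, while 0<1 holds). Nothing changes for nonempty Z. *)

theory Defs
  imports "HOL-Analysis.Analysis" "HOL-Library.Poly_Mapping"
    "HOL-Computational_Algebra.Polynomial"
begin

text \<open>
  The variables \<open>X\<^sub>0, \<dots>, X\<^sub>n\<close> are indexed by a finite type \<open>'n\<close> with \<open>n + 1\<close> elements, so that the
  polynomial ring is a whole type and the affine cone over \<open>n\<close>-dimensional projective space is
  the vector space \<^typ>\<open>'a^'n\<close>.
\<close>

type_synonym ('a, 'i) mpoly = "('i \<Rightarrow>\<^sub>0 nat) \<Rightarrow>\<^sub>0 'a"

definition smult_mpoly :: "'a::field \<Rightarrow> ('a, 'i) mpoly \<Rightarrow> ('a, 'i) mpoly" where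
  "smult_mpoly c f = Poly_Mapping.single 0 c * f"

global_interpretation mpoly: vector_space "smult_mpoly :: 'a::field \<Rightarrow> ('a, 'i) mpoly \<Rightarrow> ('a, 'i) mpoly"
  by unfold_locales
    (simp_all add: smult_mpoly_def single_add mult_single algebra_simps flip: mult.assoc)

global_interpretation ideal: module "(*) :: 'a::comm_ring_1 \<Rightarrow> 'a \<Rightarrow> 'a"
  by unfold_locales (simp_all add: algebra_simps)

definition eval_mpoly :: "('a::field, 'i::finite) mpoly \<Rightarrow> ('i \<Rightarrow> 'a) \<Rightarrow> 'a" where
  "eval_mpoly f x =
     (\<Sum>m\<in>Poly_Mapping.keys f. Poly_Mapping.lookup f m * (\<Prod>i\<in>UNIV. x i ^ Poly_Mapping.lookup m i))"

definition homogeneous_part :: "nat \<Rightarrow> ('a::field, 'i::finite) mpoly set" where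
  "homogeneous_part d =
     {f. \<forall>m\<in>Poly_Mapping.keys f. (\<Sum>i\<in>UNIV. Poly_Mapping.lookup m i) = d}"

definition graded_part :: "('a::field, 'i::finite) mpoly set \<Rightarrow> nat \<Rightarrow> ('a, 'i) mpoly set" where
  "graded_part I d = I \<inter> homogeneous_part d"

fun ideal_power :: "'a::comm_ring_1 set \<Rightarrow> nat \<Rightarrow> 'a set" where
  "ideal_power I 0 = UNIV"
| "ideal_power I (Suc k) = ideal.span {f * g | f g. f \<in> I \<and> g \<in> ideal_power I k}"


text \<open>
  Dimension of the quotient space \<open>A / B\<close> for subspaces \<open>B \<subseteq> A\<close>: \<open>S\<close> is a set of representatives
  of a basis of \<open>A / B\<close>. As with the library's \<open>dim\<close>, the value is \<open>0\<close> if there is no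
  finite basis.
\<close>

definition quot_basis ::
    "('a::field, 'i) mpoly set \<Rightarrow> ('a, 'i) mpoly set \<Rightarrow> ('a, 'i) mpoly set \<Rightarrow> bool" where
  "quot_basis A B S \<longleftrightarrow> finite S \<and> S \<subseteq> A \<and>
     (\<forall>c. (\<Sum>s\<in>S. smult_mpoly (c s) s) \<in> B \<longrightarrow> (\<forall>s\<in>S. c s = 0)) \<and>
     (\<forall>a\<in>A. \<exists>c. a - (\<Sum>s\<in>S. smult_mpoly (c s) s) \<in> B)"

definition quot_dim :: "('a::field, 'i) mpoly set \<Rightarrow> ('a, 'i) mpoly set \<Rightarrow> nat" where
  "quot_dim A B = (if \<exists>S. quot_basis A B S then card (SOME S. quot_basis A B S) else 0)"

text \<open>\<open>dim [I/J]\<^sub>d\<close> for homogeneous ideals \<open>J \<subseteq> I\<close>, where \<open>[I/J]\<^sub>d = [I]\<^sub>d / [J]\<^sub>d\<close>.\<close>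

definition graded_quot_dim ::
    "('a::field, 'i::finite) mpoly set \<Rightarrow> ('a, 'i) mpoly set \<Rightarrow> nat \<Rightarrow> nat" where
  "graded_quot_dim I J d = quot_dim (graded_part I d) (graded_part J d)"


text \<open>
  A point of projective space is a line through the origin. A linear subspace of projective space
  is given by the vector subspace \<open>W\<close> that is its cone; its projective dimension is
  \<^term>\<open>vec.dim W - 1\<close>, and it is nonempty iff \<^term>\<open>vec.dim W \<ge> 1\<close>.
\<close>

definition proj_points :: "('a::field ^ 'n) set set" where
  "proj_points = {p. vec.subspace p \<and> vec.dim p = 1}"

definition points_of :: "('a::field ^ 'n) set \<Rightarrow> ('a ^ 'n) set set" where
  "points_of W = {p \<in> proj_points. p \<subseteq> W}"

definition vanishes_at :: "('a::field, 'n::finite) mpoly \<Rightarrow> ('a ^ 'n) set \<Rightarrow> bool" where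
  "vanishes_at f p \<longleftrightarrow> (\<forall>v\<in>p. eval_mpoly f (($) v) = 0)"

definition vanishing_ideal :: "('a::field ^ 'n) set set \<Rightarrow> ('a, 'n::finite) mpoly set" where
  "vanishing_ideal Y =
     ideal.span {f. (\<exists>k. f \<in> homogeneous_part k) \<and> (\<forall>p\<in>Y. vanishes_at f p)}"

definition proj_closed :: "('a::field ^ 'n::finite) set set \<Rightarrow> bool" where
  "proj_closed Y \<longleftrightarrow> (\<exists>F \<subseteq> (\<Union>k. homogeneous_part k).
     Y = {p \<in> proj_points. \<forall>f\<in>F. vanishes_at f p})"

definition irreducible_subvariety :: "('a::field ^ 'n::finite) set set \<Rightarrow> bool" where
  "irreducible_subvariety X \<longleftrightarrow> proj_closed X \<and> X \<noteq> {} \<and>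
     (\<forall>Y1 Y2. proj_closed Y1 \<and> proj_closed Y2 \<and> X = Y1 \<union> Y2 \<longrightarrow> X = Y1 \<or> X = Y2)"


text \<open>
  The Grassmannian of linear subspaces of codimension \<open>2\<close> carries the quotient Zariski topology of
  the variety of linearly independent pairs of linear forms \<open>(a, b)\<close>: a set of subspaces is open
  iff the set of pairs cutting out its members is Zariski open among all such pairs. The polynomials
  below are in the coordinates of the pair, indexed by \<open>'n + 'n\<close>.
\<close>

definition codim2_subspaces :: "('a::field ^ 'n::finite) set set" where
  "codim2_subspaces = {W. vec.subspace W \<and> vec.dim W + 2 = CARD('n)}"

definition cut_out :: "'a::field ^ 'n::finite \<Rightarrow> 'a ^ 'n \<Rightarrow> ('a ^ 'n) set" where
  "cut_out a b = {v. (\<Sum>i\<in>UNIV. a $ i * v $ i) = 0 \<and> (\<Sum>i\<in>UNIV. b $ i * v $ i) = 0}"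

definition open_codim2 :: "('a::field ^ 'n::finite) set set \<Rightarrow> bool" where
  "open_codim2 G \<longleftrightarrow> G \<subseteq> codim2_subspaces \<and>
     (\<exists>F :: ('a, 'n + 'n) mpoly set. \<forall>a b. cut_out a b \<in> codim2_subspaces \<longrightarrow>
        (cut_out a b \<in> G \<longleftrightarrow> (\<exists>f\<in>F. eval_mpoly f (case_sum (($) a) (($) b)) \<noteq> 0)))"

definition for_general_codim2 :: "(('a::field ^ 'n::finite) set \<Rightarrow> bool) \<Rightarrow> bool" where
  "for_general_codim2 P \<longleftrightarrow> (\<exists>G. open_codim2 G \<and> G \<noteq> {} \<and> (\<forall>Q\<in>G. P Q))"


text \<open>\<open>I(Q)\<^bsup>d-1\<^esup>\<close>\<close>

definition fat_ideal :: "('a::field ^ 'n) set \<Rightarrow> nat \<Rightarrow> ('a, 'n::finite) mpoly set" where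
  "fat_ideal Q d = ideal_power (vanishing_ideal (points_of Q)) (d - 1)"

text \<open>
  In the second condition the variety \<open>X\<close> is fixed before \<open>Q\<close> is chosen general. The order matters:
  for fixed \<open>Q\<close>, the variety \<open>X\<close> could itself be an unexpected hypersurface for \<open>Q\<close>.
\<close>

definition very_unexpected :: "('a::field ^ 'n::finite) set set \<Rightarrow> nat \<Rightarrow> bool" where
  "very_unexpected Z d \<longleftrightarrow> (\<exists>U \<subseteq> Z.
     for_general_codim2 (\<lambda>Q.
       graded_part (vanishing_ideal Z \<inter> fat_ideal Q d) d =
       graded_part (vanishing_ideal U \<inter> fat_ideal Q d) d) \<and>
     (\<forall>X. irreducible_subvariety X \<longrightarrow> for_general_codim2 (\<lambda>Q.
       card (U \<inter> X) \<le> graded_quot_dim (fat_ideal Q d) (vanishing_ideal X \<inter> fat_ideal Q d) d)) \<and>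
     for_general_codim2 (\<lambda>Q.
       graded_quot_dim UNIV (vanishing_ideal U) d >
       graded_quot_dim (fat_ideal Q d) (vanishing_ideal U \<inter> fat_ideal Q d) d))"

text \<open>
  The empty collection is admitted; it only covers \<open>Z = {}\<close>, for which the value is then \<open>0\<close>.
\<close>

definition ExC :: "('a::field ^ 'n::finite) set set \<Rightarrow> nat \<Rightarrow> nat" where
  "ExC Z d = (LEAST m. \<exists>\<H>. finite \<H> \<and>
     (\<forall>H\<in>\<H>. vec.subspace H \<and> vec.dim H \<ge> 1) \<and> Z \<subseteq> (\<Union>H\<in>\<H>. points_of H) \<and>
     m = (\<Sum>H\<in>\<H>. d * (vec.dim H - 1) + 1))"

end

theory Submission
  imports Defs
begin

text \<open>
  Write \<open>r\<^sub>Q(S)\<close> for the number of conditions that a set of points \<open>S\<close> imposes on \<open>[I(Q)\<^bsup>d-1\<^esup>]\<^sub>d\<close>. A form in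
  this space is \<open>\<Sum>\<^sub>k a\<^sup>k b\<^bsup>d-1-k\<^esup> l\<^sub>k\<close> with linear forms \<open>l\<^sub>k\<close>, if \<open>Q\<close> is cut out by \<open>a, b\<close>. For general \<open>Q\<close> and a
  linear subspace \<open>H\<close> this gives \<open>r\<^sub>Q(H) = d dim H + 1\<close>, and an irreducible \<open>X\<close> satisfies
  \<open>r\<^sub>Q(X) = r\<^sub>Q(span X)\<close>: the restriction of a form to a hyperplane through \<open>Q\<close> is essentially linear,
  and a general hyperplane section of \<open>X\<close> spans the hyperplane. Hence condition (II) says that
  \<open>|U \<inter> H| \<le> d dim H + 1\<close> for all linear subspaces \<open>H\<close>. Call such sets \<open>U\<close> bounded.

  A bounded set has at most \<open>Ex.C(Z, d)\<close> elements, which gives one direction. Conversely, if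
  \<open>I \<subseteq> Z\<close> is a basis for \<open>r\<^sub>Q\<close>, then \<open>I\<close> is bounded. If it is maximal with this property, the maximal
  subspaces \<open>H\<close> attaining the bound are disjoint and cover \<open>Z\<close>, so that \<open>Ex.C(Z, d) \<le> r\<^sub>Q(Z)\<close>.
  Otherwise \<open>U = I \<union> {z}\<close> is bounded for some \<open>z\<close>. By matroid partition, modulo a point \<open>p \<in> U\<close>, the set
  \<open>U - {p}\<close> is covered by \<open>d\<close> hyperplanes avoiding \<open>p\<close>; hence \<open>U\<close> imposes \<open>|U| > r\<^sub>Q(U)\<close> conditions on
  forms of degree \<open>d\<close>, which is (III).
\<close>

section \<open>Evaluation of polynomials\<close>

text \<open>The set U of the definition, and the variety X in condition (II), are fixed before Q
  becomes general. So one finite set I of points has to compute the rank for all Q outside a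
  hypersurface of pairs (a, b). This is why interpolation is done with coefficients polynomial in
  (a, b) and a common denominator D, giving identities that hold for every pair. The same identities
  carry the passage from X to span X. For a single Q a form may vanish on X without vanishing on
  span X. A relation holding on X for all pairs leaves room to move b while a and the slope t of a
  hyperplane b = t a are kept, until the section of X spans that hyperplane. The value d dim H + 1
  is a count of monomials. Coordinates on H can be chosen as a, b and dim H - 1 further ones e_u,
  and the restricted forms are spanned by the d + 1 monomials of degree d in a, b and the d (dim H -
  1) products of a monomial of degree d - 1 in a, b with some e_u.\<close>

text \<open>The interpretation in the definitions makes \<open>a * (b * x) = (a * b) * x\<close> a simplification rule,
  which loops with \<open>algebra_simps\<close>.\<close>

declare ideal.scale_scale [simp del]

text \<open>Over a finite field the product of all X - a, plus 1, is nonconstant and takes the value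
  1 everywhere.\<close>

lemma infinite_UNIV_alg_closed: "infinite (UNIV :: 'a::alg_closed_field set)"
proof
  assume fin: "finite (UNIV :: 'a set)"
  let ?q = "\<Prod>a\<in>(UNIV :: 'a set). [:- a, 1:]"
  have "degree ?q = card (UNIV :: 'a set)"
    by (subst degree_prod_eq_sum_degree) auto
  moreover have "card (UNIV :: 'a set) > 0"
    using fin by (simp add: card_gt_0_iff)
  ultimately have "degree (?q + 1) > 0"
    by (simp add: degree_add_eq_left)
  then obtain x where "poly (?q + 1) x = 0"
    using alg_closed_imp_poly_has_root by blast
  moreover have "poly ?q x = 0"
    unfolding poly_prod using fin by (auto intro!: prod_zero)
  ultimately show False by simp
qed

lemma poly_zero_if_all_zero:
  fixes P :: "'a::alg_closed_field poly"
  assumes "\<And>s. poly P s = 0"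
  shows "P = 0"
proof (rule ccontr)
  assume "P \<noteq> 0"
  then have "finite {s. poly P s = 0}" by (rule poly_roots_finite)
  with assms show False using infinite_UNIV_alg_closed[where 'a='a] by simp
qed

lemma eval_mpoly_superset:
  assumes "finite K" "Poly_Mapping.keys f \<subseteq> K"
  shows "eval_mpoly f x =
    (\<Sum>m\<in>K. Poly_Mapping.lookup f m * (\<Prod>i\<in>UNIV. x i ^ Poly_Mapping.lookup m i))"
  unfolding eval_mpoly_def
  by (rule sum.mono_neutral_left) (use assms in \<open>auto simp: in_keys_iff\<close>)

lemma eval_mpoly_single [simp]:
  "eval_mpoly (Poly_Mapping.single m c) x = c * (\<Prod>i\<in>UNIV. x i ^ Poly_Mapping.lookup m i)"
  by (subst eval_mpoly_superset[where K="{m}"]) auto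

lemma eval_mpoly_zero [simp]: "eval_mpoly 0 x = 0"
  by (simp add: eval_mpoly_def)

lemma eval_mpoly_one [simp]: "eval_mpoly 1 x = 1"
  using eval_mpoly_single[of 0 1 x] by (simp del: eval_mpoly_single)

lemma eval_mpoly_add [simp]: "eval_mpoly (f + g) x = eval_mpoly f x + eval_mpoly g x"
proof -
  let ?K = "Poly_Mapping.keys f \<union> Poly_Mapping.keys g"
  have "eval_mpoly (f + g) x = (\<Sum>m\<in>?K. Poly_Mapping.lookup (f + g) m * (\<Prod>i\<in>UNIV. x i ^ Poly_Mapping.lookup m i))"
    by (rule eval_mpoly_superset) (auto dest: keys_add[THEN subsetD])
  moreover have "eval_mpoly f x = (\<Sum>m\<in>?K. Poly_Mapping.lookup f m * (\<Prod>i\<in>UNIV. x i ^ Poly_Mapping.lookup m i))"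
    by (rule eval_mpoly_superset) auto
  moreover have "eval_mpoly g x = (\<Sum>m\<in>?K. Poly_Mapping.lookup g m * (\<Prod>i\<in>UNIV. x i ^ Poly_Mapping.lookup m i))"
    by (rule eval_mpoly_superset) auto
  ultimately show ?thesis
    by (simp add: lookup_add distrib_right sum.distrib)
qed

lemma eval_mpoly_sum [simp]: "eval_mpoly (\<Sum>i\<in>A. f i) x = (\<Sum>i\<in>A. eval_mpoly (f i) x)"
  by (induction A rule: infinite_finite_induct) auto

lemma mpoly_eq_sum_monomials:
  "f = (\<Sum>m\<in>Poly_Mapping.keys f. Poly_Mapping.single m (Poly_Mapping.lookup f m))"
  by (rule poly_mapping_eqI) (simp add: lookup_sum lookup_single when_def in_keys_iff)

lemma eval_mpoly_mult [simp]: "eval_mpoly (f * g) x = eval_mpoly f x * eval_mpoly g x"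
proof -
  let ?F = "Poly_Mapping.keys f" and ?G = "Poly_Mapping.keys g"
  let ?x = "\<lambda>m. \<Prod>i\<in>UNIV. x i ^ Poly_Mapping.lookup m i"
  have "f * g = (\<Sum>m\<in>?F. \<Sum>m'\<in>?G.
      Poly_Mapping.single (m + m') (Poly_Mapping.lookup f m * Poly_Mapping.lookup g m'))"
    by (simp flip: mult_single sum_product mpoly_eq_sum_monomials)
  then have "eval_mpoly (f * g) x = (\<Sum>m\<in>?F. \<Sum>m'\<in>?G.
      Poly_Mapping.lookup f m * Poly_Mapping.lookup g m' * ?x (m + m'))"
    by simp
  also have "\<dots> = (\<Sum>m\<in>?F. \<Sum>m'\<in>?G.
      (Poly_Mapping.lookup f m * ?x m) * (Poly_Mapping.lookup g m' * ?x m'))"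
    by (intro sum.cong refl) (simp add: lookup_add power_add prod.distrib)
  also have "\<dots> = eval_mpoly f x * eval_mpoly g x"
    by (simp add: eval_mpoly_def sum_product)
  finally show ?thesis .
qed

lemma eval_mpoly_power [simp]: "eval_mpoly (f ^ k) x = eval_mpoly f x ^ k"
  by (induction k) auto

lemma eval_mpoly_prod [simp]: "eval_mpoly (\<Prod>i\<in>A. f i) x = (\<Prod>i\<in>A. eval_mpoly (f i) x)"
  by (induction A rule: infinite_finite_induct) auto

lemma eval_mpoly_smult [simp]: "eval_mpoly (smult_mpoly c f) x = c * eval_mpoly f x"
  by (simp add: smult_mpoly_def)

lemma eval_mpoly_uminus [simp]: "eval_mpoly (- f) x = - eval_mpoly f x"
  using eval_mpoly_add[of f "- f" x] by (simp add: eq_neg_iff_add_eq_0 add.commute)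

lemma eval_mpoly_diff [simp]: "eval_mpoly (f - g) x = eval_mpoly f x - eval_mpoly g x"
  using eval_mpoly_add[of f "- g" x] by simp

definition mpoly_var :: "'i \<Rightarrow> ('a::field, 'i) mpoly" where
  "mpoly_var i = Poly_Mapping.single (Poly_Mapping.single i 1) 1"

lemma eval_mpoly_var [simp]: "eval_mpoly (mpoly_var i) x = x i"
  by (simp add: mpoly_var_def lookup_single when_def if_distrib prod.delta cong: if_cong)

text \<open>Constants and variables generate the polynomial ring. Later claims about values of
  polynomials then only need closure under sums and products, with no handling of monomials.\<close>

lemma mpoly_induct [case_names const var add mult]:
  fixes f :: "('a::field, 'i::finite) mpoly"
  assumes const: "\<And>c. P (Poly_Mapping.single 0 c)"
    and var: "\<And>i. P (mpoly_var i)"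
    and add: "\<And>f g. P f \<Longrightarrow> P g \<Longrightarrow> P (f + g)"
    and mult: "\<And>f g. P f \<Longrightarrow> P g \<Longrightarrow> P (f * g)"
  shows "P f"
proof -
  have zero: "P 0" and one: "P 1"
    using const[of 0] const[of 1] by simp_all
  have power: "P (g ^ k)" if "P g" for g k
    by (induction k) (auto intro: one mult that)
  have prod: "P (\<Prod>i\<in>A. h i)" if "\<And>i. P (h i)" for A :: "'i set" and h
    by (induction A rule: infinite_finite_induct) (auto intro: one mult that)
  have monomial: "P (Poly_Mapping.single m c)" for m c
  proof -
    have pow: "mpoly_var i ^ k = (Poly_Mapping.single (Poly_Mapping.single i k) 1 :: ('a, 'i) mpoly)" for i k
      by (induction k) (simp_all add: mpoly_var_def mult_single flip: single_add)
    have prd: "(\<Prod>i\<in>A. Poly_Mapping.single (h i) 1) = (Poly_Mapping.single (\<Sum>i\<in>A. h i) 1 :: ('a, 'i) mpoly)"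
      if "finite A" for A and h :: "'i \<Rightarrow> 'i \<Rightarrow>\<^sub>0 nat"
      using that by induction (simp_all add: mult_single)
    have m: "(\<Sum>i\<in>UNIV. Poly_Mapping.single i (Poly_Mapping.lookup m i)) = m"
      by (rule poly_mapping_eqI) (simp add: lookup_sum lookup_single when_def)
    have "Poly_Mapping.single m c =
        Poly_Mapping.single 0 c * (\<Prod>i\<in>UNIV. mpoly_var i ^ Poly_Mapping.lookup m i)"
      by (simp add: pow prd m mult_single)
    then show ?thesis
      by (simp add: const mult prod power var)
  qed
  have "P (\<Sum>m\<in>A. Poly_Mapping.single m (Poly_Mapping.lookup f m))" if "finite A" for A
    using that by induction (simp_all add: zero add monomial)
  from this[OF finite_keys[of f]] show ?thesis
    by (simp flip: mpoly_eq_sum_monomials)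
qed

text \<open>Stated for functions instead of polynomials, so that polynomial dependence on a
  parameter is derived from the syntactic shape of an expression by introduction rules.\<close>

definition poly_fun :: "('a::field \<Rightarrow> 'a) \<Rightarrow> bool" where
  "poly_fun \<phi> \<longleftrightarrow> (\<exists>P. \<forall>s. \<phi> s = poly P s)"

lemma poly_fun_const [intro, simp]: "poly_fun (\<lambda>s. c)"
  unfolding poly_fun_def by (rule exI[of _ "[:c:]"]) simp

lemma poly_fun_ident [intro, simp]: "poly_fun (\<lambda>s. s)"
  unfolding poly_fun_def by (rule exI[of _ "[:0, 1:]"]) simp

lemma poly_fun_add [intro]: "poly_fun \<phi> \<Longrightarrow> poly_fun \<psi> \<Longrightarrow> poly_fun (\<lambda>s. \<phi> s + \<psi> s)"
  unfolding poly_fun_def by (metis poly_add)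

lemma poly_fun_mult [intro]: "poly_fun \<phi> \<Longrightarrow> poly_fun \<psi> \<Longrightarrow> poly_fun (\<lambda>s. \<phi> s * \<psi> s)"
  unfolding poly_fun_def by (metis poly_mult)

lemma poly_fun_diff [intro]: "poly_fun \<phi> \<Longrightarrow> poly_fun \<psi> \<Longrightarrow> poly_fun (\<lambda>s. \<phi> s - \<psi> s)"
  unfolding poly_fun_def by (metis poly_diff)

lemma poly_fun_power [intro]: "poly_fun \<phi> \<Longrightarrow> poly_fun (\<lambda>s. \<phi> s ^ k)"
  by (induction k) auto

lemma poly_fun_sum [intro]: "(\<And>i. i \<in> A \<Longrightarrow> poly_fun (\<phi> i)) \<Longrightarrow> poly_fun (\<lambda>s. \<Sum>i\<in>A. \<phi> i s)"
  by (induction A rule: infinite_finite_induct) auto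

lemma poly_fun_eval_mpoly:
  fixes f :: "('a::field, 'i::finite) mpoly"
  assumes "\<And>i. poly_fun (\<lambda>s. x s i)"
  shows "poly_fun (\<lambda>s. eval_mpoly f (x s))"
  by (induction f rule: mpoly_induct) (auto simp: assms)

lemma poly_fun_nonzero_finite:
  assumes "poly_fun \<phi>" "\<phi> s0 \<noteq> 0"
  shows "finite {s. \<phi> s = 0}"
proof -
  obtain P where P: "\<And>s. \<phi> s = poly P s" using assms(1) unfolding poly_fun_def by blast
  with assms(2) have "P \<noteq> 0" by auto
  then show ?thesis using P poly_roots_finite by simp
qed

text \<open>Irreducibility of the affine line: finitely many finite root sets cannot exhaust an
  infinite field.\<close>

lemma poly_fun_common_nonzero:
  fixes \<phi> :: "'i \<Rightarrow> 'a::alg_closed_field \<Rightarrow> 'a"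
  assumes "finite A" "\<And>i. i \<in> A \<Longrightarrow> poly_fun (\<phi> i)" "\<And>i. i \<in> A \<Longrightarrow> \<exists>s. \<phi> i s \<noteq> 0"
  shows "\<exists>s. \<forall>i\<in>A. \<phi> i s \<noteq> 0"
proof -
  have "finite (\<Union>i\<in>A. {s. \<phi> i s = 0})"
    using assms poly_fun_nonzero_finite by blast
  then obtain s where "s \<notin> (\<Union>i\<in>A. {s. \<phi> i s = 0})"
    using infinite_UNIV_alg_closed[where 'a='a] by (metis ex_new_if_finite)
  then show ?thesis by blast
qed

lemma poly_fun_two_nonzero:
  fixes \<phi> \<psi> :: "'a::alg_closed_field \<Rightarrow> 'a"
  assumes "poly_fun \<phi>" "poly_fun \<psi>" "\<phi> s \<noteq> 0" "\<psi> t \<noteq> 0"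
  shows "\<exists>r. \<phi> r \<noteq> 0 \<and> \<psi> r \<noteq> 0"
proof -
  have "\<exists>r. \<forall>b\<in>UNIV. (if b then \<phi> else \<psi>) r \<noteq> 0"
    by (rule poly_fun_common_nonzero) (use assms in auto)
  then obtain r where "\<forall>b. (if b then \<phi> else \<psi>) r \<noteq> 0" by auto
  from this[rule_format, of True] this[rule_format, of False] show ?thesis by auto
qed

section \<open>Homogeneous polynomials\<close>

lemma homogeneous_part_eval_scale:
  assumes "f \<in> homogeneous_part d"
  shows "eval_mpoly f (\<lambda>i. s * x i) = s ^ d * eval_mpoly f x"
proof -
  have "eval_mpoly f (\<lambda>i. s * x i) = (\<Sum>m\<in>Poly_Mapping.keys f. s ^ d *
     (Poly_Mapping.lookup f m * (\<Prod>i\<in>UNIV. x i ^ Poly_Mapping.lookup m i)))"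
    unfolding eval_mpoly_def
  proof (intro sum.cong refl)
    fix m assume "m \<in> Poly_Mapping.keys f"
    then have deg: "(\<Sum>i\<in>UNIV. Poly_Mapping.lookup m i) = d"
      using assms unfolding homogeneous_part_def by blast
    have "(\<Prod>i\<in>UNIV. (s * x i) ^ Poly_Mapping.lookup m i) =
        (\<Prod>i\<in>UNIV. s ^ Poly_Mapping.lookup m i) * (\<Prod>i\<in>UNIV. x i ^ Poly_Mapping.lookup m i)"
      by (simp only: power_mult_distrib prod.distrib)
    also have "(\<Prod>i\<in>UNIV. s ^ Poly_Mapping.lookup m i) = s ^ d"
      by (simp only: power_sum[symmetric] deg)
    finally show "Poly_Mapping.lookup f m * (\<Prod>i\<in>UNIV. (s * x i) ^ Poly_Mapping.lookup m i) =
      s ^ d * (Poly_Mapping.lookup f m * (\<Prod>i\<in>UNIV. x i ^ Poly_Mapping.lookup m i))"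
      by (simp only: mult.left_commute)
  qed
  then show ?thesis by (simp add: eval_mpoly_def sum_distrib_left)
qed

lemma homogeneous_part_zero [simp]: "0 \<in> homogeneous_part d"
  by (simp add: homogeneous_part_def)

lemma homogeneous_part_add: "f \<in> homogeneous_part d \<Longrightarrow> g \<in> homogeneous_part d \<Longrightarrow> f + g \<in> homogeneous_part d"
  using keys_add[of f g] unfolding homogeneous_part_def by blast

lemma homogeneous_part_mult:
  assumes "f \<in> homogeneous_part d" "g \<in> homogeneous_part e"
  shows "f * g \<in> homogeneous_part (d + e)"
proof -
  have "(\<Sum>i\<in>UNIV. Poly_Mapping.lookup m i) = d + e" if m: "m \<in> Poly_Mapping.keys (f * g)" for m
  proof -
    obtain a b where "m = a + b" "a \<in> Poly_Mapping.keys f" "b \<in> Poly_Mapping.keys g"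
      using m keys_mult[of f g] by blast
    then show ?thesis
      using assms by (simp add: homogeneous_part_def lookup_add sum.distrib)
  qed
  then show ?thesis unfolding homogeneous_part_def by blast
qed

lemma homogeneous_part_const: "Poly_Mapping.single 0 c \<in> homogeneous_part 0"
  by (simp add: homogeneous_part_def)

lemma homogeneous_part_var: "mpoly_var i \<in> homogeneous_part 1"
  by (simp add: homogeneous_part_def mpoly_var_def lookup_single when_def)

lemma homogeneous_part_smult: "f \<in> homogeneous_part d \<Longrightarrow> smult_mpoly c f \<in> homogeneous_part d"
  using homogeneous_part_mult[OF homogeneous_part_const] by (fastforce simp: smult_mpoly_def)

lemma homogeneous_part_sum:
  "(\<And>i. i \<in> A \<Longrightarrow> f i \<in> homogeneous_part d) \<Longrightarrow> (\<Sum>i\<in>A. f i) \<in> homogeneous_part d"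
  by (induction A rule: infinite_finite_induct) (auto intro: homogeneous_part_add)

lemma homogeneous_part_power: "f \<in> homogeneous_part d \<Longrightarrow> f ^ k \<in> homogeneous_part (k * d)"
proof (induction k)
  case 0
  then show ?case using homogeneous_part_const[of 1] by simp
next
  case (Suc k)
  then show ?case using homogeneous_part_mult[of f d "f ^ k" "k * d"] by simp
qed

lemma homogeneous_part_subspace: "mpoly.subspace (homogeneous_part d)"
  by (rule mpoly.subspaceI) (auto intro: homogeneous_part_add homogeneous_part_smult)

text \<open>Each exponent of a monomial of degree d is at most d, so there are finitely many
  monomials. This keeps the dimensions below away from the default value for infinite-dimensional
  spaces.\<close>

lemma homogeneous_part_finite_span:
  "\<exists>M. finite M \<and> (homogeneous_part d :: ('a::field, 'i::finite) mpoly set) \<subseteq> mpoly.span M"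
proof -
  let ?D = "{m :: 'i \<Rightarrow>\<^sub>0 nat. (\<Sum>i\<in>UNIV. Poly_Mapping.lookup m i) = d}"
  let ?M = "(\<lambda>m. Poly_Mapping.single m (1::'a)) ` ?D"
  have "Poly_Mapping.lookup ` ?D \<subseteq> Pi\<^sub>E UNIV (\<lambda>_. {..d})"
  proof -
    have "Poly_Mapping.lookup m i \<le> (\<Sum>i\<in>UNIV. Poly_Mapping.lookup m i)" for m :: "'i \<Rightarrow>\<^sub>0 nat" and i
      by (rule member_le_sum) auto
    then show ?thesis by auto
  qed
  then have "finite (Poly_Mapping.lookup ` ?D)"
    by (rule finite_subset) (intro finite_PiE; simp)
  then have "finite ?D"
    by (rule finite_imageD) (simp add: inj_on_def poly_mapping.lookup_inject)
  moreover have "f \<in> mpoly.span ?M" if "f \<in> homogeneous_part d" for f :: "('a, 'i) mpoly"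
  proof -
    have "f = (\<Sum>m\<in>Poly_Mapping.keys f. smult_mpoly (Poly_Mapping.lookup f m) (Poly_Mapping.single m 1))"
      by (simp add: smult_mpoly_def mult_single flip: mpoly_eq_sum_monomials)
    moreover have "\<dots> \<in> mpoly.span ?M"
      using that unfolding homogeneous_part_def
      by (intro mpoly.span_sum mpoly.span_scale mpoly.span_base) auto
    ultimately show ?thesis by simp
  qed
  ultimately show ?thesis by blast
qed

section \<open>Linear subspaces and linear forms\<close>

definition dotp :: "'a::field ^ 'n \<Rightarrow> 'a ^ 'n \<Rightarrow> 'a" where
  "dotp a v = (\<Sum>i\<in>UNIV. a $ i * v $ i)"

lemma dotp_commute: "dotp a b = dotp b a"
  by (simp add: dotp_def mult.commute)

lemma dotp_add_right: "dotp a (v + w) = dotp a v + dotp a w"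
  by (simp add: dotp_def distrib_left sum.distrib)

lemma dotp_add_left: "dotp (a + b) v = dotp a v + dotp b v"
  by (simp add: dotp_def distrib_right sum.distrib)

lemma dotp_scale_right: "dotp a (c *s v) = c * dotp a v"
  by (simp add: dotp_def sum_distrib_left ac_simps)

lemma dotp_scale_left: "dotp (c *s a) v = c * dotp a v"
  by (simp add: dotp_def sum_distrib_left ac_simps)

lemma dotp_zero_right [simp]: "dotp a 0 = 0"
  by (simp add: dotp_def)

lemma dotp_zero_left [simp]: "dotp 0 a = 0"
  by (simp add: dotp_def)

lemma dotp_diff_right: "dotp a (v - w) = dotp a v - dotp a w"
  by (simp add: dotp_def right_diff_distrib sum_subtractf)

lemma dotp_diff_left: "dotp (a - b) v = dotp a v - dotp b v"
  by (simp add: dotp_def left_diff_distrib sum_subtractf)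

lemma dotp_sum_right: "dotp a (\<Sum>i\<in>A. f i) = (\<Sum>i\<in>A. dotp a (f i))"
  by (induction A rule: infinite_finite_induct) (auto simp: dotp_add_right)

lemmas dotp_linear = dotp_add_right dotp_add_left dotp_scale_right dotp_scale_left
  dotp_diff_right dotp_diff_left

lemma dotp_axis [simp]: "dotp (axis i 1) v = v $ i"
  by (simp add: dotp_def axis_def if_distrib[of "\<lambda>x. x * _"] cong: if_cong)

lemma subspace_kernel: "vec.subspace {v. dotp a v = 0}"
  by (rule vec.subspaceI) (auto simp: dotp_linear)

lemma subspace_Int_kernel: "vec.subspace S \<Longrightarrow> vec.subspace {v\<in>S. dotp a v = 0}"
  using vec.subspace_inter[OF _ subspace_kernel] by (simp add: Collect_conj_eq)

lemma dotp_zero_on_span: "(\<And>x. x \<in> S \<Longrightarrow> dotp a x = 0) \<Longrightarrow> w \<in> vec.span S \<Longrightarrow> dotp a w = 0"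
  using vec.span_minimal[OF _ subspace_kernel, of S a] by blast

lemma exists_functional:
  fixes B :: "('a::field ^ 'n) set"
  assumes "vec.independent B"
  shows "\<exists>a. \<forall>u\<in>B. dotp a u = f u"
proof -
  \<comment> \<open>The functional is read off as one coordinate, chosen arbitrarily, of a linear
    map with values in vectors.\<close>
  let ?i = "undefined :: 'n"
  obtain g where g: "Vector_Spaces.linear (*s) (*s) g" "\<forall>u\<in>B. g u = axis ?i (f u)"
    using vec.linear_independent_extend[OF assms, of "\<lambda>u. axis ?i (f u) :: 'a ^ 'n"] by auto
  define a where "a = (\<chi> j. g (axis j 1) $ ?i)"
  have "dotp a x = g x $ ?i" for x
    by (subst Cartesian_Space.linear_componentwise[OF g(1)]) (simp add: a_def dotp_def mult.commute)
  then have "\<forall>u\<in>B. dotp a u = f u"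
    using g(2) by simp
  then show ?thesis by blast
qed

lemma separating_functional:
  assumes "vec.subspace W" "v \<notin> W"
  shows "\<exists>a. (\<forall>w\<in>W. dotp a w = 0) \<and> dotp a v = 1"
proof -
  obtain B where B: "B \<subseteq> W" "vec.independent B" "W \<subseteq> vec.span B"
    using vec.maximal_independent_subset by blast
  have sp: "vec.span B = W"
    using B assms(1) by (meson antisym vec.span_minimal)
  then have "vec.independent (insert v B)"
    using B assms(2) vec.independent_insertI by blast
  then obtain a where a: "\<forall>u\<in>insert v B. dotp a u = (if u = v then 1 else 0)"
    using exists_functional[of "insert v B" "\<lambda>u. if u = v then 1 else 0"] by blast
  have "v \<notin> B" using B assms by blast
  then have "\<forall>u\<in>B. dotp a u = 0"
    using a by auto
  then have "\<forall>w\<in>W. dotp a w = 0"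
    using dotp_zero_on_span sp by blast
  then show ?thesis using a by auto
qed

lemma dim_Int_kernel:
  assumes S: "vec.subspace S" and v: "v \<in> S" "dotp a v \<noteq> 0"
  shows "vec.dim S = Suc (vec.dim {w\<in>S. dotp a w = 0})"
proof -
  let ?T = "{w\<in>S. dotp a w = 0}"
  have T: "vec.subspace ?T" by (rule subspace_Int_kernel[OF S])
  have "S \<subseteq> vec.span (insert v ?T)"
  proof
    fix x assume x: "x \<in> S"
    let ?y = "x - (dotp a x / dotp a v) *s v"
    have "?y \<in> ?T"
      using x v S by (auto simp: dotp_linear intro!: vec.subspace_diff vec.subspace_scale)
    then have "(dotp a x / dotp a v) *s v + ?y \<in> vec.span (insert v ?T)"
      by (intro vec.span_add vec.span_scale vec.span_base) auto
    then show "x \<in> vec.span (insert v ?T)" by simp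
  qed
  moreover have "vec.span (insert v ?T) \<subseteq> S"
    by (rule vec.span_minimal) (use v S in auto)
  ultimately have "vec.span (insert v ?T) = S" by blast
  then have "vec.dim S = vec.dim (insert v ?T)" by (metis vec.dim_span)
  also have "\<dots> = Suc (vec.dim ?T)"
  proof -
    have "v \<notin> vec.span ?T"
      unfolding vec.span_eq_iff[THEN iffD2, OF T] using v(2) by simp
    then show ?thesis by (simp add: vec.dim_insert)
  qed
  finally show ?thesis .
qed

text \<open>Determinant of the forms a, b on the vectors v, w. It is nonzero iff (a, b) maps the
  span of v and w isomorphically onto K^2. For v, w in W this makes \<open>cut_out a b\<close> meet
  W in codimension 2, and the condition is polynomial in (a, b).\<close>

definition minor2 :: "'a::field ^ 'n \<Rightarrow> 'a ^ 'n \<Rightarrow> 'a ^ 'n \<Rightarrow> 'a ^ 'n \<Rightarrow> 'a" where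
  "minor2 a b v w = dotp a v * dotp b w - dotp a w * dotp b v"

text \<open>Cramer's rule for the two linear equations in the plane of v and w.\<close>

lemma minor2_dual_pair:
  assumes W: "vec.subspace W" "v \<in> W" "w \<in> W" and nz: "minor2 a b v w \<noteq> 0"
  shows "\<exists>x\<in>W. \<exists>y\<in>W. dotp a x = 1 \<and> dotp b x = 0 \<and> dotp a y = 0 \<and> dotp b y = 1"
proof -
  let ?m = "minor2 a b v w"
  let ?x = "inverse ?m *s (dotp b w *s v - dotp b v *s w)"
  let ?y = "inverse ?m *s (dotp a v *s w - dotp a w *s v)"
  have "?x \<in> W" "?y \<in> W"
    using W by (auto intro!: vec.subspace_scale vec.subspace_diff)
  moreover have "dotp a ?x = inverse ?m * ?m" "dotp b ?x = 0" "dotp a ?y = 0" "dotp b ?y = inverse ?m * ?m"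
    unfolding minor2_def by (simp_all add: dotp_linear algebra_simps)
  ultimately show ?thesis using nz by (metis left_inverse)
qed

lemma cut_out_eq: "cut_out a b = {v. dotp a v = 0 \<and> dotp b v = 0}"
  by (simp add: cut_out_def dotp_def)

lemma subspace_cut_out: "vec.subspace (cut_out a b)"
  unfolding cut_out_eq by (rule vec.subspaceI) (auto simp: dotp_linear)

lemma dim_Int_cut_out:
  assumes W: "vec.subspace W" "v \<in> W" "w \<in> W" and nz: "minor2 a b v w \<noteq> 0"
  shows "vec.dim W = vec.dim (W \<inter> cut_out a b) + 2"
proof -
  obtain x y where xy: "x \<in> W" "y \<in> W" "dotp a x = 1" "dotp b x = 0" "dotp a y = 0" "dotp b y = 1"
    using minor2_dual_pair[OF assms] by blast
  have "vec.dim W = Suc (vec.dim {w\<in>W. dotp a w = 0})"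
    by (rule dim_Int_kernel[OF W(1) xy(1)]) (simp add: xy)
  also have "vec.dim {w\<in>W. dotp a w = 0} = Suc (vec.dim {w\<in>{w\<in>W. dotp a w = 0}. dotp b w = 0})"
    by (rule dim_Int_kernel[OF subspace_Int_kernel[OF W(1)]]) (use xy in auto)
  also have "{w\<in>{w\<in>W. dotp a w = 0}. dotp b w = 0} = W \<inter> cut_out a b"
    by (auto simp: cut_out_eq)
  finally show ?thesis by simp
qed

text \<open>If all minors vanish, a and b are proportional. Then the kernel of one of them lies in
  \<open>cut_out a b\<close>, whose dimension is therefore at least
  \<open>CARD('n) - 1\<close>.\<close>

lemma cut_out_in_codim2_iff:
  fixes a b :: "'a::field ^ 'n"
  shows "cut_out a b \<in> codim2_subspaces \<longleftrightarrow> (\<exists>v w. minor2 a b v w \<noteq> 0)"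
proof
  assume "\<exists>v w. minor2 a b v w \<noteq> 0"
  then obtain v w where "minor2 a b v w \<noteq> 0" by blast
  from dim_Int_cut_out[OF vec.subspace_UNIV _ _ this]
  show "cut_out a b \<in> codim2_subspaces"
    by (simp add: codim2_subspaces_def subspace_cut_out card_cart_basis)
next
  assume cd: "cut_out a b \<in> codim2_subspaces"
  show "\<exists>v w. minor2 a b v w \<noteq> 0"
  proof (rule ccontr)
    assume "\<not> ?thesis"
    then have z: "dotp a v * dotp b w = dotp a w * dotp b v" for v w
      by (simp add: minor2_def)
    have "\<exists>c. {v. dotp c v = 0} \<subseteq> cut_out a b"
    proof (cases "\<exists>v. dotp a v \<noteq> 0")
      case True
      then obtain v where "dotp a v \<noteq> 0" by blast
      then have "{v. dotp a v = 0} \<subseteq> cut_out a b"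
        using z[of v] by (auto simp: cut_out_eq) (metis mult_eq_0_iff)
      then show ?thesis by blast
    next
      case False
      then have "{v. dotp b v = 0} \<subseteq> cut_out a b" by (auto simp: cut_out_eq)
      then show ?thesis by blast
    qed
    then obtain c where c: "{v. dotp c v = 0} \<subseteq> cut_out a b" by blast
    have "CARD('n) \<le> Suc (vec.dim {v. dotp c v = 0})"
    proof (cases "\<exists>v. dotp c v \<noteq> 0")
      case True
      then obtain v where "dotp c v \<noteq> 0" by blast
      then show ?thesis
        using dim_Int_kernel[OF vec.subspace_UNIV, of v c] by (simp add: card_cart_basis)
    next
      case False
      then have "{v. dotp c v = 0} = UNIV" by auto
      then show ?thesis by (simp add: card_cart_basis)
    qed
    also have "\<dots> \<le> Suc (vec.dim (cut_out a b))"
      using vec.dim_subset[OF c] by simp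
    finally show False
      using cd by (simp add: codim2_subspaces_def)
  qed
qed

lemma codim2_subspace_is_cut_out:
  fixes Q :: "('a::field ^ 'n) set"
  assumes "Q \<in> codim2_subspaces"
  shows "\<exists>a b. Q = cut_out a b"
proof -
  have Q: "vec.subspace Q" and dQ: "vec.dim Q + 2 = CARD('n)"
    using assms by (auto simp: codim2_subspaces_def)
  have "Q \<noteq> UNIV"
    using dQ by (auto simp: card_cart_basis)
  then obtain v where v: "v \<notin> Q" by blast
  obtain a where a: "\<forall>w\<in>Q. dotp a w = 0" "dotp a v = 1"
    using separating_functional[OF Q v] by blast
  \<comment> \<open>The second form is made to vanish at v as well, so that the matrix of (a, b) on
    (v, w) becomes triangular with ones on the diagonal.\<close>
  let ?Q = "vec.span (insert v Q)"
  have "vec.dim ?Q \<le> Suc (vec.dim Q)"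
    by (simp add: vec.dim_insert)
  then have "?Q \<noteq> UNIV"
    using dQ by (auto simp: card_cart_basis vec.dim_UNIV dest: arg_cong[of _ _ vec.dim])
  then obtain w where w: "w \<notin> ?Q" by blast
  obtain b where b: "\<forall>x\<in>?Q. dotp b x = 0" "dotp b w = 1"
    using separating_functional[OF vec.subspace_span w] by blast
  have sub: "Q \<subseteq> cut_out a b"
    using a b vec.span_base[of _ "insert v Q"] by (auto simp: cut_out_eq)
  have "dotp b v = 0" using b vec.span_base[of v "insert v Q"] by blast
  then have "minor2 a b v w \<noteq> 0"
    using a b by (simp add: minor2_def)
  then have "cut_out a b \<in> codim2_subspaces" using cut_out_in_codim2_iff by blast
  then have "vec.dim (cut_out a b) = vec.dim Q"
    using dQ by (simp add: codim2_subspaces_def)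
  then have "Q = cut_out a b"
    using vec.subspace_dim_equal[OF Q subspace_cut_out sub] by simp
  then show ?thesis by blast
qed

section \<open>Projective points and their representatives\<close>

lemma span_singleton_proj_point: "v \<noteq> 0 \<Longrightarrow> vec.span {v} \<in> proj_points"
  by (simp add: proj_points_def)

text \<open>Vanishing of a form at a point does not depend on the nonzero representative, so an
  arbitrary choice allows sets of points to be replaced by sets of vectors.\<close>

definition proj_rep :: "('a::field ^ 'n) set \<Rightarrow> 'a ^ 'n" where
  "proj_rep p = (SOME v. v \<in> p \<and> v \<noteq> 0)"

lemma proj_rep:
  assumes "p \<in> proj_points"
  shows "proj_rep p \<in> p" "proj_rep p \<noteq> 0" "p = vec.span {proj_rep p}"
proof -
  have p: "vec.subspace p" "vec.dim p = 1" using assms by (auto simp: proj_points_def)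
  have "\<exists>v. v \<in> p \<and> v \<noteq> 0"
  proof (rule ccontr)
    assume "\<not> ?thesis"
    then have "p \<subseteq> {0}" by blast
    then show False using p(2) by (metis vec.dim_eq_0 zero_neq_one)
  qed
  then have *: "proj_rep p \<in> p \<and> proj_rep p \<noteq> 0"
    unfolding proj_rep_def by (rule someI_ex)
  then show "proj_rep p \<in> p" "proj_rep p \<noteq> 0" by auto
  have "vec.span {proj_rep p} \<subseteq> p"
    using * p by (intro vec.span_minimal) auto
  then show "p = vec.span {proj_rep p}"
    using vec.subspace_dim_equal[of "vec.span {proj_rep p}" p] * p by simp
qed

lemma inj_on_proj_rep: "inj_on proj_rep proj_points"
  by (rule inj_onI) (metis proj_rep(3))

lemma proj_point_subset_iff:
  "p \<in> proj_points \<Longrightarrow> vec.subspace W \<Longrightarrow> p \<subseteq> W \<longleftrightarrow> proj_rep p \<in> W"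
  using proj_rep[of p] vec.span_minimal[of "{proj_rep p}" W] by auto

lemma proj_point_scale: "p \<in> proj_points \<Longrightarrow> v \<in> p \<Longrightarrow> \<exists>c. v = c *s proj_rep p"
  using proj_rep(3)[of p] vec.span_singleton[of "proj_rep p"] by auto

lemma homogeneous_eval_vec_scale:
  "f \<in> homogeneous_part d \<Longrightarrow> eval_mpoly f (($) (c *s v)) = c ^ d * eval_mpoly f (($) v)"
proof -
  assume "f \<in> homogeneous_part d"
  moreover have "($) (c *s v) = (\<lambda>i. c * v $ i)" by (rule ext) simp
  ultimately show ?thesis using homogeneous_part_eval_scale[of f d c "($) v"] by simp
qed

lemma vanishes_at_iff:
  assumes "f \<in> homogeneous_part d" "p \<in> proj_points"
  shows "vanishes_at f p \<longleftrightarrow> eval_mpoly f (($) (proj_rep p)) = 0"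
  using proj_point_scale[OF assms(2)] proj_rep[OF assms(2)] homogeneous_eval_vec_scale[OF assms(1)]
  unfolding vanishes_at_def by force

lemma vanishing_ideal_vanishes:
  assumes "f \<in> vanishing_ideal Y" "p \<in> Y"
  shows "vanishes_at f p"
proof -
  have "vanishing_ideal Y \<subseteq> {f. vanishes_at f p}"
    unfolding vanishing_ideal_def
    by (rule ideal.span_minimal)
      (use assms(2) in \<open>auto simp: vanishes_at_def ideal.subspace_def\<close>)
  then show ?thesis using assms(1) by blast
qed

lemma vanishing_ideal_homogeneous_iff:
  assumes "f \<in> homogeneous_part d" "Y \<subseteq> proj_points"
  shows "f \<in> vanishing_ideal Y \<longleftrightarrow> (\<forall>v\<in>proj_rep ` Y. eval_mpoly f (($) v) = 0)"
proof
  assume "f \<in> vanishing_ideal Y"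
  then show "\<forall>v\<in>proj_rep ` Y. eval_mpoly f (($) v) = 0"
    using vanishing_ideal_vanishes vanishes_at_iff[OF assms(1)] assms(2) by blast
next
  assume "\<forall>v\<in>proj_rep ` Y. eval_mpoly f (($) v) = 0"
  then have "\<forall>p\<in>Y. vanishes_at f p"
    using vanishes_at_iff[OF assms(1)] assms(2) by blast
  then show "f \<in> vanishing_ideal Y"
    unfolding vanishing_ideal_def using assms(1) by (intro ideal.span_base) blast
qed

section \<open>Forms in the fat ideal and conditions imposed by points\<close>

text \<open>For a linear space \<open>A\<close> and a finite set \<open>I\<close> this is linear
  independence of the evaluation functionals at \<open>I\<close> on \<open>A\<close>, phrased
  through dual functions.\<close>

definition independent_conditions ::
    "('a::field, 'n::finite) mpoly set \<Rightarrow> ('a ^ 'n) set \<Rightarrow> bool" where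
  "independent_conditions A I \<longleftrightarrow>
     (\<forall>p\<in>I. \<exists>f\<in>A. eval_mpoly f (($) p) \<noteq> 0 \<and> (\<forall>q\<in>I - {p}. eval_mpoly f (($) q) = 0))"

definition vanishing_on ::
    "('a::field, 'n::finite) mpoly set \<Rightarrow> ('a ^ 'n) set \<Rightarrow> ('a, 'n) mpoly set" where
  "vanishing_on A V = {f \<in> A. \<forall>v\<in>V. eval_mpoly f (($) v) = 0}"

text \<open>Representatives of a basis of A/B together with a basis of B form a basis of A. In
  particular all sets \<open>S\<close> with \<open>quot_basis A B S\<close> have the same size, so
  the choice made by \<open>quot_dim\<close> is harmless.\<close>

lemma quot_basis_dim:
  assumes A: "mpoly.subspace A" and B: "mpoly.subspace B" "B \<subseteq> A"
    and M: "finite M" "A \<subseteq> mpoly.span M" and S: "quot_basis A B S"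
  shows "mpoly.dim A = mpoly.dim B + card S"
proof -
  have S': "finite S" "S \<subseteq> A"
    "\<And>c s. (\<Sum>s\<in>S. smult_mpoly (c s) s) \<in> B \<Longrightarrow> s \<in> S \<Longrightarrow> c s = 0"
    "\<And>a. a \<in> A \<Longrightarrow> \<exists>c. a - (\<Sum>s\<in>S. smult_mpoly (c s) s) \<in> B"
    using S unfolding quot_basis_def by blast+
  obtain C where C: "C \<subseteq> B" "mpoly.independent C" "B \<subseteq> mpoly.span C"
    using mpoly.maximal_independent_subset by blast
  have finC: "finite C"
    using mpoly.independent_span_bound[OF M(1) C(2)] C(1) B(2) M(2) by blast
  have spC: "mpoly.span C = B"
    using C B(1) by (meson antisym mpoly.span_minimal)
  have disj: "S \<inter> C = {}"
  proof (rule ccontr)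
    assume "S \<inter> C \<noteq> {}"
    then obtain s where s: "s \<in> S" "s \<in> C" by blast
    have "(\<Sum>t\<in>S. smult_mpoly (if t = s then 1 else 0) t) = s"
      using s(1) S'(1) by (simp add: if_distrib[of "\<lambda>c. smult_mpoly c _"] cong: if_cong)
    then show False
      using S'(3)[of "\<lambda>t. if t = s then 1 else 0" s] s C(1) by auto
  qed
  have ind: "mpoly.independent (S \<union> C)"
  proof (rule mpoly.independent_if_scalars_zero)
    fix c x assume z: "(\<Sum>t\<in>S \<union> C. smult_mpoly (c t) t) = 0" and x: "x \<in> S \<union> C"
    have split: "(\<Sum>t\<in>S. smult_mpoly (c t) t) + (\<Sum>t\<in>C. smult_mpoly (c t) t) = 0"
      using z S'(1) finC disj by (simp add: sum.union_disjoint)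
    have "(\<Sum>t\<in>C. smult_mpoly (c t) t) \<in> B"
      unfolding spC[symmetric] by (intro mpoly.span_sum mpoly.span_scale mpoly.span_base)
    then have "- (\<Sum>t\<in>C. smult_mpoly (c t) t) \<in> B"
      using B(1) by (rule mpoly.subspace_neg[rotated])
    then have "(\<Sum>t\<in>S. smult_mpoly (c t) t) \<in> B"
      using split by (simp add: eq_neg_iff_add_eq_0[symmetric])
    then have cS: "c s = 0" if "s \<in> S" for s using S'(3) that by blast
    then have "(\<Sum>t\<in>C. smult_mpoly (c t) t) = 0"
      using split by simp
    then have "c s = 0" if "s \<in> C" for s
      using C(2) finC that mpoly.dependent_finite[OF finC] by blast
    then show "c x = 0" using cS x by blast
  qed (use S'(1) finC in simp)
  have "A \<subseteq> mpoly.span (S \<union> C)"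
  proof
    fix a assume "a \<in> A"
    then obtain c where c: "a - (\<Sum>s\<in>S. smult_mpoly (c s) s) \<in> B" using S'(4) by blast
    then have "a - (\<Sum>s\<in>S. smult_mpoly (c s) s) \<in> mpoly.span (S \<union> C)"
      using spC mpoly.span_mono[of C "S \<union> C"] by blast
    moreover have "(\<Sum>s\<in>S. smult_mpoly (c s) s) \<in> mpoly.span (S \<union> C)"
      by (intro mpoly.span_sum mpoly.span_scale mpoly.span_base) blast
    ultimately have "a - (\<Sum>s\<in>S. smult_mpoly (c s) s) + (\<Sum>s\<in>S. smult_mpoly (c s) s)
        \<in> mpoly.span (S \<union> C)"
      by (rule mpoly.span_add)
    then show "a \<in> mpoly.span (S \<union> C)" by simp
  qed
  moreover have "S \<union> C \<subseteq> A" using S'(2) C(1) B(2) by blast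
  ultimately have "mpoly.dim A = card (S \<union> C)"
    using ind by (intro mpoly.dim_unique) auto
  also have "\<dots> = card S + card C"
    by (rule card_Un_disjoint) (use S'(1) finC disj in auto)
  also have "card C = mpoly.dim B"
    using C by (intro mpoly.basis_card_eq_dim) auto
  finally show ?thesis by simp
qed

text \<open>The dual functions are linearly independent: evaluation of a relation at p leaves only
  the coefficient of the function dual to p.\<close>

lemma independent_conditions_card_le:
  assumes "finite I" "independent_conditions A I" "finite M" "A \<subseteq> mpoly.span M"
  shows "card I \<le> card M"
proof -
  obtain f where f: "\<And>p. p \<in> I \<Longrightarrow> f p \<in> A" "\<And>p. p \<in> I \<Longrightarrow> eval_mpoly (f p) (($) p) \<noteq> 0"
    "\<And>p q. p \<in> I \<Longrightarrow> q \<in> I \<Longrightarrow> q \<noteq> p \<Longrightarrow> eval_mpoly (f p) (($) q) = 0"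
    using assms(2) unfolding independent_conditions_def by (metis Diff_iff singletonD)
  have inj: "inj_on f I"
    by (rule inj_onI) (metis f(2,3))
  have "mpoly.independent (f ` I)"
  proof (rule mpoly.independent_if_scalars_zero)
    fix c x assume z: "(\<Sum>y\<in>f ` I. smult_mpoly (c y) y) = 0" and "x \<in> f ` I"
    then obtain p where p: "p \<in> I" "x = f p" by blast
    have "0 = eval_mpoly (\<Sum>y\<in>f ` I. smult_mpoly (c y) y) (($) p)"
      unfolding z by simp
    also have "\<dots> = (\<Sum>q\<in>I. c (f q) * eval_mpoly (f q) (($) p))"
      by (simp add: sum.reindex[OF inj])
    also have "\<dots> = (\<Sum>q\<in>I. if q = p then c (f p) * eval_mpoly (f p) (($) p) else 0)"
      by (intro sum.cong) (use f(3) p(1) in auto)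
    also have "\<dots> = c (f p) * eval_mpoly (f p) (($) p)"
      using p(1) assms(1) by simp
    finally show "c x = 0" using f(2) p by simp
  qed (use assms(1) in simp)
  then have "card (f ` I) \<le> card M"
    using mpoly.independent_span_bound[OF assms(3)] f(1) assms(4) by blast
  then show ?thesis by (simp add: card_image[OF inj])
qed

text \<open>A maximal set of points imposing independent conditions yields dual polynomials that
  represent a basis of the quotient.\<close>

lemma quot_dim_vanishing_on:
  fixes A :: "('a::field, 'n::finite) mpoly set"
  assumes A: "mpoly.subspace A" "A \<subseteq> homogeneous_part d"
  shows "\<exists>I\<subseteq>V. finite I \<and> independent_conditions A I \<and> vanishing_on A I = vanishing_on A V \<and>
      quot_dim A (vanishing_on A V) = card I"
    and "mpoly.dim A = mpoly.dim (vanishing_on A V) + quot_dim A (vanishing_on A V)"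
    and "I \<subseteq> V \<Longrightarrow> finite I \<Longrightarrow> independent_conditions A I \<Longrightarrow> card I \<le> quot_dim A (vanishing_on A V)"
proof -
  let ?B = "vanishing_on A V"
  obtain M :: "('a, 'n) mpoly set" where M: "finite M" "A \<subseteq> mpoly.span M"
    using homogeneous_part_finite_span[of d] A(2) by blast
  let ?P = "\<lambda>m. \<exists>I\<subseteq>V. finite I \<and> independent_conditions A I \<and> m = card I"
  have "?P 0" by (intro exI[of _ "{}"]) (simp add: independent_conditions_def)
  moreover have bound: "m \<le> card M" if "?P m" for m
    using that independent_conditions_card_le[OF _ _ M] by blast
  ultimately obtain m where m: "?P m" "\<And>m'. ?P m' \<Longrightarrow> m' \<le> m"
    using Nat.ex_has_greatest_nat[of ?P 0 "card M"] by blast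
  then obtain I where I: "I \<subseteq> V" "finite I" "independent_conditions A I" "m = card I" by blast
  have B: "mpoly.subspace ?B" "?B \<subseteq> A"
    using A(1) by (auto simp: vanishing_on_def mpoly.subspace_def)
  have max: "card I' \<le> card I" if "I' \<subseteq> V" "finite I'" "independent_conditions A I'" for I'
    using m(2) that I(4) by blast
  obtain f where f: "\<And>p. p \<in> I \<Longrightarrow> f p \<in> A" "\<And>p. p \<in> I \<Longrightarrow> eval_mpoly (f p) (($) p) \<noteq> 0"
    "\<And>p q. p \<in> I \<Longrightarrow> q \<in> I \<Longrightarrow> q \<noteq> p \<Longrightarrow> eval_mpoly (f p) (($) q) = 0"
    using I(3) unfolding independent_conditions_def by (metis Diff_iff singletonD)
  have inj: "inj_on f I"
    by (rule inj_onI) (metis f(2,3))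
  \<comment> \<open>Maximality of \<open>I\<close>: if g vanishes on I but not at y, then g is dual
    to y, and subtracting multiples of g from the old dual functions makes them vanish at y, so that
    y could be added.\<close>
  have van: "g \<in> ?B" if g: "g \<in> A" "\<And>q. q \<in> I \<Longrightarrow> eval_mpoly g (($) q) = 0" for g
  proof (rule ccontr)
    assume "g \<notin> ?B"
    then obtain y where y: "y \<in> V" "eval_mpoly g (($) y) \<noteq> 0" using g(1) unfolding vanishing_on_def by blast
    then have "y \<notin> I" using g(2) by blast
    have "independent_conditions A (insert y I)"
      unfolding independent_conditions_def
    proof
      fix p assume p: "p \<in> insert y I"
      show "\<exists>h\<in>A. eval_mpoly h (($) p) \<noteq> 0 \<and> (\<forall>q\<in>insert y I - {p}. eval_mpoly h (($) q) = 0)"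
      proof (cases "p = y")
        case True
        then show ?thesis using g y by blast
      next
        case False
        then have pI: "p \<in> I" using p by blast
        let ?h = "f p - smult_mpoly (eval_mpoly (f p) (($) y) / eval_mpoly g (($) y)) g"
        have "?h \<in> A" using A(1) f(1)[OF pI] g(1) by (intro mpoly.subspace_diff mpoly.subspace_scale)
        moreover have "eval_mpoly ?h (($) p) \<noteq> 0" using f(2)[OF pI] g(2)[OF pI] by simp
        moreover have "\<forall>q\<in>insert y I - {p}. eval_mpoly ?h (($) q) = 0"
        proof
          fix q assume "q \<in> insert y I - {p}"
          then show "eval_mpoly ?h (($) q) = 0"
            using f(3)[OF pI, of q] g(2)[of q] y(2) by (cases "q = y") simp_all
        qed
        ultimately show ?thesis by blast
      qed
    qed
    then have "card (insert y I) \<le> card I" using max[of "insert y I"] I y by blast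
    then show False using \<open>y \<notin> I\<close> I(2) by simp
  qed
  have qb: "quot_basis A ?B (f ` I)"
    unfolding quot_basis_def
  proof (intro conjI allI impI ballI)
    show "finite (f ` I)" "f ` I \<subseteq> A" using I(2) f(1) by auto
    have ev: "eval_mpoly (\<Sum>s\<in>f ` I. smult_mpoly (c s) s) (($) p) = c (f p) * eval_mpoly (f p) (($) p)"
      if p: "p \<in> I" for c p
    proof -
      have "eval_mpoly (\<Sum>s\<in>f ` I. smult_mpoly (c s) s) (($) p) = (\<Sum>q\<in>I. c (f q) * eval_mpoly (f q) (($) p))"
        by (simp add: sum.reindex[OF inj])
      also have "\<dots> = (\<Sum>q\<in>I. if q = p then c (f p) * eval_mpoly (f p) (($) p) else 0)"
        by (intro sum.cong) (use f(3) p in auto)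
      also have "\<dots> = c (f p) * eval_mpoly (f p) (($) p)"
        using p I(2) by simp
      finally show ?thesis .
    qed
    {
      fix c s assume c: "(\<Sum>s\<in>f ` I. smult_mpoly (c s) s) \<in> ?B" and "s \<in> f ` I"
      then obtain p where p: "p \<in> I" "s = f p" by blast
      then have "eval_mpoly (\<Sum>s\<in>f ` I. smult_mpoly (c s) s) (($) p) = 0"
        using c I(1) unfolding vanishing_on_def by blast
      then show "c s = 0" using ev[OF p(1), of c] f(2) p by simp
    }
    fix a assume a: "a \<in> A"
    define c where "c s = (let p = the_inv_into I f s in
        eval_mpoly a (($) p) / eval_mpoly (f p) (($) p))" for s
    have c: "c (f p) = eval_mpoly a (($) p) / eval_mpoly (f p) (($) p)" if "p \<in> I" for p
      using that by (simp add: c_def the_inv_into_f_f[OF inj])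
    have "a - (\<Sum>s\<in>f ` I. smult_mpoly (c s) s) \<in> ?B"
    proof (rule van)
      show "a - (\<Sum>s\<in>f ` I. smult_mpoly (c s) s) \<in> A"
        using A(1) a f(1) by (intro mpoly.subspace_diff mpoly.subspace_sum mpoly.subspace_scale) auto
      show "eval_mpoly (a - (\<Sum>s\<in>f ` I. smult_mpoly (c s) s)) (($) q) = 0" if "q \<in> I" for q
        using ev[OF that, of c] c[OF that] f(2)[OF that] by (simp del: eval_mpoly_sum)
    qed
    then show "\<exists>c. a - (\<Sum>s\<in>f ` I. smult_mpoly (c s) s) \<in> ?B" by blast
  qed
  \<comment> \<open>\<open>quot_dim\<close> counts an arbitrary set of representatives. It is
    compared with the dual functions through the dimensions of \<open>A\<close> and
    \<open>?B\<close>.\<close>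
  then have some: "quot_basis A ?B (SOME S. quot_basis A ?B S)" by (rule someI)
  have qd: "quot_dim A ?B = card (SOME S. quot_basis A ?B S)"
    using qb by (auto simp: quot_dim_def)
  show dim: "mpoly.dim A = mpoly.dim ?B + quot_dim A ?B"
    unfolding qd by (rule quot_basis_dim[OF A(1) B M some])
  have "mpoly.dim A = mpoly.dim ?B + card I"
    using quot_basis_dim[OF A(1) B M qb] by (simp add: card_image[OF inj])
  then have qI: "quot_dim A ?B = card I" using dim by simp
  have "vanishing_on A I = ?B"
    using van I(1) unfolding vanishing_on_def by auto
  then show "\<exists>I\<subseteq>V. finite I \<and> independent_conditions A I \<and> vanishing_on A I = ?B \<and> quot_dim A ?B = card I"
    using I qI by blast
  show "I \<subseteq> V \<Longrightarrow> finite I \<Longrightarrow> independent_conditions A I \<Longrightarrow> card I \<le> quot_dim A ?B" for I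
    using max qI by simp
qed

section \<open>Values of the forms in [I(Q)^(d-1)]_d\<close>

definition lin_form :: "'a::field ^ 'n::finite \<Rightarrow> ('a, 'n) mpoly" where
  "lin_form a = (\<Sum>i\<in>UNIV. smult_mpoly (a $ i) (mpoly_var i))"

lemma eval_lin_form [simp]: "eval_mpoly (lin_form a) (($) v) = dotp a v"
  by (simp add: lin_form_def dotp_def)

lemma lin_form_homogeneous: "lin_form a \<in> homogeneous_part 1"
  unfolding lin_form_def by (intro homogeneous_part_sum homogeneous_part_smult homogeneous_part_var)

lemma lin_form_vanishing:
  assumes "\<And>v. v \<in> W \<Longrightarrow> dotp a v = 0"
  shows "lin_form a \<in> vanishing_ideal (points_of W)"
  unfolding vanishing_ideal_def using lin_form_homogeneous assms
  by (intro ideal.span_base) (fastforce simp: vanishes_at_def points_of_def)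

lemma ideal_power_subspace: "ideal.subspace (ideal_power I k)"
  by (cases k) (auto simp: ideal.subspace_UNIV)

lemma ideal_power_mult: "f \<in> I \<Longrightarrow> g \<in> ideal_power I k \<Longrightarrow> f * g \<in> ideal_power I (Suc k)"
  by (auto intro!: ideal.span_base)

lemma ideal_power_power_mult:
  assumes "f \<in> I" "g \<in> I"
  shows "f ^ k * g ^ l \<in> ideal_power I (k + l)"
proof (induction k)
  case 0
  show ?case
  proof (induction l)
    case (Suc l)
    then show ?case using ideal_power_mult[OF assms(2), of "g ^ l" l] by simp
  qed simp
next
  case (Suc k)
  then show ?case using ideal_power_mult[OF assms(1), of "f ^ k * g ^ l" "k + l"] by (simp add: mult.assoc)
qed

text \<open>The forms a^k b^(d-1-k) X_i, indexed by j = (k, i), as functions of the point and of the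
  pair (a, b) alike. Later their dependence on the pair matters as much as that on x.\<close>

definition fat_gen :: "nat \<Rightarrow> nat \<times> 'n \<Rightarrow> 'a::field ^ 'n \<Rightarrow> 'a ^ 'n \<Rightarrow> 'a ^ 'n \<Rightarrow> 'a" where
  "fat_gen d j a b x = dotp a x ^ fst j * dotp b x ^ (d - 1 - fst j) * x $ snd j"

text \<open>One half of the description of [I(Q)^(d-1)]_d by combinations of \<open>fat_gen\<close>;
  the other half is \<open>fat_ideal_eval\<close>. Only values of polynomials are compared, since
  nothing later depends on more.\<close>

lemma fat_gen_combination_realized:
  fixes a b :: "'a::field ^ 'n::finite"
  assumes "d \<ge> 1"
  shows "\<exists>f\<in>graded_part (fat_ideal (cut_out a b) d) d.
    \<forall>x. eval_mpoly f (($) x) = (\<Sum>j\<in>{..<d} \<times> UNIV. c j * fat_gen d j a b x)"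
proof -
  let ?I = "vanishing_ideal (points_of (cut_out a b))"
  let ?t = "\<lambda>j. lin_form a ^ fst j * lin_form b ^ (d - 1 - fst j) * mpoly_var (snd j)"
  let ?f = "\<Sum>j\<in>{..<d} \<times> UNIV. smult_mpoly (c j) (?t j)"
  have ab: "lin_form a \<in> ?I" "lin_form b \<in> ?I"
    by (auto intro!: lin_form_vanishing simp: cut_out_eq)
  have t: "?t j \<in> ideal_power ?I (d - 1)" "?t j \<in> homogeneous_part d" if "j \<in> {..<d} \<times> UNIV" for j
  proof -
    have *: "fst j + (d - 1 - fst j) = d - 1" using that by auto
    have "mpoly_var (snd j) * (lin_form a ^ fst j * lin_form b ^ (d - 1 - fst j)) \<in> ideal_power ?I (d - 1)"
      using ideal_power_power_mult[OF ab, of "fst j" "d - 1 - fst j"]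
      unfolding * by (rule ideal.subspace_scale[OF ideal_power_subspace])
    then show "?t j \<in> ideal_power ?I (d - 1)" by (simp add: mult.commute)
    have "?t j \<in> homogeneous_part (fst j * 1 + (d - 1 - fst j) * 1 + 1)"
      by (intro homogeneous_part_mult homogeneous_part_power lin_form_homogeneous homogeneous_part_var)
    then show "?t j \<in> homogeneous_part d" using * assms by simp
  qed
  have "?f \<in> graded_part (fat_ideal (cut_out a b) d) d"
    unfolding graded_part_def fat_ideal_def
  proof
    show "?f \<in> homogeneous_part d"
      using t(2) by (intro homogeneous_part_sum homogeneous_part_smult)
    show "?f \<in> ideal_power ?I (d - 1)"
      unfolding smult_mpoly_def
      by (rule ideal.subspace_sum[OF ideal_power_subspace])
        (rule ideal.subspace_scale[OF ideal_power_subspace t(1)])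
  qed
  moreover have "eval_mpoly ?f (($) x) = (\<Sum>j\<in>{..<d} \<times> UNIV. c j * fat_gen d j a b x)" for x
    by (simp add: fat_gen_def)
  ultimately show ?thesis by blast
qed

text \<open>The second argument of \<open>f\<close> is the projection of v to Q along w0 and w1. A
  vector and its projection are congruent modulo (a, b), hence so are the values of every
  polynomial. For products one uses fg - f'g' = (f - f')g + f'(g - g').\<close>

lemma eval_mod_cut_out:
  assumes "dotp a w0 = 1" "dotp b w0 = 0" "dotp a w1 = 0" "dotp b w1 = 1"
  shows "\<exists>h1 h2. \<forall>v. eval_mpoly f (($) v) - eval_mpoly f (($) (v - dotp a v *s w0 - dotp b v *s w1)) =
    dotp a v * eval_mpoly h1 (($) v) + dotp b v * eval_mpoly h2 (($) v)"
    (is "\<exists>h1 h2. \<forall>v. _ v - eval_mpoly f (($) (?\<pi> v)) = _ h1 h2 v")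
proof (induction f rule: mpoly_induct)
  case (const c)
  show ?case by (rule exI[of _ 0], rule exI[of _ 0]) simp
next
  case (var i)
  show ?case
    by (rule exI[of _ "Poly_Mapping.single 0 (w0 $ i)"], rule exI[of _ "Poly_Mapping.single 0 (w1 $ i)"]) simp
next
  case (add f g)
  then obtain f1 f2 g1 g2 where
    f: "\<And>v. eval_mpoly f (($) v) - eval_mpoly f (($) (?\<pi> v)) = dotp a v * eval_mpoly f1 (($) v) + dotp b v * eval_mpoly f2 (($) v)" and
    g: "\<And>v. eval_mpoly g (($) v) - eval_mpoly g (($) (?\<pi> v)) = dotp a v * eval_mpoly g1 (($) v) + dotp b v * eval_mpoly g2 (($) v)"
    by blast
  have "eval_mpoly (f + g) (($) v) - eval_mpoly (f + g) (($) (?\<pi> v)) =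
     dotp a v * eval_mpoly (f1 + g1) (($) v) + dotp b v * eval_mpoly (f2 + g2) (($) v)" for v
  proof -
    have "eval_mpoly (f + g) (($) v) - eval_mpoly (f + g) (($) (?\<pi> v)) =
      (eval_mpoly f (($) v) - eval_mpoly f (($) (?\<pi> v))) + (eval_mpoly g (($) v) - eval_mpoly g (($) (?\<pi> v)))"
      by (simp only: eval_mpoly_add add_diff_add)
    also have "\<dots> = dotp a v * eval_mpoly (f1 + g1) (($) v) + dotp b v * eval_mpoly (f2 + g2) (($) v)"
      unfolding f g by (simp add: distrib_left)
    finally show ?thesis .
  qed
  then show ?case by blast
next
  case (mult f g)
  then obtain f1 f2 g1 g2 where
    f: "\<And>v. eval_mpoly f (($) v) - eval_mpoly f (($) (?\<pi> v)) = dotp a v * eval_mpoly f1 (($) v) + dotp b v * eval_mpoly f2 (($) v)" and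
    g: "\<And>v. eval_mpoly g (($) v) - eval_mpoly g (($) (?\<pi> v)) = dotp a v * eval_mpoly g1 (($) v) + dotp b v * eval_mpoly g2 (($) v)"
    by blast
  \<comment> \<open>A polynomial with the values of f after projection. It is needed because the
    factor f' above has to enter the coefficients as a polynomial in v.\<close>
  let ?F = "f - lin_form a * f1 - lin_form b * f2"
  have F: "eval_mpoly f (($) (?\<pi> v)) = eval_mpoly ?F (($) v)" for v
    using f[of v] by (simp add: algebra_simps)
  have "eval_mpoly (f * g) (($) v) - eval_mpoly (f * g) (($) (?\<pi> v)) =
     dotp a v * eval_mpoly (f1 * g + ?F * g1) (($) v) + dotp b v * eval_mpoly (f2 * g + ?F * g2) (($) v)" for v
  proof -
    have "eval_mpoly (f * g) (($) v) - eval_mpoly (f * g) (($) (?\<pi> v)) =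
      (eval_mpoly f (($) v) - eval_mpoly f (($) (?\<pi> v))) * eval_mpoly g (($) v) +
      eval_mpoly f (($) (?\<pi> v)) * (eval_mpoly g (($) v) - eval_mpoly g (($) (?\<pi> v)))"
      by (simp add: algebra_simps)
    also have "\<dots> = dotp a v * eval_mpoly (f1 * g + ?F * g1) (($) v) + dotp b v * eval_mpoly (f2 * g + ?F * g2) (($) v)"
      unfolding f g F by (simp add: algebra_simps)
    finally show ?thesis .
  qed
  then show ?case by blast
qed

text \<open>A generator vanishes at the projection of v to Q, so \<open>eval_mod_cut_out\<close>
  leaves only its part in (a, b).\<close>

lemma vanishing_ideal_cut_out:
  fixes a b :: "'a::field ^ 'n::finite"
  assumes cd: "cut_out a b \<in> codim2_subspaces" and card: "CARD('n) \<ge> 3"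
    and f: "f \<in> vanishing_ideal (points_of (cut_out a b))"
  shows "\<exists>h1 h2. \<forall>v. eval_mpoly f (($) v) =
    dotp a v * eval_mpoly h1 (($) v) + dotp b v * eval_mpoly h2 (($) v)"
proof -
  obtain v w where "minor2 a b v w \<noteq> 0"
    using cd cut_out_in_codim2_iff by blast
  then obtain w0 w1 where w: "dotp a w0 = 1" "dotp b w0 = 0" "dotp a w1 = 0" "dotp b w1 = 1"
    using minor2_dual_pair[OF vec.subspace_UNIV] by blast
  \<comment> \<open>This is where n >= 2 enters: Q must contain a point, since otherwise nonzero
    constants would belong to its ideal. The point also gives vanishing at the zero vector.\<close>
  have "vec.dim (cut_out a b) \<noteq> 0"
    using cd card unfolding codim2_subspaces_def by (auto simp del: vec.dim_eq_0)
  then obtain u where u: "u \<in> cut_out a b" "u \<noteq> 0" by (metis subsetI singletonI vec.dim_eq_0)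
  have zero: "eval_mpoly g (($) v) = 0"
    if g: "\<forall>p\<in>points_of (cut_out a b). vanishes_at g p" and v: "v \<in> cut_out a b" for g v
  proof -
    obtain u' where u': "u' \<in> cut_out a b" "u' \<noteq> 0" "v \<in> vec.span {u'}"
      using u v by (cases "v = 0") (auto intro: vec.span_zero vec.span_base)
    then have "vec.span {u'} \<in> points_of (cut_out a b)"
      using span_singleton_proj_point vec.span_minimal[OF _ subspace_cut_out, of "{u'}"]
      by (auto simp: points_of_def)
    then show ?thesis using g u' by (auto simp: vanishes_at_def)
  qed
  let ?S = "{f. \<exists>h1 h2. \<forall>v. eval_mpoly f (($) v) =
    dotp a v * eval_mpoly h1 (($) v) + dotp b v * eval_mpoly h2 (($) v)}"
  have "vanishing_ideal (points_of (cut_out a b)) \<subseteq> ?S"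
    unfolding vanishing_ideal_def
  proof (rule ideal.span_minimal)
    show "ideal.subspace ?S"
    proof (rule ideal.subspaceI)
      show "0 \<in> ?S" by (auto intro!: exI[of _ 0])
    next
      fix f g assume "f \<in> ?S" "g \<in> ?S"
      then obtain f1 f2 g1 g2 where
        "\<forall>v. eval_mpoly f (($) v) = dotp a v * eval_mpoly f1 (($) v) + dotp b v * eval_mpoly f2 (($) v)"
        "\<forall>v. eval_mpoly g (($) v) = dotp a v * eval_mpoly g1 (($) v) + dotp b v * eval_mpoly g2 (($) v)"
        by blast
      then have "\<forall>v. eval_mpoly (f + g) (($) v) =
          dotp a v * eval_mpoly (f1 + g1) (($) v) + dotp b v * eval_mpoly (f2 + g2) (($) v)"
        by (simp add: algebra_simps)
      then show "f + g \<in> ?S" by blast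
    next
      fix c f assume "f \<in> ?S"
      then obtain f1 f2 where
        "\<forall>v. eval_mpoly f (($) v) = dotp a v * eval_mpoly f1 (($) v) + dotp b v * eval_mpoly f2 (($) v)"
        by blast
      then have "\<forall>v. eval_mpoly (c * f) (($) v) =
          dotp a v * eval_mpoly (c * f1) (($) v) + dotp b v * eval_mpoly (c * f2) (($) v)"
        by (simp add: algebra_simps)
      then show "c * f \<in> ?S" by blast
    qed
    show "{f. (\<exists>k. f \<in> homogeneous_part k) \<and> (\<forall>p\<in>points_of (cut_out a b). vanishes_at f p)} \<subseteq> ?S"
    proof safe
      fix f k assume "\<forall>p\<in>points_of (cut_out a b). vanishes_at f p"
      then have "eval_mpoly f (($) (v - dotp a v *s w0 - dotp b v *s w1)) = 0" for v
        by (rule zero) (simp add: cut_out_eq dotp_linear w)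
      then show "\<exists>h1 h2. \<forall>v. eval_mpoly f (($) v) =
          dotp a v * eval_mpoly h1 (($) v) + dotp b v * eval_mpoly h2 (($) v)"
        using eval_mod_cut_out[OF w, of f] by simp
    qed
  qed
  then show ?thesis using f by blast
qed

lemma ideal_power_eval:
  assumes I: "\<And>g. g \<in> I \<Longrightarrow> \<exists>h1 h2. \<forall>v. eval_mpoly g (($) v) =
    dotp a v * eval_mpoly h1 (($) v) + dotp b v * eval_mpoly h2 (($) v)"
    and f: "f \<in> ideal_power I k"
  shows "\<exists>h. \<forall>v. eval_mpoly f (($) v) =
    (\<Sum>j\<le>k. dotp a v ^ j * dotp b v ^ (k - j) * eval_mpoly (h j) (($) v))"
  using f
proof (induction k arbitrary: f)
  case 0
  show ?case by (rule exI[of _ "\<lambda>_. f"]) simp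
next
  case (Suc k)
  let ?S = "{f. \<exists>h. \<forall>v. eval_mpoly f (($) v) =
    (\<Sum>j\<le>Suc k. dotp a v ^ j * dotp b v ^ (Suc k - j) * eval_mpoly (h j) (($) v))}"
  have "ideal_power I (Suc k) \<subseteq> ?S"
    unfolding ideal_power.simps
  proof (rule ideal.span_minimal)
    show "ideal.subspace ?S"
    proof (rule ideal.subspaceI)
      show "0 \<in> ?S" by (auto intro!: exI[of _ "\<lambda>_. 0"])
    next
      fix f g assume "f \<in> ?S" "g \<in> ?S"
      then obtain h h' where
        "\<forall>v. eval_mpoly f (($) v) = (\<Sum>j\<le>Suc k. dotp a v ^ j * dotp b v ^ (Suc k - j) * eval_mpoly (h j) (($) v))"
        "\<forall>v. eval_mpoly g (($) v) = (\<Sum>j\<le>Suc k. dotp a v ^ j * dotp b v ^ (Suc k - j) * eval_mpoly (h' j) (($) v))"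
        by blast
      then have "\<forall>v. eval_mpoly (f + g) (($) v) =
        (\<Sum>j\<le>Suc k. dotp a v ^ j * dotp b v ^ (Suc k - j) * eval_mpoly (h j + h' j) (($) v))"
        by (simp only: eval_mpoly_add distrib_left sum.distrib) simp
      then show "f + g \<in> ?S" by (intro CollectI exI[of _ "\<lambda>j. h j + h' j"])
    next
      fix c f assume "f \<in> ?S"
      then obtain h where
        "\<forall>v. eval_mpoly f (($) v) = (\<Sum>j\<le>Suc k. dotp a v ^ j * dotp b v ^ (Suc k - j) * eval_mpoly (h j) (($) v))"
        by blast
      then have "\<forall>v. eval_mpoly (c * f) (($) v) =
        (\<Sum>j\<le>Suc k. dotp a v ^ j * dotp b v ^ (Suc k - j) * eval_mpoly (c * h j) (($) v))"
        by (simp only: eval_mpoly_mult sum_distrib_left mult.left_commute) simp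
      then show "c * f \<in> ?S" by (intro CollectI exI[of _ "\<lambda>j. c * h j"])
    qed
    show "{f * g |f g. f \<in> I \<and> g \<in> ideal_power I k} \<subseteq> ?S"
    proof safe
      fix f g assume "f \<in> I" and g: "g \<in> ideal_power I k"
      obtain h1 h2 where f: "\<And>v. eval_mpoly f (($) v) =
          dotp a v * eval_mpoly h1 (($) v) + dotp b v * eval_mpoly h2 (($) v)"
        using I[OF \<open>f \<in> I\<close>] by blast
      obtain h where g: "\<And>v. eval_mpoly g (($) v) =
          (\<Sum>j\<le>k. dotp a v ^ j * dotp b v ^ (k - j) * eval_mpoly (h j) (($) v))"
        using Suc.IH[OF g] by blast
      \<comment> \<open>Multiplying by a raises the exponent of a, so the coefficients from
        \<open>h1\<close> are shifted by one. Multiplying by b leaves it alone. The case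
        distinctions pad both families with zero.\<close>
      let ?p = "\<lambda>j. if j = 0 then 0 else h1 * h (j - 1)"
      let ?q = "\<lambda>j. if j \<le> k then h2 * h j else 0"
      have "eval_mpoly (f * g) (($) v) =
        (\<Sum>j\<le>Suc k. dotp a v ^ j * dotp b v ^ (Suc k - j) * eval_mpoly (?p j + ?q j) (($) v))" for v
      proof -
        let ?A = "dotp a v" and ?B = "dotp b v" and ?e = "\<lambda>f. eval_mpoly f (($) v)"
        have 1: "?A * ?e h1 * (\<Sum>j\<le>k. ?A ^ j * ?B ^ (k - j) * ?e (h j)) =
          (\<Sum>j\<le>Suc k. ?A ^ j * ?B ^ (Suc k - j) * ?e (?p j))"
          by (subst sum.atMost_Suc_shift) (simp add: sum_distrib_left algebra_simps)
        have "?B * ?e h2 * (\<Sum>j\<le>k. ?A ^ j * ?B ^ (k - j) * ?e (h j)) =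
          (\<Sum>j\<le>k. ?A ^ j * ?B ^ (Suc k - j) * ?e (?q j))"
          unfolding sum_distrib_left by (intro sum.cong refl) (simp add: Suc_diff_le algebra_simps)
        also have "\<dots> = (\<Sum>j\<le>Suc k. ?A ^ j * ?B ^ (Suc k - j) * ?e (?q j))"
          by simp
        finally have 2: "?B * ?e h2 * (\<Sum>j\<le>k. ?A ^ j * ?B ^ (k - j) * ?e (h j)) = \<dots>" .
        show ?thesis
          unfolding eval_mpoly_mult f g eval_mpoly_add distrib_left distrib_right sum.distrib 1 2 ..
      qed
      then show "\<exists>h. \<forall>v. eval_mpoly (f * g) (($) v) =
        (\<Sum>j\<le>Suc k. dotp a v ^ j * dotp b v ^ (Suc k - j) * eval_mpoly (h j) (($) v))"
        by (intro exI[of _ "\<lambda>j. ?p j + ?q j"]) blast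
    qed
  qed
  then show ?case using Suc.prems by blast
qed

text \<open>The form c is the linear part of h at the origin; the product case is the Leibniz
  rule.\<close>

lemma eval_linear_coeff:
  "\<exists>c. \<forall>v. \<exists>P. (\<forall>s. eval_mpoly h (($) (s *s v)) = poly P s) \<and> coeff P 1 = dotp c v"
proof (induction h rule: mpoly_induct)
  case (const c)
  show ?case by (intro exI[of _ 0] allI exI[of _ "[:c:]"]) simp
next
  case (var i)
  have "\<exists>P. (\<forall>s. eval_mpoly (mpoly_var i) (($) (s *s v)) = poly P s) \<and> coeff P 1 = dotp (axis i 1) v" for v :: "'a ^ 'b"
    by (intro exI[of _ "[:0, v $ i:]"]) simp
  then show ?case by blast
next
  case (add f g)
  then obtain c c' where
    f: "\<And>v. \<exists>P. (\<forall>s. eval_mpoly f (($) (s *s v)) = poly P s) \<and> coeff P 1 = dotp c v" and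
    g: "\<And>v. \<exists>P. (\<forall>s. eval_mpoly g (($) (s *s v)) = poly P s) \<and> coeff P 1 = dotp c' v" by blast
  show ?case
  proof (intro exI[of _ "c + c'"] allI)
    fix v
    obtain P Q where "\<forall>s. eval_mpoly f (($) (s *s v)) = poly P s" "coeff P 1 = dotp c v"
      "\<forall>s. eval_mpoly g (($) (s *s v)) = poly Q s" "coeff Q 1 = dotp c' v" using f[of v] g[of v] by blast
    then show "\<exists>P. (\<forall>s. eval_mpoly (f + g) (($) (s *s v)) = poly P s) \<and> coeff P 1 = dotp (c + c') v"
      by (intro exI[of _ "P + Q"]) (simp add: dotp_add_left)
  qed
next
  case (mult f g)
  then obtain c c' where
    f: "\<And>v. \<exists>P. (\<forall>s. eval_mpoly f (($) (s *s v)) = poly P s) \<and> coeff P 1 = dotp c v" and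
    g: "\<And>v. \<exists>P. (\<forall>s. eval_mpoly g (($) (s *s v)) = poly P s) \<and> coeff P 1 = dotp c' v" by blast
  let ?c = "eval_mpoly f (($) 0) *s c' + eval_mpoly g (($) 0) *s c"
  show ?case
  proof (intro exI[of _ ?c] allI)
    fix v
    obtain P Q where P: "\<forall>s. eval_mpoly f (($) (s *s v)) = poly P s" "coeff P 1 = dotp c v"
      and Q: "\<forall>s. eval_mpoly g (($) (s *s v)) = poly Q s" "coeff Q 1 = dotp c' v" using f[of v] g[of v] by blast
    have "coeff P 0 = eval_mpoly f (($) 0)" "coeff Q 0 = eval_mpoly g (($) 0)"
      using P(1)[rule_format, of 0] Q(1)[rule_format, of 0] by (simp_all add: poly_0_coeff_0)
    then have "coeff (P * Q) 1 = dotp ?c v"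
      using P(2) Q(2) by (simp add: coeff_mult dotp_linear)
    then show "\<exists>P. (\<forall>s. eval_mpoly (f * g) (($) (s *s v)) = poly P s) \<and> coeff P 1 = dotp ?c v"
      using P(1) Q(1) by (intro exI[of _ "P * Q"]) simp
  qed
qed

text \<open>The expansion from \<open>ideal_power_eval\<close> has coefficients h_k of any degree.
  Replacing v by s v, the left side becomes s^d f(v), and each summand on the right is s^(d-1) times
  a^k b^(d-1-k) h_k(s v). Comparing coefficients of s^d replaces h_k by its linear part.\<close>

lemma fat_ideal_eval:
  fixes a b :: "'a::alg_closed_field ^ 'n::finite"
  assumes cd: "cut_out a b \<in> codim2_subspaces" and card: "CARD('n) \<ge> 3" and d: "d \<ge> 1"
    and f: "f \<in> graded_part (fat_ideal (cut_out a b) d) d"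
  shows "\<exists>c. \<forall>x. eval_mpoly f (($) x) = (\<Sum>j\<in>{..<d} \<times> UNIV. c j * fat_gen d j a b x)"
proof -
  obtain h where h: "\<And>v. eval_mpoly f (($) v) =
      (\<Sum>k\<le>d - 1. dotp a v ^ k * dotp b v ^ (d - 1 - k) * eval_mpoly (h k) (($) v))"
    using ideal_power_eval[OF vanishing_ideal_cut_out[OF cd card], where f = f and k = "d - 1"] f
    unfolding graded_part_def fat_ideal_def by blast
  have le: "{..d - 1} = {..<d}" using d by auto
  obtain c where c: "\<And>k v. \<exists>P. (\<forall>s. eval_mpoly (h k) (($) (s *s v)) = poly P s) \<and> coeff P 1 = dotp (c k) v"
    using eval_linear_coeff[of "h _"] by metis
  have "eval_mpoly f (($) v) = (\<Sum>k<d. dotp a v ^ k * dotp b v ^ (d - 1 - k) * dotp (c k) v)" for v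
  proof -
    have "\<forall>k. \<exists>P. (\<forall>s. eval_mpoly (h k) (($) (s *s v)) = poly P s) \<and> coeff P 1 = dotp (c k) v"
      using c by blast
    from choice[OF this] obtain P where
      P: "\<And>k s. eval_mpoly (h k) (($) (s *s v)) = poly (P k) s" "\<And>k. coeff (P k) 1 = dotp (c k) v"
      by blast
    let ?Q = "\<Sum>k<d. smult (dotp a v ^ k * dotp b v ^ (d - 1 - k)) (P k)"
    have "poly (monom (eval_mpoly f (($) v)) d - monom 1 (d - 1) * ?Q) s = 0" for s
    proof -
      have "s ^ d * eval_mpoly f (($) v) = eval_mpoly f (($) (s *s v))"
        using f homogeneous_eval_vec_scale by (force simp: graded_part_def)
      also have "\<dots> = (\<Sum>k<d. s ^ (d - 1) * (dotp a v ^ k * dotp b v ^ (d - 1 - k) * poly (P k) s))"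
        unfolding h le
      proof (intro sum.cong refl)
        fix k assume "k \<in> {..<d}"
        then have "s ^ (d - 1) = s ^ k * s ^ (d - 1 - k)"
          by (simp flip: power_add)
        then show "dotp a (s *s v) ^ k * dotp b (s *s v) ^ (d - 1 - k) * eval_mpoly (h k) (($) (s *s v)) =
          s ^ (d - 1) * (dotp a v ^ k * dotp b v ^ (d - 1 - k) * poly (P k) s)"
          unfolding P by (simp add: dotp_scale_right power_mult_distrib mult_ac)
      qed
      finally show ?thesis
        by (simp add: poly_monom poly_sum sum_distrib_left mult_ac)
    qed
    then have "monom (eval_mpoly f (($) v)) d - monom 1 (d - 1) * ?Q = 0"
      by (rule poly_zero_if_all_zero)
    then have "coeff (monom (eval_mpoly f (($) v)) d) d = coeff (monom 1 (d - 1) * ?Q) d"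
      by simp
    then show ?thesis
      using d P(2) by (simp add: coeff_monom_mult coeff_sum)
  qed
  then have "eval_mpoly f (($) x) = (\<Sum>j\<in>{..<d} \<times> UNIV. c (fst j) $ snd j * fat_gen d j a b x)" for x
    by (simp add: dotp_def[of "c _"] fat_gen_def sum.cartesian_product' sum_distrib_left mult_ac)
  then show ?thesis by (intro exI[of _ "\<lambda>j. c (fst j) $ snd j"]) blast
qed

lemma subspace_graded_fat: "mpoly.subspace (graded_part (fat_ideal Q d) d)"
proof (rule mpoly.subspaceI)
  have s: "ideal.subspace (fat_ideal Q d)" unfolding fat_ideal_def by (rule ideal_power_subspace)
  show "0 \<in> graded_part (fat_ideal Q d) d"
    using ideal.subspace_0[OF s] by (simp add: graded_part_def)
  show "x + y \<in> graded_part (fat_ideal Q d) d"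
    if "x \<in> graded_part (fat_ideal Q d) d" "y \<in> graded_part (fat_ideal Q d) d" for x y
    using ideal.subspace_add[OF s] that homogeneous_part_add by (auto simp: graded_part_def)
  show "smult_mpoly c x \<in> graded_part (fat_ideal Q d) d"
    if "x \<in> graded_part (fat_ideal Q d) d" for c x
    using ideal.subspace_scale[OF s] that homogeneous_part_smult
    by (auto simp: graded_part_def smult_mpoly_def)
qed

lemma graded_part_vanishing_Int:
  assumes "Y \<subseteq> proj_points"
  shows "graded_part (vanishing_ideal Y \<inter> A) d = vanishing_on (graded_part A d) (proj_rep ` Y)"
  using vanishing_ideal_homogeneous_iff[OF _ assms, of _ d]
  by (auto simp: graded_part_def vanishing_on_def)

section \<open>General subspaces of codimension two\<close>

text \<open>The coordinates of a pair are indexed as in \<open>open_codim2\<close>, so that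
  non-vanishing of such a function describes an open condition on Q. As with
  \<open>poly_fun\<close>, functions are used to obtain closure rules.\<close>

definition pair_poly :: "('a::field ^ 'n::finite \<Rightarrow> 'a ^ 'n \<Rightarrow> 'a) \<Rightarrow> bool" where
  "pair_poly \<phi> \<longleftrightarrow> (\<exists>f. \<forall>a b. \<phi> a b = eval_mpoly f (case_sum (($) a) (($) b)))"

lemma pair_poly_const [intro, simp]: "pair_poly (\<lambda>a b. c)"
  unfolding pair_poly_def by (rule exI[of _ "Poly_Mapping.single 0 c"]) simp

lemma pair_poly_fst [intro, simp]: "pair_poly (\<lambda>a b. a $ i)"
  unfolding pair_poly_def by (rule exI[of _ "mpoly_var (Inl i)"]) simp

lemma pair_poly_snd [intro, simp]: "pair_poly (\<lambda>a b. b $ i)"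
  unfolding pair_poly_def by (rule exI[of _ "mpoly_var (Inr i)"]) simp

lemma pair_poly_add [intro]: "pair_poly \<phi> \<Longrightarrow> pair_poly \<psi> \<Longrightarrow> pair_poly (\<lambda>a b. \<phi> a b + \<psi> a b)"
  unfolding pair_poly_def by (metis eval_mpoly_add)

lemma pair_poly_diff [intro]: "pair_poly \<phi> \<Longrightarrow> pair_poly \<psi> \<Longrightarrow> pair_poly (\<lambda>a b. \<phi> a b - \<psi> a b)"
  unfolding pair_poly_def by (metis eval_mpoly_diff)

lemma pair_poly_mult [intro]: "pair_poly \<phi> \<Longrightarrow> pair_poly \<psi> \<Longrightarrow> pair_poly (\<lambda>a b. \<phi> a b * \<psi> a b)"
  unfolding pair_poly_def by (metis eval_mpoly_mult)

lemma pair_poly_power [intro]: "pair_poly \<phi> \<Longrightarrow> pair_poly (\<lambda>a b. \<phi> a b ^ k)"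
  by (induction k) auto

lemma pair_poly_sum [intro]: "(\<And>i. i \<in> A \<Longrightarrow> pair_poly (\<phi> i)) \<Longrightarrow> pair_poly (\<lambda>a b. \<Sum>i\<in>A. \<phi> i a b)"
  by (induction A rule: infinite_finite_induct) auto

lemma pair_poly_dotp [intro, simp]: "pair_poly (\<lambda>a b. dotp a x)" "pair_poly (\<lambda>a b. dotp b x)"
  unfolding dotp_def
  by (intro pair_poly_sum pair_poly_mult pair_poly_fst pair_poly_snd pair_poly_const)+

lemma pair_poly_fat_gen [intro, simp]: "pair_poly (\<lambda>a b. fat_gen d j a b x)"
  unfolding fat_gen_def by (intro pair_poly_mult pair_poly_power pair_poly_dotp pair_poly_const)

lemma pair_poly_minor2 [intro, simp]: "pair_poly (\<lambda>a b. minor2 a b v w)"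
  unfolding minor2_def by (intro pair_poly_diff pair_poly_mult pair_poly_dotp)

lemmas pair_poly_intros = pair_poly_add pair_poly_diff pair_poly_mult pair_poly_power pair_poly_sum
  pair_poly_fst pair_poly_snd pair_poly_dotp pair_poly_fat_gen pair_poly_minor2 pair_poly_const

lemma pair_poly_subst:
  assumes "pair_poly \<phi>"
  shows "pair_poly (\<lambda>a b. \<phi> (\<alpha> *s a + \<beta> *s b) (\<gamma> *s a + \<delta> *s b))"
proof -
  have "pair_poly (\<lambda>a b. eval_mpoly f (case_sum (($) (\<alpha> *s a + \<beta> *s b)) (($) (\<gamma> *s a + \<delta> *s b))))" for f
  proof (induction f rule: mpoly_induct)
    case (var i)
    show ?case
      by (cases i) (simp_all, intro pair_poly_intros, intro pair_poly_intros)
  qed (simp_all add: pair_poly_intros)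
  then show ?thesis using assms by (auto simp: pair_poly_def)
qed

lemma poly_fun_vec:
  assumes "\<And>i. poly_fun (\<lambda>s. A s $ i)" "\<And>i. poly_fun (\<lambda>s. B s $ i)" "pair_poly \<phi>"
  shows "poly_fun (\<lambda>s. \<phi> (A s) (B s))"
proof -
  obtain f where f: "\<And>a b. \<phi> a b = eval_mpoly f (case_sum (($) a) (($) b))"
    using assms(3) unfolding pair_poly_def by blast
  have "poly_fun (\<lambda>s. case_sum (($) (A s)) (($) (B s)) i)" for i
    using assms by (cases i) auto
  then show ?thesis unfolding f by (rule poly_fun_eval_mpoly)
qed

text \<open>Irreducibility of the space of pairs, by restriction to the line joining the two given
  pairs.\<close>

lemma pair_poly_common_nonzero:
  fixes \<phi> \<psi> :: "'a::alg_closed_field ^ 'n::finite \<Rightarrow> 'a ^ 'n \<Rightarrow> 'a"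
  assumes "pair_poly \<phi>" "pair_poly \<psi>" "\<phi> a b \<noteq> 0" "\<psi> a' b' \<noteq> 0"
  shows "\<exists>x y. \<phi> x y \<noteq> 0 \<and> \<psi> x y \<noteq> 0"
proof -
  let ?A = "\<lambda>s. a + s *s (a' - a)" and ?B = "\<lambda>s. b + s *s (b' - b)"
  have line: "poly_fun (\<lambda>s. (x + s *s y) $ i)" for x y :: "'a ^ 'n" and i
    unfolding vector_add_component vector_smult_component
    by (intro poly_fun_add poly_fun_mult poly_fun_ident poly_fun_const)
  have "poly_fun (\<lambda>s. \<phi> (?A s) (?B s))"
    by (rule poly_fun_vec[OF line line assms(1)])
  moreover have "poly_fun (\<lambda>s. \<psi> (?A s) (?B s))"
    by (rule poly_fun_vec[OF line line assms(2)])
  moreover have "\<phi> (?A 0) (?B 0) \<noteq> 0" "\<psi> (?A 1) (?B 1) \<noteq> 0"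
    using assms by auto
  ultimately show ?thesis
    using poly_fun_two_nonzero[of "\<lambda>s. \<phi> (?A s) (?B s)" "\<lambda>s. \<psi> (?A s) (?B s)" 0 1] by blast
qed

lemma dotp_ext: "(\<And>u. dotp a u = dotp b u) \<Longrightarrow> a = b"
proof -
  have "dotp c (axis i 1) = c $ i" for c :: "'a ^ 'b" and i
    by (simp add: dotp_def axis_def if_distrib[of "\<lambda>x. _ * x"] cong: if_cong)
  then show "(\<And>u. dotp a u = dotp b u) \<Longrightarrow> a = b" by (metis vec_eq_iff)
qed

lemma minor2_comb:
  "minor2 (\<alpha> *s a + \<beta> *s b) (\<gamma> *s a + \<delta> *s b) v w = (\<alpha> * \<delta> - \<beta> * \<gamma>) * minor2 a b v w"
  by (simp add: minor2_def dotp_linear algebra_simps)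

text \<open>A form vanishing on Q is determined by its values on a dual pair x, y, hence is a
  combination of a and b. By \<open>minor2_comb\<close> a nonzero minor of the new pair forces a
  nonzero determinant.\<close>

lemma cut_out_eq_imp_comb:
  assumes eq: "cut_out a' b' = cut_out a b" and cd: "cut_out a b \<in> codim2_subspaces"
  shows "\<exists>\<alpha> \<beta> \<gamma> \<delta>. \<alpha> * \<delta> - \<beta> * \<gamma> \<noteq> 0 \<and> a' = \<alpha> *s a + \<beta> *s b \<and> b' = \<gamma> *s a + \<delta> *s b"
proof -
  obtain v w where "minor2 a b v w \<noteq> 0" using cd cut_out_in_codim2_iff by blast
  then obtain x y where xy: "dotp a x = 1" "dotp b x = 0" "dotp a y = 0" "dotp b y = 1"
    using minor2_dual_pair[OF vec.subspace_UNIV] by blast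
  have comb: "c = dotp c x *s a + dotp c y *s b" if c: "\<And>u. u \<in> cut_out a b \<Longrightarrow> dotp c u = 0" for c
  proof (rule dotp_ext)
    fix u
    have "u - dotp a u *s x - dotp b u *s y \<in> cut_out a b"
      by (simp add: cut_out_eq dotp_linear xy)
    from c[OF this] show "dotp c u = dotp (dotp c x *s a + dotp c y *s b) u"
      by (simp add: dotp_linear algebra_simps)
  qed
  have sub: "dotp a' u = 0" "dotp b' u = 0" if "u \<in> cut_out a b" for u
    using that unfolding eq[symmetric] by (simp_all add: cut_out_eq)
  have a': "a' = dotp a' x *s a + dotp a' y *s b"
    by (rule comb[OF sub(1)])
  have b': "b' = dotp b' x *s a + dotp b' y *s b"
    by (rule comb[OF sub(2)])
  obtain v' w' where "minor2 a' b' v' w' \<noteq> 0" using cd eq cut_out_in_codim2_iff by metis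
  then have "dotp a' x * dotp b' y - dotp a' y * dotp b' x \<noteq> 0"
    using minor2_comb[of "dotp a' x" a "dotp a' y" b "dotp b' x" "dotp b' y" v' w'] a' b' by auto
  then show ?thesis using a' b' by blast
qed

lemma cut_out_comb:
  assumes "\<alpha> * \<delta> - \<beta> * \<gamma> \<noteq> 0"
  shows "cut_out (\<alpha> *s a + \<beta> *s b) (\<gamma> *s a + \<delta> *s b) = cut_out a b"
proof -
  have "dotp a v = 0 \<and> dotp b v = 0"
    if "\<alpha> * dotp a v + \<beta> * dotp b v = 0" "\<gamma> * dotp a v + \<delta> * dotp b v = 0" for v
  proof -
    have "(\<alpha> * \<delta> - \<beta> * \<gamma>) * dotp a v =
        \<delta> * (\<alpha> * dotp a v + \<beta> * dotp b v) - \<beta> * (\<gamma> * dotp a v + \<delta> * dotp b v)"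
      "(\<alpha> * \<delta> - \<beta> * \<gamma>) * dotp b v =
        \<alpha> * (\<gamma> * dotp a v + \<delta> * dotp b v) - \<gamma> * (\<alpha> * dotp a v + \<beta> * dotp b v)"
      by (simp_all add: algebra_simps)
    then show ?thesis using that assms by simp
  qed
  then show ?thesis by (auto simp: cut_out_eq dotp_linear)
qed

text \<open>The open set obtained from a polynomial condition \<open>D \<noteq> 0\<close> on pairs of linear forms consists
  of the subspaces that are cut out by some pair satisfying it, hence the action of \<open>GL\<^sub>2\<close>.\<close>

lemma for_general_codim2_iff:
  fixes P :: "('a::alg_closed_field ^ 'n::finite) set \<Rightarrow> bool"
  assumes card: "CARD('n) \<ge> 2"
  shows "for_general_codim2 P \<longleftrightarrow> (\<exists>D. pair_poly D \<and> (\<exists>a b. D a b \<noteq> 0) \<and>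
    (\<forall>a b. cut_out a b \<in> codim2_subspaces \<longrightarrow> D a b \<noteq> 0 \<longrightarrow> P (cut_out a b)))"
proof
  assume "for_general_codim2 P"
  then obtain G where G: "open_codim2 G" "G \<noteq> {}" "\<And>Q. Q \<in> G \<Longrightarrow> P Q"
    unfolding for_general_codim2_def by blast
  obtain F :: "('a, 'n + 'n) mpoly set" where sub: "G \<subseteq> codim2_subspaces" and
    F: "\<And>a b. cut_out a b \<in> codim2_subspaces \<Longrightarrow>
      cut_out a b \<in> G \<longleftrightarrow> (\<exists>f\<in>F. eval_mpoly f (case_sum (($) a) (($) b)) \<noteq> 0)"
    using G(1) unfolding open_codim2_def by blast
  obtain a b where ab: "cut_out a b \<in> G"
    using G(2) sub codim2_subspace_is_cut_out by fast
  then obtain f where f: "f \<in> F" "eval_mpoly f (case_sum (($) a) (($) b)) \<noteq> 0"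
    using F sub by blast
  show "\<exists>D. pair_poly D \<and> (\<exists>a b. D a b \<noteq> 0) \<and>
    (\<forall>a b. cut_out a b \<in> codim2_subspaces \<longrightarrow> D a b \<noteq> 0 \<longrightarrow> P (cut_out a b))"
  proof (intro exI[of _ "\<lambda>a b. eval_mpoly f (case_sum (($) a) (($) b))"] conjI allI impI)
    show "pair_poly (\<lambda>a b. eval_mpoly f (case_sum (($) a) (($) b)))"
      by (auto simp: pair_poly_def)
    show "\<exists>a b. eval_mpoly f (case_sum (($) a) (($) b)) \<noteq> 0" using f(2) by blast
    show "P (cut_out a b)" if "cut_out a b \<in> codim2_subspaces"
      "eval_mpoly f (case_sum (($) a) (($) b)) \<noteq> 0" for a b
      using F[OF that(1)] f(1) that(2) G(3) by blast
  qed
next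
  assume "\<exists>D. pair_poly D \<and> (\<exists>a b. D a b \<noteq> 0) \<and>
    (\<forall>a b. cut_out a b \<in> codim2_subspaces \<longrightarrow> D a b \<noteq> 0 \<longrightarrow> P (cut_out a b))"
  then obtain D a0 b0 where D: "pair_poly D" "D a0 b0 \<noteq> 0" and
    P: "\<And>a b. cut_out a b \<in> codim2_subspaces \<Longrightarrow> D a b \<noteq> 0 \<Longrightarrow> P (cut_out a b)"
    by blast
  define G where "G = {cut_out a b | a b. cut_out a b \<in> codim2_subspaces \<and> D a b \<noteq> 0}"
  obtain i j :: 'n where "i \<noteq> j"
    using card by (metis One_nat_def card_le_Suc0_iff_eq finite not_less_eq_eq numeral_2_eq_2 UNIV_I)
  \<comment> \<open>Some pair cuts out codimension 2. A pair that in addition satisfies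
    \<open>D a b \<noteq> 0\<close> then makes \<open>G\<close> nonempty.\<close>
  have "minor2 (axis i 1) (axis j 1) (axis i 1) (axis j 1) \<noteq> (0 :: 'a)"
    unfolding minor2_def dotp_axis using \<open>i \<noteq> j\<close> by (simp add: axis_def)
  then obtain a1 b1 v w where "D a1 b1 \<noteq> 0" "minor2 a1 b1 v w \<noteq> 0"
    using pair_poly_common_nonzero[OF D(1) pair_poly_minor2 D(2)] by blast
  then have "cut_out a1 b1 \<in> G"
    using cut_out_in_codim2_iff unfolding G_def by blast
  moreover have "open_codim2 G"
    unfolding open_codim2_def
  proof (intro conjI exI allI impI)
    show "G \<subseteq> codim2_subspaces" unfolding G_def by blast
    \<comment> \<open>All pullbacks of D along invertible changes of the pair: D may vanish at one
      pair cutting out a member of \<open>G\<close> and not at another, but membership must be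
      visible from every pair.\<close>
    let ?F = "{f :: ('a, 'n + 'n) mpoly. \<exists>\<alpha> \<beta> \<gamma> \<delta>. \<alpha> * \<delta> - \<beta> * \<gamma> \<noteq> 0 \<and>
      (\<forall>a b. eval_mpoly f (case_sum (($) a) (($) b)) = D (\<alpha> *s a + \<beta> *s b) (\<gamma> *s a + \<delta> *s b))}"
    fix a b :: "'a ^ 'n"
    assume cd: "cut_out a b \<in> codim2_subspaces"
    show "cut_out a b \<in> G \<longleftrightarrow> (\<exists>f\<in>?F. eval_mpoly f (case_sum (($) a) (($) b)) \<noteq> 0)"
    proof
      assume "cut_out a b \<in> G"
      then obtain a' b' where ab': "cut_out a' b' = cut_out a b" "D a' b' \<noteq> 0"
        unfolding G_def by auto
      obtain \<alpha> \<beta> \<gamma> \<delta> where M: "\<alpha> * \<delta> - \<beta> * \<gamma> \<noteq> 0" "a' = \<alpha> *s a + \<beta> *s b" "b' = \<gamma> *s a + \<delta> *s b"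
        using cut_out_eq_imp_comb[OF ab'(1) cd] by blast
      obtain f where f: "\<forall>a b. D (\<alpha> *s a + \<beta> *s b) (\<gamma> *s a + \<delta> *s b) = eval_mpoly f (case_sum (($) a) (($) b))"
        using pair_poly_subst[OF D(1), of \<alpha> \<beta> \<gamma> \<delta>] unfolding pair_poly_def by blast
      have "f \<in> ?F" using M(1) f by (intro CollectI exI[of _ \<alpha>] exI[of _ \<beta>] exI[of _ \<gamma>] exI[of _ \<delta>]) metis
      moreover have "eval_mpoly f (case_sum (($) a) (($) b)) \<noteq> 0"
        using f ab'(2) M by metis
      ultimately show "\<exists>f\<in>?F. eval_mpoly f (case_sum (($) a) (($) b)) \<noteq> 0" by blast
    next
      assume "\<exists>f\<in>?F. eval_mpoly f (case_sum (($) a) (($) b)) \<noteq> 0"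
      then obtain f \<alpha> \<beta> \<gamma> \<delta> where det: "\<alpha> * \<delta> - \<beta> * \<gamma> \<noteq> 0" and
        "\<forall>a b. eval_mpoly f (case_sum (($) a) (($) b)) = D (\<alpha> *s a + \<beta> *s b) (\<gamma> *s a + \<delta> *s b)"
        "eval_mpoly f (case_sum (($) a) (($) b)) \<noteq> 0" by blast
      then have "D (\<alpha> *s a + \<beta> *s b) (\<gamma> *s a + \<delta> *s b) \<noteq> 0" by metis
      then show "cut_out a b \<in> G"
        using cut_out_comb[OF det, of a b] cd unfolding G_def by (metis (mono_tags, lifting) mem_Collect_eq)
    qed
  qed
  moreover have "P Q" if "Q \<in> G" for Q
    using that P unfolding G_def by blast
  ultimately show "for_general_codim2 P" unfolding for_general_codim2_def by blast
qed

lemma for_general_codim2_conj: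
  fixes P :: "('a::alg_closed_field ^ 'n::finite) set \<Rightarrow> bool"
  assumes card: "CARD('n) \<ge> 2" and "for_general_codim2 P" "for_general_codim2 R"
  shows "for_general_codim2 (\<lambda>Q. P Q \<and> R Q)"
proof -
  obtain D a b where D: "pair_poly D" "D a b \<noteq> 0"
    "\<And>a b. cut_out a b \<in> codim2_subspaces \<Longrightarrow> D a b \<noteq> 0 \<Longrightarrow> P (cut_out a b)"
    using assms(2) unfolding for_general_codim2_iff[OF card] by blast
  obtain E a' b' where E: "pair_poly E" "E a' b' \<noteq> 0"
    "\<And>a b. cut_out a b \<in> codim2_subspaces \<Longrightarrow> E a b \<noteq> 0 \<Longrightarrow> R (cut_out a b)"
    using assms(3) unfolding for_general_codim2_iff[OF card] by blast
  have "pair_poly (\<lambda>a b. D a b * E a b)" by (intro pair_poly_mult D(1) E(1))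
  moreover have "\<exists>a b. D a b * E a b \<noteq> 0"
    using pair_poly_common_nonzero[OF D(1) E(1) D(2) E(2)] by simp
  ultimately show ?thesis
    unfolding for_general_codim2_iff[OF card] using D(3) E(3)
    by (intro exI[of _ "\<lambda>a b. D a b * E a b"]) auto
qed

lemma for_general_codim2_mono:
  assumes "for_general_codim2 P" "\<And>Q. Q \<in> codim2_subspaces \<Longrightarrow> P Q \<Longrightarrow> R Q"
  shows "for_general_codim2 R"
proof -
  obtain G where G: "open_codim2 G" "G \<noteq> {}" "\<forall>Q\<in>G. P Q"
    using assms(1) unfolding for_general_codim2_def by blast
  moreover have "G \<subseteq> codim2_subspaces"
    using G(1) unfolding open_codim2_def by simp
  ultimately show ?thesis
    unfolding for_general_codim2_def using assms(2) by (intro exI[of _ G]) auto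
qed

lemma for_general_codim2_witness:
  assumes "for_general_codim2 P"
  shows "\<exists>a b. cut_out a b \<in> codim2_subspaces \<and> P (cut_out a b)"
proof -
  obtain G Q where G: "open_codim2 G" "Q \<in> G" "P Q"
    using assms(1) unfolding for_general_codim2_def by blast
  then have "Q \<in> codim2_subspaces"
    unfolding open_codim2_def by auto
  then show ?thesis using codim2_subspace_is_cut_out G(3) by metis
qed

text \<open>Fewer equations than unknowns. The equation p is used to eliminate an unknown j0 that
  occurs in it.\<close>

lemma homogeneous_system_nontrivial_solution:
  fixes M :: "'i \<Rightarrow> 'p \<Rightarrow> 'a::field"
  assumes "finite P" "finite J" "card P < card J"
  shows "\<exists>c. (\<exists>j\<in>J. c j \<noteq> 0) \<and> (\<forall>p\<in>P. (\<Sum>j\<in>J. c j * M j p) = 0)"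
  using assms
proof (induction P arbitrary: J M rule: finite_induct)
  case empty
  then have "J \<noteq> {}" by auto
  then show ?case by (intro exI[of _ "\<lambda>_. 1"]) auto
next
  case (insert p P)
  show ?case
  proof (cases "\<forall>j\<in>J. M j p = 0")
    case True
    obtain c where "\<exists>j\<in>J. c j \<noteq> 0" "\<forall>p\<in>P. (\<Sum>j\<in>J. c j * M j p) = 0"
      using insert.IH[of J M] insert.prems insert.hyps by auto
    then show ?thesis using True by (intro exI[of _ c]) auto
  next
    case False
    then obtain j0 where j0: "j0 \<in> J" "M j0 p \<noteq> 0" by blast
    let ?J = "J - {j0}"
    let ?M = "\<lambda>j q. M j q - M j p / M j0 p * M j0 q"
    have "card P < card ?J"
      using insert.prems insert.hyps j0 by (simp add: card_Diff_singleton)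
    then obtain c where c: "\<exists>j\<in>?J. c j \<noteq> 0" "\<forall>q\<in>P. (\<Sum>j\<in>?J. c j * ?M j q) = 0"
      using insert.IH[of ?J ?M] insert.prems by auto
    let ?c = "c(j0 := - (\<Sum>j\<in>?J. c j * (M j p / M j0 p)))"
    have eq: "(\<Sum>j\<in>J. ?c j * M j q) = (\<Sum>j\<in>?J. c j * ?M j q)" for q
    proof -
      have "(\<Sum>j\<in>J. ?c j * M j q) = ?c j0 * M j0 q + (\<Sum>j\<in>?J. ?c j * M j q)"
        using insert.prems j0 by (simp add: sum.remove[of J j0])
      also have "(\<Sum>j\<in>?J. ?c j * M j q) = (\<Sum>j\<in>?J. c j * M j q)"
        by (intro sum.cong) auto
      finally show ?thesis
        by (simp add: sum_distrib_right right_diff_distrib sum_subtractf mult.assoc)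
    qed
    have "(\<Sum>j\<in>?J. c j * ?M j p) = 0" using j0(2) by simp
    then have "\<forall>q\<in>insert p P. (\<Sum>j\<in>J. ?c j * M j q) = 0"
      unfolding eq using c(2) by blast
    moreover have "\<exists>j\<in>J. ?c j \<noteq> 0" using c(1) by auto
    ultimately show ?thesis by blast
  qed
qed

text \<open>Fraction-free Gaussian elimination: the points \<open>I\<close> determine, generically in \<open>(a, b)\<close>, all
  values of a combination of the \<open>g j\<close> on \<open>Y\<close>, by an interpolation formula with
  coefficients polynomial in \<open>(a, b)\<close> that is valid for all \<open>(a, b)\<close>.\<close>

lemma polynomial_interpolation_basis:
  fixes g :: "'j \<Rightarrow> 'a::alg_closed_field ^ 'n::finite \<Rightarrow> 'a ^ 'n \<Rightarrow> 'x \<Rightarrow> 'a"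
  assumes J: "finite J" and g: "\<And>j x. pair_poly (\<lambda>a b. g j a b x)"
  shows "\<exists>I\<subseteq>Y. finite I \<and> (\<exists>D e. pair_poly D \<and> (\<forall>p j. pair_poly (e p j)) \<and> (\<exists>a b. D a b \<noteq> 0) \<and>
    (\<forall>a b. \<forall>p\<in>I. \<forall>q\<in>I. (\<Sum>j\<in>J. e p j a b * g j a b q) = (if p = q then D a b else 0)) \<and>
    (\<forall>a b. \<forall>j\<in>J. \<forall>x\<in>Y. D a b * g j a b x =
       (\<Sum>p\<in>I. g j a b p * (\<Sum>k\<in>J. e p k a b * g k a b x))))"
proof -
  define S where "S I D e \<longleftrightarrow> finite I \<and> I \<subseteq> Y \<and> pair_poly D \<and> (\<forall>p j. pair_poly (e p j)) \<and> (\<exists>a b. D a b \<noteq> 0) \<and>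
    (\<forall>a b. \<forall>p\<in>I. \<forall>q\<in>I. (\<Sum>j\<in>J. e p j a b * g j a b q) = (if p = q then D a b else 0))" for I :: "'x set" and D and e :: "'x \<Rightarrow> 'j \<Rightarrow> _"
  let ?P = "\<lambda>m. \<exists>I D e. S I D e \<and> m = card I"
  have "S {} (\<lambda>_ _. 1) (\<lambda>_ _ _ _. 0)" by (simp add: S_def)
  then have "?P 0" by (metis card.empty)
  \<comment> \<open>Where D is nonzero, duality makes the coefficient vectors of the dual functions
    linearly independent in a space of dimension \<open>card J\<close>.\<close>
  moreover have "m \<le> card J" if Pm: "?P m" for m
  proof (rule ccontr)
    assume "\<not> m \<le> card J"
    then obtain I D e where S: "S I D e" and "m = card I" using Pm by blast
    then have lt: "card J < card I" using \<open>\<not> m \<le> card J\<close> by simp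
    obtain a b where ab: "D a b \<noteq> 0" using S unfolding S_def by blast
    have fin: "finite I" using S unfolding S_def by simp
    obtain c where c: "\<exists>p\<in>I. c p \<noteq> 0" "\<forall>j\<in>J. (\<Sum>p\<in>I. c p * e p j a b) = 0"
      using homogeneous_system_nontrivial_solution[OF J _ lt, of "\<lambda>p j. e p j a b"] fin by blast
    then obtain q where q: "q \<in> I" "c q \<noteq> 0" by blast
    have "0 = (\<Sum>j\<in>J. (\<Sum>p\<in>I. c p * e p j a b) * g j a b q)"
      using c(2) by simp
    also have "\<dots> = (\<Sum>p\<in>I. c p * (\<Sum>j\<in>J. e p j a b * g j a b q))"
      by (simp only: sum_distrib_left sum_distrib_right sum.swap[of _ J I] mult.assoc)
    also have "\<dots> = (\<Sum>p\<in>I. if p = q then c p * D a b else 0)"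
      using S q(1) unfolding S_def by (intro sum.cong) auto
    also have "\<dots> = c q * D a b" using q(1) fin by simp
    finally show False using q(2) ab by simp
  qed
  ultimately obtain m where m: "?P m" "\<And>m'. ?P m' \<Longrightarrow> m' \<le> m"
    using Nat.ex_has_greatest_nat[of ?P 0 "card J"] by blast
  then obtain I D e where S: "S I D e" and mI: "m = card I" by blast
  from S have fin: "finite I" and IY: "I \<subseteq> Y" and D: "pair_poly D" and e: "\<And>p j. pair_poly (e p j)"
    and D0: "\<exists>a b. D a b \<noteq> 0"
    and dual: "\<And>a b p q. p \<in> I \<Longrightarrow> q \<in> I \<Longrightarrow>
      (\<Sum>j\<in>J. e p j a b * g j a b q) = (if p = q then D a b else 0)"
    unfolding S_def by simp_all
  let ?E = "\<lambda>p a b x. \<Sum>k\<in>J. e p k a b * g k a b x"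
  have "D a b * g j0 a b x = (\<Sum>p\<in>I. g j0 a b p * ?E p a b x)" if j0: "j0 \<in> J" and x: "x \<in> Y" for a b j0 x
  proof (rule ccontr)
    assume ne: "D a b * g j0 a b x \<noteq> (\<Sum>p\<in>I. g j0 a b p * ?E p a b x)"
    \<comment> \<open>F is the interpolation error for \<open>g j0\<close>, multiplied by D, and f
      are its coefficients with respect to the functions g. It vanishes on I by duality and is not
      identically zero at x, so x can be added to I.\<close>
    define f where "f j a b = (if j = j0 then D a b else 0) - (\<Sum>p\<in>I. g j0 a b p * e p j a b)" for j a b
    define F where "F a b y = (\<Sum>j\<in>J. f j a b * g j a b y)" for a b y
    have F: "F a b y = D a b * g j0 a b y - (\<Sum>p\<in>I. g j0 a b p * ?E p a b y)" for a b y
    proof -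
      have "F a b y = (\<Sum>j\<in>J. if j = j0 then D a b * g j0 a b y else 0) -
         (\<Sum>j\<in>J. \<Sum>p\<in>I. g j0 a b p * (e p j a b * g j a b y))"
        unfolding F_def f_def left_diff_distrib sum_subtractf sum_distrib_right mult.assoc
        by (intro arg_cong2[of _ _ _ _ "(-)"] sum.cong refl) auto
      also have "(\<Sum>j\<in>J. \<Sum>p\<in>I. g j0 a b p * (e p j a b * g j a b y)) = (\<Sum>p\<in>I. g j0 a b p * ?E p a b y)"
        by (subst sum.swap) (simp add: sum_distrib_left)
      finally show ?thesis using J j0 by simp
    qed
    have FI: "F a b q = 0" if "q \<in> I" for a b q
    proof -
      have "(\<Sum>p\<in>I. g j0 a b p * ?E p a b q) = (\<Sum>p\<in>I. if p = q then g j0 a b q * D a b else 0)"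
        using that by (intro sum.cong) (auto simp: dual)
      then show ?thesis unfolding F using that fin by simp
    qed
    have f_poly: "pair_poly (f j)" for j
    proof -
      have "pair_poly (\<lambda>a b. if j = j0 then D a b else 0)"
        by (cases "j = j0") (simp_all add: D)
      then show ?thesis
        unfolding f_def by (intro pair_poly_diff pair_poly_sum pair_poly_mult e g)
    qed
    have F_poly: "pair_poly (\<lambda>a b. F a b y)" for y
      unfolding F_def by (intro pair_poly_sum pair_poly_mult f_poly g)
    have Fx: "F a b x \<noteq> 0" using ne unfolding F by simp
    then have xI: "x \<notin> I" using FI by blast
    \<comment> \<open>A pivot step without division: F becomes dual to x, and multiples of F are
      subtracted from the old dual functions. The extra factors D and F(x) give all of them the same
      value D F(x) at their own point.\<close>
    define D' where "D' a b = D a b * F a b x" for a b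
    define e' where "e' p j a b = (if p = x then D a b * f j a b
      else F a b x * e p j a b - ?E p a b x * f j a b)" for p j a b
    have "pair_poly D'" unfolding D'_def by (intro pair_poly_mult D F_poly)
    moreover have "pair_poly (e' p j)" for p j
      unfolding e'_def
      by (cases "p = x") (simp_all, (intro pair_poly_diff pair_poly_sum pair_poly_mult D e g f_poly F_poly)+)
    moreover have "\<exists>a b. D' a b \<noteq> 0"
      unfolding D'_def using D0 pair_poly_common_nonzero[OF D F_poly _ Fx] by fastforce
    moreover have "(\<Sum>j\<in>J. e' p j a b * g j a b q) = (if p = q then D' a b else 0)"
      if p: "p \<in> insert x I" and q: "q \<in> insert x I" for a b p q
    proof (cases "p = x")
      case True
      have "(\<Sum>j\<in>J. e' p j a b * g j a b q) = D a b * F a b q"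
        by (simp add: True e'_def F_def sum_distrib_left mult.assoc)
      then show ?thesis using q True FI[of q a b] xI by (auto simp: D'_def)
    next
      case False
      then have pI: "p \<in> I" using p by blast
      have "(\<Sum>j\<in>J. e' p j a b * g j a b q) = F a b x * ?E p a b q - ?E p a b x * F a b q"
        unfolding e'_def F_def[of a b q]
        by (simp add: False left_diff_distrib sum_subtractf sum_distrib_left mult.assoc)
      then show ?thesis
        using q pI FI[of q a b] xI dual[OF pI, of q a b] False by (auto simp: D'_def mult.commute)
    qed
    ultimately have "S (insert x I) D' e'"
      unfolding S_def using fin IY x by simp
    then have "card (insert x I) \<le> m" using m(2) by blast
    then show False using mI xI fin by simp
  qed
  then have "\<forall>a b. \<forall>j\<in>J. \<forall>x\<in>Y. D a b * g j a b x = (\<Sum>p\<in>I. g j a b p * ?E p a b x)"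
    by blast
  then show ?thesis
    using fin IY D e D0 dual by (intro exI[of _ I] conjI exI[of _ D] exI[of _ e]) simp_all
qed

section \<open>Restriction to linear subspaces\<close>

lemma power_sum_zero_imp_coeffs_zero:
  fixes c :: "nat \<Rightarrow> 'a::alg_closed_field"
  assumes "finite A" "\<And>s. (\<Sum>m\<in>A. c m * s ^ m) = 0" "m \<in> A"
  shows "c m = 0"
proof -
  have "(\<Sum>m\<in>A. monom (c m) m) = 0"
    by (rule poly_zero_if_all_zero) (simp add: poly_sum poly_monom assms(2))
  then have "coeff (\<Sum>m\<in>A. monom (c m) m) m = 0" by simp
  then show ?thesis using assms(1,3) by (simp add: coeff_sum)
qed

text \<open>W is the direct sum of its intersection with Q, of which \<open>B\<close> is a basis,
  and the plane of w0, w1, on which a and b are the dual coordinates. The forms \<open>e u\<close>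
  complete a and b to coordinates on W.\<close>

lemma adapted_coordinates:
  fixes W :: "('a::field ^ 'n::finite) set"
  assumes W: "vec.subspace W" "v \<in> W" "w \<in> W" and nz: "minor2 a b v w \<noteq> 0"
  obtains w0 w1 B e where "finite B" "B \<subseteq> W" "card B + 2 = vec.dim W" "w0 \<in> W" "w1 \<in> W"
    "dotp a w0 = 1" "dotp b w0 = 0" "dotp a w1 = 0" "dotp b w1 = 1"
    "\<And>u. u \<in> B \<Longrightarrow> dotp a u = 0" "\<And>u. u \<in> B \<Longrightarrow> dotp b u = 0"
    "\<And>u. u \<in> B \<Longrightarrow> dotp (e u) w0 = 0" "\<And>u. u \<in> B \<Longrightarrow> dotp (e u) w1 = 0"
    "\<And>u u'. u \<in> B \<Longrightarrow> u' \<in> B \<Longrightarrow> dotp (e u) u' = (if u = u' then 1 else 0)"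
    "\<And>x. x \<in> W \<Longrightarrow> x = dotp a x *s w0 + dotp b x *s w1 + (\<Sum>u\<in>B. dotp (e u) x *s u)"
proof -
  obtain w0 w1 where w: "w0 \<in> W" "w1 \<in> W"
    "dotp a w0 = 1" "dotp b w0 = 0" "dotp a w1 = 0" "dotp b w1 = 1"
    using minor2_dual_pair[OF assms] by blast
  let ?V = "W \<inter> cut_out a b"
  have V: "vec.subspace ?V" using W(1) subspace_cut_out by (rule vec.subspace_inter)
  obtain B where B: "B \<subseteq> ?V" "vec.independent B" "?V \<subseteq> vec.span B" "card B = vec.dim ?V"
    using vec.basis_exists by blast
  have fin: "finite B" using B(2) vec.finiteI_independent by blast
  have spB: "vec.span B = ?V" using B V by (meson antisym vec.span_minimal)
  have "w1 \<notin> vec.span B" using w unfolding spB by (simp add: cut_out_eq)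
  then have i1: "vec.independent (insert w1 B)" using B(2) vec.independent_insertI by blast
  have "\<And>x. x \<in> insert w1 B \<Longrightarrow> dotp a x = 0" using w B(1) by (auto simp: cut_out_eq)
  then have "w0 \<notin> vec.span (insert w1 B)" using dotp_zero_on_span[of "insert w1 B" a w0] w by auto
  then have i0: "vec.independent (insert w0 (insert w1 B))" using i1 vec.independent_insertI by blast
  have nB: "w0 \<notin> B" "w1 \<notin> B" "w0 \<noteq> w1" using w B(1) by (auto simp: cut_out_eq)
  have "\<exists>c. \<forall>x\<in>insert w0 (insert w1 B). dotp c x = (if x = u then 1 else 0)" for u
    by (rule exists_functional[OF i0])
  then obtain e where e: "\<And>u x. x \<in> insert w0 (insert w1 B) \<Longrightarrow> dotp (e u) x = (if x = u then 1 else 0)"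
    by metis
  have dec: "x = dotp a x *s w0 + dotp b x *s w1 + (\<Sum>u\<in>B. dotp (e u) x *s u)" if x: "x \<in> W" for x
  proof -
    let ?y = "x - dotp a x *s w0 - dotp b x *s w1"
    have "?y \<in> ?V"
      using x W(1) w by (auto simp: cut_out_eq dotp_linear intro!: vec.subspace_diff vec.subspace_scale)
    then obtain r where r: "?y = (\<Sum>u\<in>B. r u *s u)"
      using vec.span_finite[OF fin] spB by blast
    have "dotp (e u) x = r u" if u: "u \<in> B" for u
    proof -
      have "dotp (e u) ?y = (\<Sum>u'\<in>B. if u' = u then r u else 0)"
        unfolding r dotp_sum_right using u e by (intro sum.cong) (auto simp: dotp_scale_right)
      also have "\<dots> = r u" using fin u by simp
      finally have "dotp (e u) ?y = r u" .
      moreover have "dotp (e u) w0 = 0" "dotp (e u) w1 = 0"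
        using e[of w0 u] e[of w1 u] u nB by auto
      ultimately show ?thesis by (simp add: dotp_linear)
    qed
    then have "(\<Sum>u\<in>B. dotp (e u) x *s u) = ?y" unfolding r by (intro sum.cong) auto
    then show ?thesis by simp
  qed
  show thesis
  proof (rule that)
    show "finite B" "w0 \<in> W" "w1 \<in> W" "dotp a w0 = 1" "dotp b w0 = 0" "dotp a w1 = 0" "dotp b w1 = 1"
      by (fact fin w)+
    show "B \<subseteq> W" using B(1) by blast
    show "card B + 2 = vec.dim W" using dim_Int_cut_out[OF assms] B(4) by simp
    show "dotp a u = 0" "dotp b u = 0" if "u \<in> B" for u
      using B(1) that by (auto simp: cut_out_eq)
    show "dotp (e u) w0 = 0" "dotp (e u) w1 = 0" if "u \<in> B" for u
      using e[of w0 u] e[of w1 u] that nB by auto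
    show "dotp (e u) u' = (if u = u' then 1 else 0)" if "u \<in> B" "u' \<in> B" for u u'
      using e[of u' u] that by auto
    show "x = dotp a x *s w0 + dotp b x *s w1 + (\<Sum>u\<in>B. dotp (e u) x *s u)" if "x \<in> W" for x
      by (rule dec[OF that])
  qed
qed

text \<open>In adapted coordinates \<open>(a, b, e\<^sub>u)\<close> on \<open>W\<close>, the restrictions to \<open>W\<close> of the forms in
  \<open>[I(Q)\<^bsup>d-1\<^esup>]\<^sub>d\<close> have the basis \<open>a\<^sup>m b\<^bsup>d-m\<^esup>\<close>, \<open>a\<^sup>m b\<^bsup>d-1-m\<^esup> e\<^sub>u\<close>.\<close>

lemma fat_forms_basis:
  fixes W :: "('a::alg_closed_field ^ 'n::finite) set"
  assumes W: "vec.subspace W" "v \<in> W" "w \<in> W" and nz: "minor2 a b v w \<noteq> 0" and d: "d \<ge> 1"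
  obtains K :: "(nat + nat \<times> ('a ^ 'n)) set" and \<phi> where
    "finite K" "card K = d * (vec.dim W - 1) + 1"
    "\<And>j. j \<in> {..<d} \<times> UNIV \<Longrightarrow> \<exists>c. \<forall>x\<in>W. fat_gen d j a b x = (\<Sum>\<kappa>\<in>K. c \<kappa> * \<phi> \<kappa> x)"
    "\<And>\<kappa>. \<kappa> \<in> K \<Longrightarrow> \<exists>c. \<forall>x. \<phi> \<kappa> x = (\<Sum>j\<in>{..<d} \<times> UNIV. c j * fat_gen d j a b x)"
    "\<And>c \<kappa>. \<forall>x\<in>W. (\<Sum>\<kappa>\<in>K. c \<kappa> * \<phi> \<kappa> x) = 0 \<Longrightarrow> \<kappa> \<in> K \<Longrightarrow> c \<kappa> = 0"
proof -
  obtain w0 w1 B e where B: "finite B" "B \<subseteq> W" "card B + 2 = vec.dim W" and w: "w0 \<in> W" "w1 \<in> W"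
    "dotp a w0 = 1" "dotp b w0 = 0" "dotp a w1 = 0" "dotp b w1 = 1"
    and abB: "\<And>u. u \<in> B \<Longrightarrow> dotp a u = 0" "\<And>u. u \<in> B \<Longrightarrow> dotp b u = 0"
    and ew: "\<And>u. u \<in> B \<Longrightarrow> dotp (e u) w0 = 0" "\<And>u. u \<in> B \<Longrightarrow> dotp (e u) w1 = 0"
    and ee: "\<And>u u'. u \<in> B \<Longrightarrow> u' \<in> B \<Longrightarrow> dotp (e u) u' = (if u = u' then 1 else 0)"
    and dec: "\<And>x. x \<in> W \<Longrightarrow> x = dotp a x *s w0 + dotp b x *s w1 + (\<Sum>u\<in>B. dotp (e u) x *s u)"
    by (rule adapted_coordinates[OF W nz]) (rule that)
  \<comment> \<open>\<open>Inl m\<close> stands for a^m b^(d-m) and \<open>Inr (m, u)\<close> for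
    a^m b^(d-1-m) e_u. With two vectors of a basis of W used up by a and b, the count is (d + 1) + d
    (dim W - 2).\<close>
  let ?K = "{..d} <+> ({..<d} \<times> B)"
  define \<phi> where "\<phi> \<kappa> x = (case \<kappa> of Inl m \<Rightarrow> dotp a x ^ m * dotp b x ^ (d - m)
     | Inr (m, u) \<Rightarrow> dotp a x ^ m * dotp b x ^ (d - 1 - m) * dotp (e u) x)" for \<kappa> x
  have sumK: "(\<Sum>\<kappa>\<in>?K. h \<kappa>) = (\<Sum>m\<le>d. h (Inl m)) + (\<Sum>m<d. \<Sum>u\<in>B. h (Inr (m, u)))"
    for h :: "nat + nat \<times> ('a ^ 'n) \<Rightarrow> 'a"
    using B(1) by (simp add: sum.Plus sum.cartesian_product)
  have "card ?K = d + 1 + d * card B"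
    using B(1) by (simp add: card_Plus)
  also have "\<dots> = d * (vec.dim W - 1) + 1" using B(3)[symmetric] by simp
  finally have cardK: "card ?K = d * (vec.dim W - 1) + 1" .
  have gen: "\<exists>c. \<forall>x\<in>W. fat_gen d j a b x = (\<Sum>\<kappa>\<in>?K. c \<kappa> * \<phi> \<kappa> x)" if j: "j \<in> {..<d} \<times> UNIV" for j
  proof -
    obtain k i where ki: "j = (k, i)" "k < d" using j by auto
    \<comment> \<open>The coordinate x_i is expanded in a, b and the e_u. The term with a raises the
      exponent of a, hence k + 1; the term with b keeps it.\<close>
    define c where "c \<kappa> = (case \<kappa> of Inl m \<Rightarrow> (if m = k + 1 then w0 $ i else 0) + (if m = k then w1 $ i else 0)
       | Inr (m, u) \<Rightarrow> if m = k then u $ i else 0)" for \<kappa>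
    have "fat_gen d j a b x = (\<Sum>\<kappa>\<in>?K. c \<kappa> * \<phi> \<kappa> x)" if x: "x \<in> W" for x
    proof -
      let ?A = "dotp a x" and ?B = "dotp b x"
      have "x $ i = ?A * w0 $ i + ?B * w1 $ i + (\<Sum>u\<in>B. dotp (e u) x * u $ i)"
        using arg_cong[OF dec[OF x], of "\<lambda>x. x $ i"] by (simp add: sum_component)
      then have "fat_gen d j a b x = ?A ^ k * ?B ^ (d - 1 - k) *
          (?A * w0 $ i + ?B * w1 $ i + (\<Sum>u\<in>B. dotp (e u) x * u $ i))"
        by (simp add: fat_gen_def ki)
      also have "\<dots> = w0 $ i * (?A ^ (k + 1) * ?B ^ (d - (k + 1))) + w1 $ i * (?A ^ k * ?B ^ (d - k)) +
          (\<Sum>u\<in>B. u $ i * (?A ^ k * ?B ^ (d - 1 - k) * dotp (e u) x))"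
      proof -
        have "?B ^ (d - k) = ?B ^ (d - 1 - k) * ?B"
          using ki(2) by (simp flip: power_Suc2 add: Suc_diff_Suc)
        moreover have "d - (k + 1) = d - 1 - k" by simp
        ultimately show ?thesis
          by (simp add: distrib_left sum_distrib_left mult_ac)
      qed
      also have "\<dots> = (\<Sum>m\<le>d. c (Inl m) * \<phi> (Inl m) x) + (\<Sum>m<d. \<Sum>u\<in>B. c (Inr (m, u)) * \<phi> (Inr (m, u)) x)"
      proof -
        have "(\<Sum>m\<le>d. c (Inl m) * \<phi> (Inl m) x) =
          (\<Sum>m\<le>d. if m = k + 1 then w0 $ i * (?A ^ (k + 1) * ?B ^ (d - (k + 1))) else 0) +
          (\<Sum>m\<le>d. if m = k then w1 $ i * (?A ^ k * ?B ^ (d - k)) else 0)"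
          unfolding sum.distrib[symmetric] by (intro sum.cong) (auto simp: c_def \<phi>_def)
        moreover have "(\<Sum>m<d. \<Sum>u\<in>B. c (Inr (m, u)) * \<phi> (Inr (m, u)) x) =
          (\<Sum>m<d. if m = k then (\<Sum>u\<in>B. u $ i * (?A ^ k * ?B ^ (d - 1 - k) * dotp (e u) x)) else 0)"
          by (intro sum.cong) (auto simp: c_def \<phi>_def)
        ultimately show ?thesis using ki(2) by simp
      qed
      finally show ?thesis unfolding sumK .
    qed
    then show ?thesis by blast
  qed
  have comb: "\<exists>c. \<forall>x. dotp a x ^ k * dotp b x ^ (d - 1 - k) * dotp l x =
      (\<Sum>j\<in>{..<d} \<times> UNIV. c j * fat_gen d j a b x)" if k: "k < d" for k l
  proof -
    have "(\<Sum>j\<in>{..<d} \<times> UNIV. (if fst j = k then l $ snd j else 0) * fat_gen d j a b x) =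
        (\<Sum>m<d. if m = k then (\<Sum>i\<in>UNIV. l $ i * fat_gen d (k, i) a b x) else 0)" for x
      unfolding sum.cartesian_product' by (intro sum.cong) auto
    then have "(\<Sum>j\<in>{..<d} \<times> UNIV. (if fst j = k then l $ snd j else 0) * fat_gen d j a b x) =
        (\<Sum>i\<in>UNIV. l $ i * fat_gen d (k, i) a b x)" for x
      using k by simp
    then have "dotp a x ^ k * dotp b x ^ (d - 1 - k) * dotp l x =
        (\<Sum>j\<in>{..<d} \<times> UNIV. (if fst j = k then l $ snd j else 0) * fat_gen d j a b x)" for x
      by (simp add: fat_gen_def dotp_def[of l] sum_distrib_left mult_ac)
    then show ?thesis by (intro exI[of _ "\<lambda>j. if fst j = k then l $ snd j else 0"]) blast
  qed
  have \<phi>: "\<exists>c. \<forall>x. \<phi> \<kappa> x = (\<Sum>j\<in>{..<d} \<times> UNIV. c j * fat_gen d j a b x)" if \<kappa>: "\<kappa> \<in> ?K" for \<kappa>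
  proof (cases \<kappa>)
    case (Inl m)
    \<comment> \<open>Every monomial except b^d contains a factor a, which can serve as the linear
      form. For b^d that form is b.\<close>
    show ?thesis
    proof (cases m)
      case 0
      have "dotp a x ^ 0 * dotp b x ^ (d - 1 - 0) * dotp b x = \<phi> \<kappa> x" for x
        using d power_minus_mult[of d "dotp b x"] by (simp add: \<phi>_def Inl 0)
      then show ?thesis using comb[of 0 b] d by simp
    next
      case (Suc k)
      then have "k < d" using \<kappa> Inl by auto
      moreover have "dotp a x ^ k * dotp b x ^ (d - 1 - k) * dotp a x = \<phi> \<kappa> x" for x
        by (simp add: \<phi>_def Inl Suc mult_ac)
      ultimately show ?thesis using comb[of k a] by simp
    qed
  next
    case (Inr p)
    then obtain m u where "p = (m, u)" "m < d" using \<kappa> by auto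
    then show ?thesis using comb[of m "e u"] by (simp add: \<phi>_def Inr)
  qed
  have ind: "c \<kappa> = 0" if c: "\<forall>x\<in>W. (\<Sum>\<kappa>\<in>?K. c \<kappa> * \<phi> \<kappa> x) = 0" and \<kappa>: "\<kappa> \<in> ?K" for c \<kappa>
  proof -
    \<comment> \<open>On s w0 + w1 the coordinates are a = s, b = 1, e_u = 0, which isolates the
      monomials in a and b. Once these are gone, adding u to the vector isolates those with
      e_u.\<close>
    have Inl0: "c (Inl m) = 0" if "m \<in> {..d}" for m
    proof (rule power_sum_zero_imp_coeffs_zero[OF finite_atMost _ that])
      fix s
      have x: "s *s w0 + w1 \<in> W" using w W(1) by (intro vec.subspace_add vec.subspace_scale)
      have "\<phi> (Inl m) (s *s w0 + w1) = s ^ m" for m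
        by (simp add: \<phi>_def dotp_linear w)
      moreover have "\<phi> (Inr (m, u)) (s *s w0 + w1) = 0" if "u \<in> B" for m u
        by (simp add: \<phi>_def dotp_linear ew[OF that])
      ultimately show "(\<Sum>m\<le>d. c (Inl m) * s ^ m) = 0"
        using c[rule_format, OF x] unfolding sumK by simp
    qed
    have Inr0: "c (Inr (m, u)) = 0" if m: "m \<in> {..<d}" and u: "u \<in> B" for m u
    proof (rule power_sum_zero_imp_coeffs_zero[where c = "\<lambda>m. c (Inr (m, u))", OF finite_lessThan _ m])
      fix s
      let ?x = "s *s w0 + w1 + u"
      have x: "?x \<in> W" using w W(1) u B(2) by (intro vec.subspace_add vec.subspace_scale) auto
      have "(\<Sum>u'\<in>B. c (Inr (m, u')) * \<phi> (Inr (m, u')) ?x) = c (Inr (m, u)) * s ^ m" for m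
      proof -
        have "(\<Sum>u'\<in>B. c (Inr (m, u')) * \<phi> (Inr (m, u')) ?x) =
            (\<Sum>u'\<in>B. if u' = u then c (Inr (m, u)) * s ^ m else 0)"
          by (intro sum.cong) (auto simp: \<phi>_def dotp_linear ew ee u abB[OF u] w)
        then show ?thesis using B(1) u by simp
      qed
      moreover have "(\<Sum>m\<le>d. c (Inl m) * \<phi> (Inl m) ?x) = 0" using Inl0 by simp
      ultimately show "(\<Sum>m<d. c (Inr (m, u)) * s ^ m) = 0"
        using c[rule_format, OF x] unfolding sumK by simp
    qed
    show ?thesis using \<kappa> Inl0 Inr0 by auto
  qed
  have "finite ?K" using B(1) by simp
  then show thesis using cardK gen \<phi> ind by (rule that)
qed

text \<open>On W the dual functions of \<open>I\<close> are combinations of the functions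
  \<open>\<phi>\<close>. With more points than such functions the dual functions would satisfy a
  linear relation on W, contradicting duality.\<close>

lemma fat_forms_card_le:
  fixes W :: "('a::alg_closed_field ^ 'n::finite) set"
  assumes W: "vec.subspace W" "v \<in> W" "w \<in> W" and nz: "minor2 a b v w \<noteq> 0" and d: "d \<ge> 1"
    and card: "CARD('n) \<ge> 3" and I: "finite I" "I \<subseteq> W"
    and ind: "independent_conditions (graded_part (fat_ideal (cut_out a b) d) d) I"
  shows "card I \<le> d * (vec.dim W - 1) + 1"
proof (rule ccontr)
  assume neg: "\<not> ?thesis"
  obtain K :: "(nat + nat \<times> ('a ^ 'n)) set" and \<phi> where K: "finite K" "card K = d * (vec.dim W - 1) + 1"
    and gen: "\<And>j. j \<in> {..<d} \<times> UNIV \<Longrightarrow> \<exists>c. \<forall>x\<in>W. fat_gen d j a b x = (\<Sum>\<kappa>\<in>K. c \<kappa> * \<phi> \<kappa> x)"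
    by (rule fat_forms_basis[OF W nz d]) (rule that)
  have lt: "card K < card I" using neg K(2) by simp
  have cd: "cut_out a b \<in> codim2_subspaces" using nz cut_out_in_codim2_iff by blast
  obtain f where f: "\<And>p. p \<in> I \<Longrightarrow> f p \<in> graded_part (fat_ideal (cut_out a b) d) d"
    "\<And>p. p \<in> I \<Longrightarrow> eval_mpoly (f p) (($) p) \<noteq> 0"
    "\<And>p q. p \<in> I \<Longrightarrow> q \<in> I \<Longrightarrow> q \<noteq> p \<Longrightarrow> eval_mpoly (f p) (($) q) = 0"
    using ind unfolding independent_conditions_def by (metis Diff_iff singletonD)
  have "\<exists>m. \<forall>x\<in>W. eval_mpoly (f p) (($) x) = (\<Sum>\<kappa>\<in>K. m \<kappa> * \<phi> \<kappa> x)" if p: "p \<in> I" for p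
  proof -
    obtain c where c: "\<And>x. eval_mpoly (f p) (($) x) = (\<Sum>j\<in>{..<d} \<times> UNIV. c j * fat_gen d j a b x)"
      using fat_ideal_eval[OF cd card d f(1)[OF p]] by blast
    obtain m where m: "\<And>j x. j \<in> {..<d} \<times> UNIV \<Longrightarrow> x \<in> W \<Longrightarrow> fat_gen d j a b x = (\<Sum>\<kappa>\<in>K. m j \<kappa> * \<phi> \<kappa> x)"
      using gen by metis
    have "eval_mpoly (f p) (($) x) = (\<Sum>\<kappa>\<in>K. (\<Sum>j\<in>{..<d} \<times> UNIV. c j * m j \<kappa>) * \<phi> \<kappa> x)" if x: "x \<in> W" for x
    proof -
      have "eval_mpoly (f p) (($) x) = (\<Sum>j\<in>{..<d} \<times> UNIV. \<Sum>\<kappa>\<in>K. c j * m j \<kappa> * \<phi> \<kappa> x)"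
        unfolding c using m x by (intro sum.cong) (auto simp: sum_distrib_left mult.assoc)
      also have "\<dots> = (\<Sum>\<kappa>\<in>K. (\<Sum>j\<in>{..<d} \<times> UNIV. c j * m j \<kappa>) * \<phi> \<kappa> x)"
        by (subst sum.swap) (simp add: sum_distrib_right)
      finally show ?thesis .
    qed
    then show ?thesis by (intro exI[of _ "\<lambda>\<kappa>. \<Sum>j\<in>{..<d} \<times> UNIV. c j * m j \<kappa>"]) blast
  qed
  then obtain m where m: "\<And>p x. p \<in> I \<Longrightarrow> x \<in> W \<Longrightarrow> eval_mpoly (f p) (($) x) = (\<Sum>\<kappa>\<in>K. m p \<kappa> * \<phi> \<kappa> x)"
    by metis
  obtain c where c: "\<exists>p\<in>I. c p \<noteq> 0" "\<forall>\<kappa>\<in>K. (\<Sum>p\<in>I. c p * m p \<kappa>) = 0"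
    using homogeneous_system_nontrivial_solution[OF K(1) I(1) lt] by blast
  then obtain q where q: "q \<in> I" "c q \<noteq> 0" by blast
  have "c q * eval_mpoly (f q) (($) q) = (\<Sum>p\<in>I. if p = q then c q * eval_mpoly (f q) (($) q) else 0)"
    using I(1) q(1) by simp
  also have "\<dots> = (\<Sum>p\<in>I. c p * eval_mpoly (f p) (($) q))"
    using f(3) q(1) by (intro sum.cong) auto
  also have "\<dots> = (\<Sum>p\<in>I. \<Sum>\<kappa>\<in>K. c p * m p \<kappa> * \<phi> \<kappa> q)"
    using m q(1) I(2) by (intro sum.cong) (auto simp: sum_distrib_left mult.assoc)
  also have "\<dots> = (\<Sum>\<kappa>\<in>K. (\<Sum>p\<in>I. c p * m p \<kappa>) * \<phi> \<kappa> q)"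
    by (subst sum.swap) (simp add: sum_distrib_right)
  also have "\<dots> = 0" using c(2) by simp
  finally show False using q f(2) by simp
qed

section \<open>Irreducible subvarieties\<close>

lemma proj_closed_Int_vanishing:
  assumes "proj_closed X" "g \<in> homogeneous_part k"
  shows "proj_closed {p \<in> X. vanishes_at g p}"
proof -
  obtain F where F: "F \<subseteq> (\<Union>k. homogeneous_part k)" "X = {p \<in> proj_points. \<forall>f\<in>F. vanishes_at f p}"
    using assms(1) unfolding proj_closed_def by blast
  have "{p \<in> X. vanishes_at g p} = {p \<in> proj_points. \<forall>f\<in>insert g F. vanishes_at f p}"
    using F(2) by blast
  moreover have "insert g F \<subseteq> (\<Union>k. homogeneous_part k)" using F(1) assms(2) by blast
  ultimately show ?thesis unfolding proj_closed_def by blast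
qed

lemma irreducible_subvariety_subset: "irreducible_subvariety X \<Longrightarrow> X \<subseteq> proj_points"
  unfolding irreducible_subvariety_def proj_closed_def by blast

text \<open>The homogeneous ideal of X is prime: the zero sets of g and h would otherwise decompose
  X.\<close>

lemma irreducible_mult_vanishing:
  assumes X: "irreducible_subvariety X" and g: "g \<in> homogeneous_part k" "h \<in> homogeneous_part l"
    and van: "\<And>p. p \<in> X \<Longrightarrow> vanishes_at g p \<or> vanishes_at h p"
  shows "(\<forall>p\<in>X. vanishes_at g p) \<or> (\<forall>p\<in>X. vanishes_at h p)"
proof -
  have "proj_closed X" using X unfolding irreducible_subvariety_def by blast
  then have "proj_closed {p \<in> X. vanishes_at g p}" "proj_closed {p \<in> X. vanishes_at h p}"
    using g proj_closed_Int_vanishing by blast+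
  moreover have "X = {p \<in> X. vanishes_at g p} \<union> {p \<in> X. vanishes_at h p}" using van by blast
  ultimately have "X = {p \<in> X. vanishes_at g p} \<or> X = {p \<in> X. vanishes_at h p}"
    using X unfolding irreducible_subvariety_def by blast
  then show ?thesis by blast
qed

text \<open>The product of the linear forms does not vanish identically on X, by primality.\<close>

lemma irreducible_avoid_hyperplanes:
  assumes X: "irreducible_subvariety X" and T: "finite T"
    and nv: "\<And>u. u \<in> T \<Longrightarrow> \<exists>y\<in>proj_rep ` X. dotp u y \<noteq> 0"
  shows "\<exists>y\<in>proj_rep ` X. \<forall>u\<in>T. dotp u y \<noteq> 0"
proof -
  have Xp: "X \<subseteq> proj_points" by (rule irreducible_subvariety_subset[OF X])
  have "\<exists>g k. g \<in> homogeneous_part k \<and> (\<exists>p\<in>X. \<not> vanishes_at g p) \<and>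
      (\<forall>y. eval_mpoly g (($) y) = (\<Prod>u\<in>T. dotp u y))"
    using T nv
  proof (induction T rule: finite_induct)
    case empty
    have "1 \<in> homogeneous_part 0" using homogeneous_part_const[of 1] by simp
    moreover obtain p where p: "p \<in> X" using X unfolding irreducible_subvariety_def by blast
    then have "\<not> vanishes_at 1 p"
      using proj_rep(1) Xp by (auto simp: vanishes_at_def)
    ultimately show ?case using p by (intro exI[of _ 1] exI[of _ 0]) auto
  next
    case (insert u T)
    then obtain g k where g: "g \<in> homogeneous_part k" "\<exists>p\<in>X. \<not> vanishes_at g p"
      "\<And>y. eval_mpoly g (($) y) = (\<Prod>u\<in>T. dotp u y)" by auto
    have "\<exists>p\<in>X. \<not> vanishes_at (lin_form u) p"
      using insert.prems[of u] Xp proj_rep(1) by (fastforce simp: vanishes_at_def)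
    then obtain p where p: "p \<in> X" "\<not> vanishes_at (lin_form u) p" "\<not> vanishes_at g p"
      using irreducible_mult_vanishing[OF X lin_form_homogeneous g(1)] g(2) by blast
    have hom: "lin_form u * g \<in> homogeneous_part (1 + k)"
      using g(1) lin_form_homogeneous by (rule homogeneous_part_mult[rotated])
    have pp: "p \<in> proj_points" using p(1) Xp by blast
    have "\<not> vanishes_at (lin_form u * g) p"
      using p(2,3) unfolding vanishes_at_iff[OF hom pp] vanishes_at_iff[OF g(1) pp]
        vanishes_at_iff[OF lin_form_homogeneous pp] by simp
    then show ?case using hom p(1) g(3) insert.hyps
      by (intro exI[of _ "lin_form u * g"] exI[of _ "1 + k"]) auto
  qed
  then obtain g k p where g: "g \<in> homogeneous_part k" "p \<in> X" "\<not> vanishes_at g p"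
    "\<And>y. eval_mpoly g (($) y) = (\<Prod>u\<in>T. dotp u y)" by blast
  then have "(\<Prod>u\<in>T. dotp u (proj_rep p)) \<noteq> 0"
    using vanishes_at_iff[OF g(1)] Xp by auto
  then show ?thesis using g(2) T by auto
qed

text \<open>Two proper closed parts give two forms, each nonzero somewhere on H. On the line joining
  two such vectors both are nonzero at a common vector, whose point then lies in neither
  part.\<close>

lemma irreducible_linear_subspace:
  fixes H :: "('a::alg_closed_field ^ 'n::finite) set"
  assumes H: "vec.subspace H" "vec.dim H \<ge> 1"
  shows "irreducible_subvariety (points_of H)"
  unfolding irreducible_subvariety_def
proof (intro conjI allI impI)
  have mem: "p \<in> points_of H \<longleftrightarrow> p \<in> proj_points \<and> proj_rep p \<in> H" for p
    using proj_point_subset_iff[OF _ H(1)] by (auto simp: points_of_def)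
  let ?F = "{lin_form a | a. \<forall>w\<in>H. dotp a w = 0}"
  have "points_of H = {p \<in> proj_points. \<forall>f\<in>?F. vanishes_at f p}"
  proof (intro set_eqI iffI)
    fix p assume "p \<in> points_of H"
    then show "p \<in> {p \<in> proj_points. \<forall>f\<in>?F. vanishes_at f p}"
      by (auto simp: points_of_def vanishes_at_def)
  next
    fix p assume p: "p \<in> {p \<in> proj_points. \<forall>f\<in>?F. vanishes_at f p}"
    have "proj_rep p \<in> H"
    proof (rule ccontr)
      assume "proj_rep p \<notin> H"
      then obtain a where a: "\<forall>w\<in>H. dotp a w = 0" "dotp a (proj_rep p) = 1"
        using separating_functional[OF H(1)] by blast
      then have "vanishes_at (lin_form a) p" using p by blast
      moreover have "proj_rep p \<in> p" using proj_rep(1) p by blast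
      ultimately have "dotp a (proj_rep p) = 0" unfolding vanishes_at_def by simp
      then show False using a(2) by simp
    qed
    then show "p \<in> points_of H" using mem p by blast
  qed
  moreover have "?F \<subseteq> (\<Union>k. homogeneous_part k)" using lin_form_homogeneous by blast
  ultimately show "proj_closed (points_of H)" unfolding proj_closed_def by blast
  have "\<not> H \<subseteq> {0}" using H(2) vec.dim_eq_0[of H] by linarith
  then obtain v where "v \<in> H" "v \<noteq> 0" by blast
  then have "vec.span {v} \<in> points_of H"
    using span_singleton_proj_point vec.span_minimal[of "{v}" H] H(1) by (auto simp: points_of_def)
  then show "points_of H \<noteq> {}" by blast
  fix Y1 Y2 assume Y: "proj_closed Y1 \<and> proj_closed Y2 \<and> points_of H = Y1 \<union> Y2"
  show "points_of H = Y1 \<or> points_of H = Y2"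
  proof (rule ccontr)
    assume neg: "\<not> ?thesis"
    have ex: "\<exists>f k v. f \<in> homogeneous_part k \<and> v \<in> H \<and> eval_mpoly f (($) v) \<noteq> 0 \<and> (\<forall>p\<in>Y. vanishes_at f p)"
      if Y: "proj_closed Y" "Y \<subseteq> points_of H" "points_of H \<noteq> Y" for Y
    proof -
      obtain F where F: "F \<subseteq> (\<Union>k. homogeneous_part k)" "Y = {p \<in> proj_points. \<forall>f\<in>F. vanishes_at f p}"
        using Y(1) unfolding proj_closed_def by blast
      obtain p where p: "p \<in> points_of H" "p \<notin> Y" using Y by blast
      then obtain f where f: "f \<in> F" "\<not> vanishes_at f p" using F(2) mem by blast
      then obtain k where k: "f \<in> homogeneous_part k" using F(1) by blast
      have "eval_mpoly f (($) (proj_rep p)) \<noteq> 0"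
        using vanishes_at_iff[OF k] f(2) p(1) mem by blast
      then show ?thesis using k f(1) F(2) p(1) mem by blast
    qed
    obtain f k v where f: "f \<in> homogeneous_part k" "v \<in> H" "eval_mpoly f (($) v) \<noteq> 0"
      "\<forall>p\<in>Y1. vanishes_at f p" using ex[of Y1] Y neg by blast
    obtain g l w where g: "g \<in> homogeneous_part l" "w \<in> H" "eval_mpoly g (($) w) \<noteq> 0"
      "\<forall>p\<in>Y2. vanishes_at g p" using ex[of Y2] Y neg by blast
    let ?x = "\<lambda>s. v + s *s (w - v)"
    have comp: "poly_fun (\<lambda>s. ?x s $ i)" for i
      unfolding vector_add_component vector_smult_component
      by (intro poly_fun_add poly_fun_mult poly_fun_ident poly_fun_const)
    have "poly_fun (\<lambda>s. eval_mpoly f (($) (?x s)))"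
      by (rule poly_fun_eval_mpoly[of "\<lambda>s. ($) (?x s)"]) (rule comp)
    moreover have "poly_fun (\<lambda>s. eval_mpoly g (($) (?x s)))"
      by (rule poly_fun_eval_mpoly[of "\<lambda>s. ($) (?x s)"]) (rule comp)
    moreover have "eval_mpoly f (($) (?x 0)) \<noteq> 0" "eval_mpoly g (($) (?x 1)) \<noteq> 0"
      using f g by auto
    ultimately obtain s where s: "eval_mpoly f (($) (?x s)) \<noteq> 0" "eval_mpoly g (($) (?x s)) \<noteq> 0"
      using poly_fun_two_nonzero[of "\<lambda>s. eval_mpoly f (($) (?x s))" "\<lambda>s. eval_mpoly g (($) (?x s))" 0 1] by blast
    have xH: "?x s \<in> H" using f(2) g(2) H(1) by (intro vec.subspace_add vec.subspace_scale vec.subspace_diff)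
    have "\<exists>x\<in>H. x \<noteq> 0 \<and> eval_mpoly f (($) x) \<noteq> 0 \<and> eval_mpoly g (($) x) \<noteq> 0"
    proof (cases "?x s = 0")
      case False
      then show ?thesis using s xH by blast
    next
      case True
      \<comment> \<open>A form that is nonzero at the origin has degree 0, so any nonzero vector of
        H may replace the origin.\<close>
      obtain z where z: "z \<in> H" "z \<noteq> 0" using \<open>v \<in> H\<close> \<open>\<not> H \<subseteq> {0}\<close> by blast
      have "eval_mpoly f (($) (0 *s z)) \<noteq> 0" "eval_mpoly g (($) (0 *s z)) \<noteq> 0"
        using s True by simp_all
      then have "eval_mpoly f (($) z) \<noteq> 0" "eval_mpoly g (($) z) \<noteq> 0"
        unfolding homogeneous_eval_vec_scale[OF f(1)] homogeneous_eval_vec_scale[OF g(1)] by auto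
      then show ?thesis using z by blast
    qed
    then obtain x where x: "x \<in> H" "x \<noteq> 0" "eval_mpoly f (($) x) \<noteq> 0" "eval_mpoly g (($) x) \<noteq> 0" by blast
    have "vec.span {x} \<in> points_of H"
      using x span_singleton_proj_point vec.span_minimal[of "{x}" H] H(1) by (auto simp: points_of_def)
    then have "vanishes_at f (vec.span {x}) \<or> vanishes_at g (vec.span {x})"
      using Y f(4) g(4) by blast
    moreover have "x \<in> vec.span {x}" by (simp add: vec.span_base)
    ultimately show False using x unfolding vanishes_at_def by blast
  qed
qed

text \<open>A generic hyperplane section of an irreducible \<open>X\<close> (minus a fixed hyperplane \<open>a = 0\<close>) spans
  the hyperplane. The points are chosen one after the other: along a pencil \<open>\<gamma> + s u\<close> the
  hyperplane through \<open>y \<in> X\<close> has parameter \<open>- \<gamma>(y) / u(y)\<close>, which avoids the finitely many bad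
  values for some \<open>y\<close> since otherwise \<open>X\<close> would lie in finitely many hyperplanes.\<close>

lemma hyperplane_section_spans:
  fixes f :: "'a::alg_closed_field ^ 'n::finite \<Rightarrow> 'a"
  assumes X: "irreducible_subvariety X" and Y: "Y = proj_rep ` X"
    and a: "\<exists>y\<in>Y. dotp a y \<noteq> 0"
    and f_poly: "\<And>\<gamma> u. poly_fun (\<lambda>s. f (\<gamma> + s *s u))"
    and f_nv: "\<forall>\<gamma>. f \<gamma> \<noteq> 0 \<longrightarrow> (\<exists>y\<in>Y. dotp \<gamma> y \<noteq> 0)"
    and \<Gamma>: "vec.subspace \<Gamma>" "\<gamma> \<in> \<Gamma>" "f \<gamma> \<noteq> 0"
  shows "\<exists>\<gamma>'\<in>\<Gamma>. f \<gamma>' \<noteq> 0 \<and>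
    (\<forall>u\<in>\<Gamma>. (\<forall>y\<in>Y. dotp a y \<noteq> 0 \<longrightarrow> dotp \<gamma>' y = 0 \<longrightarrow> dotp u y = 0) \<longrightarrow>
      (\<exists>\<kappa>. \<forall>y\<in>Y. dotp u y = \<kappa> * dotp \<gamma>' y))"
  using \<Gamma>
proof (induction "vec.dim \<Gamma>" arbitrary: \<Gamma> \<gamma> rule: less_induct)
  case less
  show ?case
  proof (cases "\<forall>u\<in>\<Gamma>. \<exists>\<kappa>. \<forall>y\<in>Y. dotp u y = \<kappa> * dotp \<gamma> y")
    case True
    then show ?thesis using less.prems by blast
  next
    case False
    then obtain u where u: "u \<in> \<Gamma>" "\<And>\<kappa>. \<exists>y\<in>Y. dotp u y \<noteq> \<kappa> * dotp \<gamma> y" by blast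
    let ?S = "{s. f (\<gamma> + s *s u) = 0}"
    have "f (\<gamma> + 0 *s u) \<noteq> 0" using less.prems by simp
    then have fin: "finite ?S" using poly_fun_nonzero_finite[OF f_poly] by blast
    \<comment> \<open>Avoiding u makes the parameter s of y well defined, avoiding a puts y into the
      part of the section that counts, and avoiding the bad members of the pencil keeps s from being
      a root of f.\<close>
    let ?T = "insert a (insert u ((\<lambda>s. \<gamma> + s *s u) ` ?S))"
    have "\<exists>y\<in>Y. dotp t y \<noteq> 0" if t: "t \<in> ?T" for t
    proof -
      consider "t = a" | "t = u" | s where "s \<in> ?S" "t = \<gamma> + s *s u" using t by blast
      then show ?thesis
      proof cases
        case 1
        then show ?thesis using a by blast
      next
        case 2
        then show ?thesis using u(2)[of 0] by simp
      next
        case 3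
        have "s \<noteq> 0" using 3(1) less.prems(3) by auto
        obtain y where y: "y \<in> Y" "dotp u y \<noteq> (- 1 / s) * dotp \<gamma> y" using u(2) by blast
        then have "dotp t y \<noteq> 0"
          using \<open>s \<noteq> 0\<close> by (auto simp: 3(2) dotp_linear field_simps eq_neg_iff_add_eq_0)
        then show ?thesis using y(1) by blast
      qed
    qed
    then obtain y where y: "y \<in> Y" "\<And>t. t \<in> ?T \<Longrightarrow> dotp t y \<noteq> 0"
      using irreducible_avoid_hyperplanes[OF X, of ?T] fin unfolding Y by auto
    define s where "s = - dotp \<gamma> y / dotp u y"
    have uy: "dotp u y \<noteq> 0" "dotp a y \<noteq> 0" using y(2) by auto
    have z: "dotp (\<gamma> + s *s u) y = 0" using uy by (simp add: s_def dotp_linear)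
    then have fs: "f (\<gamma> + s *s u) \<noteq> 0" using y(2) by blast
    \<comment> \<open>From here on only hyperplanes through y are considered. Since u(y) is nonzero,
      the dimension drops, and y remains in the section found at the end.\<close>
    let ?\<Gamma> = "{v\<in>\<Gamma>. dotp y v = 0}"
    have "vec.dim \<Gamma> = Suc (vec.dim ?\<Gamma>)"
      by (rule dim_Int_kernel[OF less.prems(1) u(1)]) (simp add: uy dotp_commute[of y])
    moreover have sub: "vec.subspace ?\<Gamma>" by (rule subspace_Int_kernel[OF less.prems(1)])
    moreover have mem: "\<gamma> + s *s u \<in> ?\<Gamma>"
      using z less.prems u(1) by (auto simp: dotp_commute[of y] intro!: vec.subspace_add vec.subspace_scale)
    ultimately obtain \<gamma>' where \<gamma>': "\<gamma>' \<in> ?\<Gamma>" "f \<gamma>' \<noteq> 0"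
      "\<forall>u\<in>?\<Gamma>. (\<forall>y\<in>Y. dotp a y \<noteq> 0 \<longrightarrow> dotp \<gamma>' y = 0 \<longrightarrow> dotp u y = 0) \<longrightarrow>
        (\<exists>\<kappa>. \<forall>y\<in>Y. dotp u y = \<kappa> * dotp \<gamma>' y)"
      using less.hyps[OF _ sub mem fs] by auto
    have "dotp \<gamma>' y = 0" using \<gamma>'(1) by (simp add: dotp_commute[of y])
    then have "v \<in> ?\<Gamma>" if "v \<in> \<Gamma>" "\<forall>y\<in>Y. dotp a y \<noteq> 0 \<longrightarrow> dotp \<gamma>' y = 0 \<longrightarrow> dotp v y = 0" for v
      using that y(1) uy(2) by (simp add: dotp_commute[of y])
    then show ?thesis using \<gamma>' by blast
  qed
qed

lemma poly_fun_dotp: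
  assumes "\<And>i. poly_fun (\<lambda>s. A s $ i)" "\<And>i. poly_fun (\<lambda>s. X s $ i)"
  shows "poly_fun (\<lambda>s. dotp (A s) (X s))"
  unfolding dotp_def by (intro poly_fun_sum poly_fun_mult assms)

lemma poly_fun_fat_gen:
  assumes "\<And>i. poly_fun (\<lambda>s. A s $ i)" "\<And>i. poly_fun (\<lambda>s. B s $ i)" "\<And>i. poly_fun (\<lambda>s. X s $ i)"
  shows "poly_fun (\<lambda>s. fat_gen d j (A s) (B s) (X s))"
  unfolding fat_gen_def by (intro poly_fun_mult poly_fun_power poly_fun_dotp assms)

lemma poly_fun_line: "poly_fun (\<lambda>s. (x + s *s y) $ i)"
  unfolding vector_add_component vector_smult_component
  by (intro poly_fun_add poly_fun_mult poly_fun_ident poly_fun_const)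

lemma fat_gen_pencil:
  assumes "dotp b x = t * dotp a x" "k < d"
  shows "fat_gen d (k, i) a b x = dotp a x ^ (d - 1) * (t ^ (d - 1 - k) * x $ i)"
proof -
  have "dotp a x ^ k * (t * dotp a x) ^ (d - 1 - k) = t ^ (d - 1 - k) * dotp a x ^ (k + (d - 1 - k))"
    by (simp only: power_mult_distrib power_add mult_ac)
  then show ?thesis using assms by (simp add: fat_gen_def mult_ac)
qed

text \<open>On the hyperplane \<open>b = t a\<close> of the pencil through \<open>Q\<close>, the form \<open>\<Phi>\<close> is \<open>a\<^bsup>d-1\<^esup>\<close> times a linear form.
  If \<open>\<Phi>\<close> vanishes on \<open>X\<close> and the hyperplane is spanned by its section with \<open>X\<close>, that linear
  form vanishes on the hyperplane.\<close>

lemma generic_relation_trivial: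
  fixes C :: "nat \<times> 'n::finite \<Rightarrow> 'a::alg_closed_field ^ 'n \<Rightarrow> 'a ^ 'n \<Rightarrow> 'a"
  assumes X: "irreducible_subvariety X" and Y: "Y = proj_rep ` X"
    and C: "\<And>j. pair_poly (C j)" and d: "d \<ge> 1"
    and van: "\<And>a b y. y \<in> Y \<Longrightarrow> (\<Sum>j\<in>{..<d} \<times> UNIV. C j a b * fat_gen d j a b y) = 0"
    and vw: "v \<in> vec.span Y" "w \<in> vec.span Y" "minor2 a b v w \<noteq> 0"
    and x: "x \<in> vec.span Y"
  shows "(\<Sum>j\<in>{..<d} \<times> UNIV. C j a b * fat_gen d j a b x) = 0"
proof (rule ccontr)
  assume nz: "(\<Sum>j\<in>{..<d} \<times> UNIV. C j a b * fat_gen d j a b x) \<noteq> 0"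
  let ?W = "vec.span Y"
  define \<Phi> where "\<Phi> a b x = (\<Sum>j\<in>{..<d} \<times> UNIV. C j a b * fat_gen d j a b x)" for a b x
  have \<Phi>_poly: "poly_fun (\<lambda>s. \<Phi> (A s) (B s) (Z s))"
    if "\<And>i. poly_fun (\<lambda>s. A s $ i)" "\<And>i. poly_fun (\<lambda>s. B s $ i)" "\<And>i. poly_fun (\<lambda>s. Z s $ i)" for A B Z
    unfolding \<Phi>_def
    by (intro poly_fun_sum poly_fun_mult poly_fun_vec[OF that(1,2) C] poly_fun_fat_gen[OF that])
  obtain v0 v1 where v: "v0 \<in> ?W" "v1 \<in> ?W" "dotp a v0 = 1" "dotp b v0 = 0" "dotp a v1 = 0" "dotp b v1 = 1"
    using minor2_dual_pair[OF vec.subspace_span vw] by blast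
  \<comment> \<open>The vector x is moved towards v0 to make a nonzero there without losing the
    value of the relation, so that a hyperplane b = t a passes through it.\<close>
  let ?l = "\<lambda>s. x + s *s (v0 - x)"
  have "poly_fun (\<lambda>s. \<Phi> a b (?l s))"
    by (rule \<Phi>_poly[of "\<lambda>_. a" "\<lambda>_. b"]) (intro poly_fun_const poly_fun_line)+
  moreover have "poly_fun (\<lambda>s. dotp a (?l s))"
    by (rule poly_fun_dotp[of "\<lambda>_. a"]) (intro poly_fun_const poly_fun_line)+
  moreover have "\<Phi> a b (?l 0) \<noteq> 0" "dotp a (?l 1) \<noteq> 0" using nz v by (auto simp: \<Phi>_def)
  ultimately obtain s where s: "\<Phi> a b (?l s) \<noteq> 0" "dotp a (?l s) \<noteq> 0"
    using poly_fun_two_nonzero[of "\<lambda>s. \<Phi> a b (?l s)" "\<lambda>s. dotp a (?l s)" 0 1] by blast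
  define w0 where "w0 = ?l s"
  have w0: "w0 \<in> ?W" "\<Phi> a b w0 \<noteq> 0" "dotp a w0 \<noteq> 0"
    using s x v(1) unfolding w0_def by (auto intro!: vec.span_add vec.span_scale vec.span_diff)
  \<comment> \<open>The slope of the hyperplane of the pencil through w0, which
    \<open>\<gamma>0\<close> cuts out. From now on a and t stay fixed and only the hyperplane is
    moved.\<close>
  define t where "t = dotp b w0 / dotp a w0"
  define \<gamma>0 where "\<gamma>0 = b - t *s a"
  \<comment> \<open>A vector of \<open>?W\<close> on the hyperplane \<open>\<gamma>\<close> that
    depends polynomially on \<open>\<gamma>\<close> and is w0 for \<open>\<gamma>0\<close>. So
    \<open>f \<gamma> \<noteq> 0\<close> says that the relation fails on the moved
    hyperplane.\<close>
  define wf where "wf \<gamma> = dotp \<gamma> v1 *s w0 - dotp \<gamma> w0 *s v1" for \<gamma>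
  define f where "f \<gamma> = \<Phi> a (\<gamma> + t *s a) (wf \<gamma>)" for \<gamma>
  have \<gamma>0: "dotp \<gamma>0 w0 = 0" "dotp \<gamma>0 v1 = 1"
    using w0 v by (auto simp: \<gamma>0_def t_def dotp_linear)
  have "f \<gamma>0 = \<Phi> a b w0" unfolding f_def wf_def \<gamma>0 by (simp add: \<gamma>0_def)
  then have f0: "f \<gamma>0 \<noteq> 0" using w0 by simp
  have wf_W: "wf \<gamma> \<in> ?W" for \<gamma>
    unfolding wf_def using w0 v by (intro vec.span_diff vec.span_scale)
  have on_W: "dotp u z = 0" if "\<And>y. y \<in> Y \<Longrightarrow> dotp u y = 0" "z \<in> ?W" for u z
    using dotp_zero_on_span that by blast
  have f_nv: "\<forall>\<gamma>. f \<gamma> \<noteq> 0 \<longrightarrow> (\<exists>y\<in>Y. dotp \<gamma> y \<noteq> 0)"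
  proof (intro allI impI, rule ccontr)
    fix \<gamma> assume "f \<gamma> \<noteq> 0" "\<not> (\<exists>y\<in>Y. dotp \<gamma> y \<noteq> 0)"
    then have "wf \<gamma> = 0" using on_W[of \<gamma>] w0(1) v(2) by (simp add: wf_def)
    then have "f \<gamma> = 0" unfolding f_def \<Phi>_def fat_gen_def by simp
    then show False using \<open>f \<gamma> \<noteq> 0\<close> by simp
  qed
  have f_poly: "poly_fun (\<lambda>s. f (\<gamma> + s *s u))" for \<gamma> u
    unfolding f_def wf_def
  proof (rule \<Phi>_poly[of "\<lambda>_. a"])
    show "poly_fun (\<lambda>s. a $ i)" for i by simp
    show "poly_fun (\<lambda>s. (\<gamma> + s *s u + t *s a) $ i)" for i
      unfolding vector_add_component[of _ "t *s a"] by (intro poly_fun_add poly_fun_line poly_fun_const)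
    have "poly_fun (\<lambda>s. dotp (\<gamma> + s *s u) z)" for z
      by (rule poly_fun_dotp) (intro poly_fun_const poly_fun_line)+
    then show "poly_fun (\<lambda>s. (dotp (\<gamma> + s *s u) v1 *s w0 - dotp (\<gamma> + s *s u) w0 *s v1) $ i)" for i
      unfolding vector_minus_component vector_smult_component
      by (intro poly_fun_diff poly_fun_mult poly_fun_const)
  qed
  have "\<exists>y\<in>Y. dotp a y \<noteq> 0"
    using on_W[of a v0] v by (metis zero_neq_one)
  from hyperplane_section_spans[OF X Y this f_poly f_nv vec.subspace_UNIV UNIV_I f0]
  obtain \<gamma> where \<gamma>: "f \<gamma> \<noteq> 0 \<and>
      (\<forall>u\<in>UNIV. (\<forall>y\<in>Y. dotp a y \<noteq> 0 \<longrightarrow> dotp \<gamma> y = 0 \<longrightarrow> dotp u y = 0) \<longrightarrow>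
        (\<exists>\<kappa>. \<forall>y\<in>Y. dotp u y = \<kappa> * dotp \<gamma> y))"
    by (elim bexE) (rule that)
  \<comment> \<open>With this b' the hyperplane \<open>\<gamma>\<close> is b' = t a, and on it the
    relation is a^(d-1) times the linear form c.\<close>
  define b' where "b' = \<gamma> + t *s a"
  define c where "c = (\<chi> i. \<Sum>k<d. C (k, i) a b' * t ^ (d - 1 - k))"
  have \<Phi>c: "\<Phi> a b' z = dotp a z ^ (d - 1) * dotp c z" if z: "dotp \<gamma> z = 0" for z
  proof -
    have "dotp b' z = t * dotp a z" using z by (simp add: b'_def dotp_linear)
    then have "\<Phi> a b' z = (\<Sum>k<d. \<Sum>i\<in>UNIV. dotp a z ^ (d - 1) * (C (k, i) a b' * t ^ (d - 1 - k) * z $ i))"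
      unfolding \<Phi>_def sum.cartesian_product'
      by (intro sum.cong refl) (simp only: lessThan_iff fat_gen_pencil mult_ac)
    also have "\<dots> = dotp a z ^ (d - 1) * dotp c z"
      by (subst sum.swap) (simp add: c_def dotp_def sum_distrib_left sum_distrib_right)
    finally show ?thesis .
  qed
  have "\<forall>y\<in>Y. dotp a y \<noteq> 0 \<longrightarrow> dotp \<gamma> y = 0 \<longrightarrow> dotp c y = 0"
  proof (intro ballI impI)
    fix y assume y: "y \<in> Y" "dotp a y \<noteq> 0" "dotp \<gamma> y = 0"
    show "dotp c y = 0"
      using \<Phi>c[OF y(3)] van[OF y(1), of a b'] y(2) by (simp add: \<Phi>_def)
  qed
  then obtain \<kappa> where \<kappa>: "\<And>y. y \<in> Y \<Longrightarrow> dotp c y = \<kappa> * dotp \<gamma> y"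
    using \<gamma>[THEN conjunct2, rule_format, OF UNIV_I, of c] by blast
  have \<gamma>wf: "dotp \<gamma> (wf \<gamma>) = 0" by (simp add: wf_def dotp_linear)
  \<comment> \<open>Modulo \<open>\<gamma>\<close> the form c vanishes on Y and hence on its span,
    so the relation holds at \<open>wf \<gamma>\<close> after all.\<close>
  have "dotp (c - \<kappa> *s \<gamma>) (wf \<gamma>) = 0"
    by (rule on_W[OF _ wf_W]) (simp add: \<kappa> dotp_linear)
  then have "dotp c (wf \<gamma>) = 0" using \<gamma>wf by (simp add: dotp_linear)
  then have "f \<gamma> = 0" using \<Phi>c[OF \<gamma>wf] by (simp add: f_def b'_def)
  then show False using \<gamma> by simp
qed

text \<open>One set \<open>I\<close>, independent of Q, is a basis of the conditions imposed by Y
  for all Q with a nonzero D. The interpolation identity itself is kept too, because it holds for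
  all pairs.\<close>

lemma generic_interpolation:
  fixes Y :: "('a::alg_closed_field ^ 'n::finite) set"
  assumes card: "CARD('n) \<ge> 3" and d: "d \<ge> 1"
  obtains I D e where "I \<subseteq> Y" "finite I" "pair_poly D" "\<And>p j. pair_poly (e p j)" "\<exists>a b. D a b \<noteq> 0"
    "\<And>a b j x. j \<in> {..<d} \<times> UNIV \<Longrightarrow> x \<in> Y \<Longrightarrow> D a b * fat_gen d j a b x =
       (\<Sum>p\<in>I. fat_gen d j a b p * (\<Sum>k\<in>{..<d} \<times> UNIV. e p k a b * fat_gen d k a b x))"
    "\<And>a b. cut_out a b \<in> codim2_subspaces \<Longrightarrow> D a b \<noteq> 0 \<Longrightarrow>
       independent_conditions (graded_part (fat_ideal (cut_out a b) d) d) I \<and>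
       vanishing_on (graded_part (fat_ideal (cut_out a b) d) d) I =
       vanishing_on (graded_part (fat_ideal (cut_out a b) d) d) Y"
proof -
  let ?J = "{..<d} \<times> (UNIV :: 'n set)"
  have "finite ?J" by simp
  from polynomial_interpolation_basis[where g = "fat_gen d" and Y = Y, OF this pair_poly_fat_gen]
  obtain I D e where I: "I \<subseteq> Y" "finite I" and D: "pair_poly D" and e: "\<forall>p j. pair_poly (e p j)"
    and D0: "\<exists>a b. D a b \<noteq> 0"
    and dual: "\<forall>a b. \<forall>p\<in>I. \<forall>q\<in>I. (\<Sum>j\<in>?J. e p j a b * fat_gen d j a b q) = (if p = q then D a b else 0)"
    and interp: "\<forall>a b. \<forall>j\<in>?J. \<forall>x\<in>Y. D a b * fat_gen d j a b x =
       (\<Sum>p\<in>I. fat_gen d j a b p * (\<Sum>k\<in>?J. e p k a b * fat_gen d k a b x))"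
    by (elim exE conjE) (rule that, assumption+, blast, assumption+)
  show thesis
  proof (rule that[OF I D])
    show "pair_poly (e p j)" for p j using e by blast
    show "\<exists>a b. D a b \<noteq> 0" by (rule D0)
    show "D a b * fat_gen d j a b x =
       (\<Sum>p\<in>I. fat_gen d j a b p * (\<Sum>k\<in>?J. e p k a b * fat_gen d k a b x))"
      if "j \<in> ?J" "x \<in> Y" for a b j x using interp that by blast
    fix a b assume cd: "cut_out a b \<in> codim2_subspaces" and Dab: "D a b \<noteq> 0"
    let ?A = "graded_part (fat_ideal (cut_out a b) d) d"
    have "independent_conditions ?A I"
      unfolding independent_conditions_def
    proof
      fix p assume p: "p \<in> I"
      obtain f where f: "f \<in> ?A" "\<forall>x. eval_mpoly f (($) x) = (\<Sum>j\<in>?J. e p j a b * fat_gen d j a b x)"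
        using fat_gen_combination_realized[OF d, of a b "\<lambda>j. e p j a b"] by blast
      then have "eval_mpoly f (($) p) \<noteq> 0 \<and> (\<forall>q\<in>I - {p}. eval_mpoly f (($) q) = 0)"
        using dual p Dab by auto
      then show "\<exists>f\<in>?A. eval_mpoly f (($) p) \<noteq> 0 \<and> (\<forall>q\<in>I - {p}. eval_mpoly f (($) q) = 0)"
        using f(1) by blast
    qed
    moreover have "eval_mpoly f (($) x) = 0"
      if f: "f \<in> ?A" "\<And>p. p \<in> I \<Longrightarrow> eval_mpoly f (($) p) = 0" and x: "x \<in> Y" for f x
    proof -
      obtain c where c: "\<And>x. eval_mpoly f (($) x) = (\<Sum>j\<in>?J. c j * fat_gen d j a b x)"
        using fat_ideal_eval[OF cd card d f(1)] by blast
      let ?E = "\<lambda>p. \<Sum>k\<in>?J. e p k a b * fat_gen d k a b x"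
      have "D a b * eval_mpoly f (($) x) = (\<Sum>j\<in>?J. c j * (D a b * fat_gen d j a b x))"
        unfolding c by (simp add: sum_distrib_left mult.left_commute)
      also have "\<dots> = (\<Sum>j\<in>?J. \<Sum>p\<in>I. c j * fat_gen d j a b p * ?E p)"
      proof (intro sum.cong refl)
        fix j assume j: "j \<in> ?J"
        show "c j * (D a b * fat_gen d j a b x) = (\<Sum>p\<in>I. c j * fat_gen d j a b p * ?E p)"
          by (simp only: interp[rule_format, OF j x] sum_distrib_left[of _ _ I] mult.assoc)
      qed
      also have "\<dots> = (\<Sum>p\<in>I. eval_mpoly f (($) p) * ?E p)"
        unfolding c by (subst sum.swap) (simp only: sum_distrib_right)
      also have "\<dots> = 0" using f(2) by simp
      finally show ?thesis using Dab by simp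
    qed
    then have "vanishing_on ?A I = vanishing_on ?A Y"
      using I(1) unfolding vanishing_on_def by blast
    ultimately show "independent_conditions ?A I \<and> vanishing_on ?A I = vanishing_on ?A Y" by blast
  qed
qed

lemma exists_minor2_nonzero:
  fixes W :: "('a::field ^ 'n::finite) set"
  assumes "vec.subspace W" "vec.dim W \<ge> 2"
  shows "\<exists>v\<in>W. \<exists>w\<in>W. \<exists>a b. minor2 a b v w \<noteq> 0"
proof -
  obtain B where B: "B \<subseteq> W" "vec.independent B" "W \<subseteq> vec.span B" "card B = vec.dim W"
    using vec.basis_exists by blast
  have "finite B" by (rule vec.finiteI_independent[OF B(2)])
  moreover have "\<not> card B \<le> Suc 0" using B(4) assms(2) by simp
  ultimately have "\<exists>v\<in>B. \<exists>w\<in>B. v \<noteq> w" by (simp add: card_le_Suc0_iff_eq)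
  then obtain v w where vw: "v \<in> B" "w \<in> B" "v \<noteq> w" by blast
  obtain a where a: "\<forall>u\<in>B. dotp a u = (if u = v then 1 else 0)"
    using exists_functional[OF B(2), of "\<lambda>u. if u = v then 1 else 0"] by blast
  obtain b where b: "\<forall>u\<in>B. dotp b u = (if u = w then 1 else 0)"
    using exists_functional[OF B(2), of "\<lambda>u. if u = w then 1 else 0"] by blast
  have "minor2 a b v w \<noteq> 0" using a b vw by (simp add: minor2_def)
  moreover have "v \<in> W" "w \<in> W" using B(1) vw by auto
  ultimately show ?thesis by blast
qed

text \<open>If I were smaller than the number of monomials on span X, some nonzero combination of
  them would vanish on I. The interpolation identity holds on X for all pairs, so
  \<open>generic_relation_trivial\<close> extends it to span X, where it makes the combination
  vanish.\<close>

lemma generic_rank_irreducible: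
  fixes X :: "('a::alg_closed_field ^ 'n::finite) set set"
  assumes X: "irreducible_subvariety X" and card: "CARD('n) \<ge> 3" and d: "d \<ge> 1"
  shows "for_general_codim2 (\<lambda>Q. d * (vec.dim (vec.span (proj_rep ` X)) - 1) + 1 \<le>
    quot_dim (graded_part (fat_ideal Q d) d) (vanishing_on (graded_part (fat_ideal Q d) d) (proj_rep ` X)))"
proof -
  let ?Y = "proj_rep ` X" and ?J = "{..<d} \<times> (UNIV :: 'n set)"
  let ?W = "vec.span ?Y"
  obtain I D e where I: "I \<subseteq> ?Y" "finite I" and D: "pair_poly D" and e: "\<And>p j. pair_poly (e p j)"
    and D0: "\<exists>a b. D a b \<noteq> 0"
    and interp: "\<And>a b j x. j \<in> ?J \<Longrightarrow> x \<in> ?Y \<Longrightarrow> D a b * fat_gen d j a b x =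
       (\<Sum>p\<in>I. fat_gen d j a b p * (\<Sum>k\<in>?J. e p k a b * fat_gen d k a b x))"
    and ind: "\<And>a b. cut_out a b \<in> codim2_subspaces \<Longrightarrow> D a b \<noteq> 0 \<Longrightarrow>
       independent_conditions (graded_part (fat_ideal (cut_out a b) d) d) I \<and>
       vanishing_on (graded_part (fat_ideal (cut_out a b) d) d) I =
       vanishing_on (graded_part (fat_ideal (cut_out a b) d) d) ?Y"
    by (rule generic_interpolation[OF card d]) (rule that)
  have "d * (vec.dim ?W - 1) + 1 \<le> card I"
  proof (rule ccontr)
    assume neg: "\<not> d * (vec.dim ?W - 1) + 1 \<le> card I"
    obtain a1 b1 where D1: "D a1 b1 \<noteq> 0" using D0 by blast
    show False
    proof (cases "vec.dim ?W \<ge> 2")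
      case False
      then have "vec.dim ?W - 1 = 0" by simp
      then have "card I = 0" using neg by simp
      then have "I = {}" using I(2) by simp
      obtain p where "p \<in> X" using X unfolding irreducible_subvariety_def by blast
      then obtain y where y: "y \<in> ?Y" "y \<noteq> 0"
        using proj_rep(2) irreducible_subvariety_subset[OF X] by blast
      then obtain i where i: "y $ i \<noteq> 0" by (metis vec_eq_iff zero_index)
      \<comment> \<open>In dimension 1 no minor is available and only an empty I has to be excluded.
        The value here is the d-th power of \<open>y $ i\<close>.\<close>
      have "fat_gen d (0, i) (axis i 1) (axis i 1) y \<noteq> 0"
        using i by (simp add: fat_gen_def)
      then obtain a b where "D a b \<noteq> 0" "fat_gen d (0, i) a b y \<noteq> 0"
        using pair_poly_common_nonzero[OF D pair_poly_fat_gen D1] by blast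
      moreover have "D a b * fat_gen d (0, i) a b y = 0"
        using interp[of "(0, i)" y a b] y(1) d \<open>I = {}\<close> by simp
      ultimately show False by simp
    next
      case True
      then obtain v w a' b' where vw: "v \<in> ?W" "w \<in> ?W" "minor2 a' b' v w \<noteq> 0"
        using exists_minor2_nonzero[OF vec.subspace_span] by blast
      obtain a b where ab: "D a b \<noteq> 0" "minor2 a b v w \<noteq> 0"
        using pair_poly_common_nonzero[OF D pair_poly_minor2 D1 vw(3)] by blast
      obtain K :: "(nat + nat \<times> ('a ^ 'n)) set" and \<phi> where K: "finite K" "card K = d * (vec.dim ?W - 1) + 1"
        and \<phi>: "\<And>\<kappa>. \<kappa> \<in> K \<Longrightarrow> \<exists>c. \<forall>x. \<phi> \<kappa> x = (\<Sum>j\<in>?J. c j * fat_gen d j a b x)"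
        and lin: "\<And>c \<kappa>. \<forall>x\<in>?W. (\<Sum>\<kappa>\<in>K. c \<kappa> * \<phi> \<kappa> x) = 0 \<Longrightarrow> \<kappa> \<in> K \<Longrightarrow> c \<kappa> = 0"
        by (rule fat_forms_basis[OF vec.subspace_span vw(1,2) ab(2) d]) (rule that)
      have "card I < card K" using neg K(2) by simp
      from homogeneous_system_nontrivial_solution[OF I(2) K(1) this, of \<phi>]
      obtain c where c: "\<exists>\<kappa>\<in>K. c \<kappa> \<noteq> 0" "\<And>p. p \<in> I \<Longrightarrow> (\<Sum>\<kappa>\<in>K. c \<kappa> * \<phi> \<kappa> p) = 0"
        by blast
      obtain h where h: "\<And>\<kappa> x. \<kappa> \<in> K \<Longrightarrow> \<phi> \<kappa> x = (\<Sum>j\<in>?J. h \<kappa> j * fat_gen d j a b x)"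
        using \<phi> by metis
      define g where "g j = (\<Sum>\<kappa>\<in>K. c \<kappa> * h \<kappa> j)" for j
      have g: "(\<Sum>\<kappa>\<in>K. c \<kappa> * \<phi> \<kappa> x) = (\<Sum>j\<in>?J. g j * fat_gen d j a b x)" for x
      proof -
        have "(\<Sum>\<kappa>\<in>K. c \<kappa> * \<phi> \<kappa> x) = (\<Sum>\<kappa>\<in>K. \<Sum>j\<in>?J. c \<kappa> * h \<kappa> j * fat_gen d j a b x)"
          using h by (intro sum.cong) (auto simp: sum_distrib_left mult.assoc)
        then show ?thesis by (subst (asm) sum.swap) (simp add: g_def sum_distrib_right)
      qed
      have rel: "D a b * fat_gen d j a b x = (\<Sum>p\<in>I. fat_gen d j a b p * (\<Sum>k\<in>?J. e p k a b * fat_gen d k a b x))"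
        if j: "j \<in> ?J" and x: "x \<in> ?W" for j x
      proof -
        \<comment> \<open>Coefficients of the interpolation error as a combination of
          \<open>fat_gen\<close>: polynomial in the pair, with sum zero on X for every pair.\<close>
        define C where "C k a b = (if k = j then D a b else 0) - (\<Sum>p\<in>I. fat_gen d j a b p * e p k a b)" for k a b
        have C: "(\<Sum>k\<in>?J. C k a b * fat_gen d k a b x) = D a b * fat_gen d j a b x -
            (\<Sum>p\<in>I. fat_gen d j a b p * (\<Sum>k\<in>?J. e p k a b * fat_gen d k a b x))" for a b x
        proof -
          have "(\<Sum>k\<in>?J. C k a b * fat_gen d k a b x) = (\<Sum>k\<in>?J. if k = j then D a b * fat_gen d j a b x else 0) -
             (\<Sum>k\<in>?J. \<Sum>p\<in>I. fat_gen d j a b p * (e p k a b * fat_gen d k a b x))"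
            unfolding C_def left_diff_distrib sum_subtractf sum_distrib_right mult.assoc
            by (intro arg_cong2[of _ _ _ _ "(-)"] sum.cong refl) auto
          also have "(\<Sum>k\<in>?J. \<Sum>p\<in>I. fat_gen d j a b p * (e p k a b * fat_gen d k a b x)) =
            (\<Sum>p\<in>I. fat_gen d j a b p * (\<Sum>k\<in>?J. e p k a b * fat_gen d k a b x))"
            by (subst sum.swap) (simp only: sum_distrib_left)
          also have "(\<Sum>k\<in>?J. if k = j then D a b * fat_gen d j a b x else 0) = D a b * fat_gen d j a b x"
            using j by (subst sum.delta) simp_all
          finally show ?thesis .
        qed
        have Cp: "pair_poly (C k)" for k
        proof -
          have "pair_poly (\<lambda>a b. if k = j then D a b else 0)"
            by (cases "k = j") (simp_all add: D)
          then show ?thesis unfolding C_def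
            by (intro pair_poly_diff pair_poly_sum pair_poly_mult pair_poly_fat_gen e)
        qed
        have "(\<Sum>k\<in>?J. C k a b * fat_gen d k a b x) = 0"
          by (rule generic_relation_trivial[OF X refl Cp d _ vw(1,2) ab(2) x]) (simp add: C interp[OF j])
        then show ?thesis unfolding C by simp
      qed
      have "(\<Sum>\<kappa>\<in>K. c \<kappa> * \<phi> \<kappa> x) = 0" if x: "x \<in> ?W" for x
      proof -
        let ?E = "\<lambda>p. \<Sum>k\<in>?J. e p k a b * fat_gen d k a b x"
        have "D a b * (\<Sum>\<kappa>\<in>K. c \<kappa> * \<phi> \<kappa> x) = (\<Sum>j\<in>?J. g j * (D a b * fat_gen d j a b x))"
          unfolding g by (simp only: sum_distrib_left mult.left_commute)
        also have "\<dots> = (\<Sum>j\<in>?J. \<Sum>p\<in>I. g j * fat_gen d j a b p * ?E p)"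
          by (intro sum.cong refl) (simp only: rel[OF _ x] sum_distrib_left[of _ _ I] mult.assoc)
        also have "\<dots> = (\<Sum>p\<in>I. (\<Sum>\<kappa>\<in>K. c \<kappa> * \<phi> \<kappa> p) * ?E p)"
          unfolding g by (subst sum.swap) (simp only: sum_distrib_right)
        also have "\<dots> = 0" using c(2) by simp
        finally show ?thesis using ab(1) by simp
      qed
      then have "\<forall>\<kappa>\<in>K. c \<kappa> = 0" using lin by blast
      then show False using c(1) by blast
    qed
  qed
  moreover have "card I \<le> quot_dim (graded_part (fat_ideal (cut_out a b) d) d)
      (vanishing_on (graded_part (fat_ideal (cut_out a b) d) d) ?Y)"
    if "cut_out a b \<in> codim2_subspaces" "D a b \<noteq> 0" for a b
    by (rule quot_dim_vanishing_on(3)[OF subspace_graded_fat _ I])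
      (use ind[OF that] in \<open>auto simp: graded_part_def\<close>)
  moreover have "CARD('n) \<ge> 2" using card by simp
  ultimately show ?thesis
    using D D0 by (subst for_general_codim2_iff) (auto intro!: exI[of _ D] elim!: order_trans)
qed

section \<open>Matroid partition and subspace bounds\<close>

text \<open>Colour lists are shrunk one colour at a time while maintaining a rank condition, which by
  submodularity is possible as long as some list has two colours (Rado's theorem).\<close>

lemma matroid_partition:
  fixes rk :: "'e set \<Rightarrow> nat"
  assumes E: "finite E" and rk0: "rk {} = 0"
    and mono: "\<And>A B. A \<subseteq> B \<Longrightarrow> B \<subseteq> E \<Longrightarrow> rk A \<le> rk B"
    and submod: "\<And>A B. A \<subseteq> E \<Longrightarrow> B \<subseteq> E \<Longrightarrow> rk (A \<union> B) + rk (A \<inter> B) \<le> rk A + rk B"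
    and bound: "\<And>J. J \<subseteq> E \<Longrightarrow> card J \<le> d * rk J"
  shows "\<exists>c. (\<forall>e\<in>E. c e < d) \<and> (\<forall>j. \<forall>J\<subseteq>{e\<in>E. c e = j}. card J \<le> rk J)"
proof -
  \<comment> \<open>\<open>C e\<close> is the list of colours still allowed for e. The inequality is
    Rado's condition; for full lists it is the assumed bound, and for one-element lists it says that
    colour classes are independent.\<close>
  define good where "good C \<longleftrightarrow> (\<forall>e\<in>E. C e \<subseteq> {..<d}) \<and>
    (\<forall>J\<subseteq>E. card J \<le> (\<Sum>j<d. rk {e\<in>J. j \<in> C e}))" for C :: "'e \<Rightarrow> nat set"
  have "(\<Sum>j<d. rk {e\<in>J. j \<in> {..<d}}) = (\<Sum>j<d. rk J)" for J
    by (intro sum.cong) auto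
  then have "good (\<lambda>_. {..<d})"
    using bound unfolding good_def by simp
  then obtain C where C: "good C" and least: "\<And>C'. good C' \<Longrightarrow> (\<Sum>e\<in>E. card (C e)) \<le> (\<Sum>e\<in>E. card (C' e))"
    using ex_has_least_nat[of good _ "\<lambda>C. \<Sum>e\<in>E. card (C e)"] by blast
  have Cd: "C e \<subseteq> {..<d}" if "e \<in> E" for e using C that unfolding good_def by blast
  have cond: "card J \<le> (\<Sum>j<d. rk {e\<in>J. j \<in> C e})" if "J \<subseteq> E" for J using C that unfolding good_def by blast
  have singleton: "is_singleton (C e)" if e: "e \<in> E" for e
  proof (rule ccontr)
    assume ns: "\<not> is_singleton (C e)"
    have "C e \<noteq> {}"
    proof
      assume "C e = {}"
      then have "{e'\<in>{e}. j \<in> C e'} = {}" for j by auto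
      then have "(\<Sum>j<d. rk {e'\<in>{e}. j \<in> C e'}) = 0" by (simp only: rk0 sum.neutral_const)
      then show False using cond[of "{e}"] e by simp
    qed
    then obtain x y where xy: "x \<in> C e" "y \<in> C e" "x \<noteq> y"
      using ns is_singletonI'[of "C e"] by blast
    \<comment> \<open>By minimality no colour can be removed from the list of e, and a set violating
      the condition after removal must contain e.\<close>
    have bad: "\<exists>J\<subseteq>E. e \<in> J \<and> (\<Sum>j<d. rk {e'\<in>J. j \<in> (C(e := C e - {z})) e'}) < card J" if z: "z \<in> C e" for z
    proof -
      let ?C = "C(e := C e - {z})"
      have "finite (C e)" using Cd[OF e] finite_subset by blast
      then have "card (?C e) < card (C e)" using card_Diff1_less[of "C e" z] z by simp
      then have "(\<Sum>e\<in>E. card (?C e)) < (\<Sum>e\<in>E. card (C e))"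
        using e E by (intro sum_strict_mono_ex1) auto
      then have "\<not> good ?C" using least[of ?C] by linarith
      moreover have "\<forall>e'\<in>E. ?C e' \<subseteq> {..<d}" using Cd by auto
      ultimately obtain J where J: "J \<subseteq> E" "(\<Sum>j<d. rk {e'\<in>J. j \<in> ?C e'}) < card J"
        unfolding good_def by (meson not_le)
      have "e \<in> J"
      proof (rule ccontr)
        assume "e \<notin> J"
        then have "{e'\<in>J. j \<in> ?C e'} = {e'\<in>J. j \<in> C e'}" for j by auto
        then show False using J cond[OF J(1)] by simp
      qed
      then show ?thesis using J by blast
    qed
    obtain J1 where J1: "J1 \<subseteq> E" "e \<in> J1" "(\<Sum>j<d. rk {e'\<in>J1. j \<in> (C(e := C e - {x})) e'}) < card J1"
      using bad[OF xy(1)] by blast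
    obtain J2 where J2: "J2 \<subseteq> E" "e \<in> J2" "(\<Sum>j<d. rk {e'\<in>J2. j \<in> (C(e := C e - {y})) e'}) < card J2"
      using bad[OF xy(2)] by blast
    have fin: "finite J1" "finite J2" using J1 J2 E finite_subset by blast+
    let ?A = "\<lambda>j. {e'\<in>J1. j \<in> (C(e := C e - {x})) e'}" and ?B = "\<lambda>j. {e'\<in>J2. j \<in> (C(e := C e - {y})) e'}"
    \<comment> \<open>The colour of e missing on one side is present on the other, since x and y
      differ. So the union recovers the original lists, while the intersection is taken without
      e.\<close>
    have un: "{e'\<in>J1 \<union> J2. j \<in> C e'} = ?A j \<union> ?B j" for j
      using xy J1(2) J2(2) by auto
    have int: "{e'\<in>J1 \<inter> J2 - {e}. j \<in> C e'} \<subseteq> ?A j \<inter> ?B j" for j by auto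
    have "card (J1 \<union> J2) + card (J1 \<inter> J2 - {e}) \<le>
      (\<Sum>j<d. rk {e'\<in>J1 \<union> J2. j \<in> C e'}) + (\<Sum>j<d. rk {e'\<in>J1 \<inter> J2 - {e}. j \<in> C e'})"
      using J1(1) J2(1) by (intro add_mono cond) auto
    also have "\<dots> \<le> (\<Sum>j<d. rk (?A j \<union> ?B j) + rk (?A j \<inter> ?B j))"
      unfolding un sum.distrib using J1(1) J2(1)
      by (intro add_mono sum_mono mono[OF int] order_refl) auto
    also have "\<dots> \<le> (\<Sum>j<d. rk (?A j) + rk (?B j))"
      using J1(1) J2(1) by (intro sum_mono submod) auto
    \<comment> \<open>Two strict inequalities give a gain of 2, but leaving e out of the
      intersection costs only 1.\<close>
    finally have "card (J1 \<union> J2) + card (J1 \<inter> J2 - {e}) + 2 \<le> card J1 + card J2"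
      using J1(3) J2(3) unfolding sum.distrib by linarith
    moreover have "card (J1 \<inter> J2) = Suc (card (J1 \<inter> J2 - {e}))"
      using J1(2) J2(2) fin by (intro card.remove) auto
    ultimately show False using card_Un_Int[OF fin] by linarith
  qed
  define c where "c e = the_elem (C e)" for e
  have c: "C e = {c e}" if "e \<in> E" for e
    using singleton[OF that] unfolding c_def is_singleton_the_elem .
  have cd: "c e < d" if "e \<in> E" for e using Cd[OF that] c[OF that] by simp
  have "card J \<le> rk J" if J: "J \<subseteq> {e\<in>E. c e = j}" for j J
  proof (cases "J = {}")
    case False
    then have jd: "j < d" using J cd by blast
    have "{e\<in>J. j' \<in> C e} = (if j' = j then J else {})" for j' using J c by auto
    then have "(\<Sum>j'<d. rk {e\<in>J. j' \<in> C e}) = (\<Sum>j'<d. if j' = j then rk J else 0)"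
      using rk0 by (intro sum.cong) auto
    then show ?thesis using cond[of J] J jd by auto
  qed simp
  then show ?thesis using cd by blast
qed

text \<open>Applied to the span of p and J, the bound reads 1 + |J| <= d rk(J) + 1, where the point
  p accounts for the 1. What remains is exactly the hypothesis of \<open>matroid_partition\<close>.
  A product of d linear forms, each nonzero at p and zero on one class, is dual to p.\<close>

lemma independent_conditions_of_subspace_bound:
  fixes U :: "('a::field ^ 'n::finite) set"
  assumes U: "finite U" "0 \<notin> U"
    and bound: "\<And>H. vec.subspace H \<Longrightarrow> vec.dim H \<ge> 1 \<Longrightarrow> card (U \<inter> H) \<le> d * (vec.dim H - 1) + 1"
  shows "independent_conditions (homogeneous_part d) U"
  unfolding independent_conditions_def
proof
  fix p assume p: "p \<in> U"
  let ?E = "U - {p}"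
  \<comment> \<open>The rank of J in the quotient by the line of p.\<close>
  define rk where "rk J = vec.dim (insert p J) - 1" for J
  have p0: "p \<noteq> 0" using p U(2) by blast
  have pos: "vec.dim (insert p J) \<ge> 1" for J
  proof -
    have "vec.dim {p} \<le> vec.dim (insert p J)" by (rule vec.dim_subset) blast
    then show ?thesis using p0 by simp
  qed
  have "\<exists>c. (\<forall>e\<in>?E. c e < d) \<and> (\<forall>j. \<forall>J\<subseteq>{e\<in>?E. c e = j}. card J \<le> rk J)"
  proof (rule matroid_partition)
    show "finite ?E" using U by simp
    show "rk {} = 0" using p0 by (simp add: rk_def)
    show "rk A \<le> rk B" if "A \<subseteq> B" for A B
      unfolding rk_def using vec.dim_subset[of "insert p A" "insert p B"] that by (intro diff_le_mono) blast
    show "rk (A \<union> B) + rk (A \<inter> B) \<le> rk A + rk B" for A B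
    proof -
      let ?S = "vec.span (insert p A)" and ?T = "vec.span (insert p B)"
      have "vec.dim (insert p (A \<union> B)) \<le> vec.dim {x + y |x y. x \<in> ?S \<and> y \<in> ?T}"
      proof (rule vec.dim_subset, rule subsetI)
        fix z assume "z \<in> insert p (A \<union> B)"
        then have "z \<in> ?S \<or> z \<in> ?T" by (auto intro: vec.span_base)
        then show "z \<in> {x + y |x y. x \<in> ?S \<and> y \<in> ?T}"
        proof
          assume "z \<in> ?S"
          then show ?thesis using vec.span_zero[of "insert p B"] by force
        next
          assume "z \<in> ?T"
          then show ?thesis using vec.span_zero[of "insert p A"] by force
        qed
      qed
      moreover have "vec.dim (insert p (A \<inter> B)) \<le> vec.dim (?S \<inter> ?T)"
        by (rule vec.dim_subset) (auto intro: vec.span_base)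
      moreover have "vec.dim {x + y |x y. x \<in> ?S \<and> y \<in> ?T} + vec.dim (?S \<inter> ?T) = vec.dim ?S + vec.dim ?T"
        by (rule vec.dim_sums_Int) (rule vec.subspace_span)+
      ultimately have "vec.dim (insert p (A \<union> B)) + vec.dim (insert p (A \<inter> B)) \<le>
          vec.dim (insert p A) + vec.dim (insert p B)"
        unfolding vec.dim_span by linarith
      then show ?thesis unfolding rk_def using pos[of "A \<union> B"] pos[of "A \<inter> B"] by linarith
    qed
    show "card J \<le> d * rk J" if J: "J \<subseteq> ?E" for J
    proof -
      let ?H = "vec.span (insert p J)"
      have "card (insert p J) \<le> card (U \<inter> ?H)"
        using J p U(1) by (intro card_mono) (auto intro: vec.span_base)
      also have "\<dots> \<le> d * (vec.dim ?H - 1) + 1"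
        using pos[of J] by (intro bound) auto
      finally have "card (insert p J) \<le> d * rk J + 1" by (simp add: rk_def)
      moreover have "card (insert p J) = Suc (card J)"
        using J U(1) finite_subset[OF J] by (intro card_insert_disjoint) auto
      ultimately show ?thesis by simp
    qed
  qed
  then obtain c where c': "\<forall>e\<in>?E. c e < d" "\<forall>j. \<forall>J\<subseteq>{e\<in>?E. c e = j}. card J \<le> rk J"
    by (elim exE conjE) (rule that)
  have c: "\<And>e. e \<in> ?E \<Longrightarrow> c e < d" "\<And>j. card {e\<in>?E. c e = j} \<le> rk {e\<in>?E. c e = j}"
    using c'(1) c'(2)[rule_format, OF order_refl] by blast+
  have "\<exists>a. (\<forall>w\<in>vec.span {e\<in>?E. c e = j}. dotp a w = 0) \<and> dotp a p = 1" for j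
  proof (rule separating_functional[OF vec.subspace_span])
    let ?C = "{e\<in>?E. c e = j}"
    \<comment> \<open>Otherwise adding p would not raise the dimension, which is at most the size of
      the class, while independence modulo p requires one more.\<close>
    show "p \<notin> vec.span ?C"
    proof
      assume "p \<in> vec.span ?C"
      then have "vec.span (insert p ?C) = vec.span ?C" by (rule vec.span_redundant)
      then have "vec.dim (insert p ?C) = vec.dim ?C" by (rule vec.span_eq_dim)
      also have "\<dots> \<le> card ?C" using U(1) by (intro vec.dim_le_card) (auto intro: vec.span_base)
      finally show False using c(2)[of j] pos[of ?C] by (simp add: rk_def)
    qed
  qed
  then obtain a where a: "\<And>j w. w \<in> vec.span {e\<in>?E. c e = j} \<Longrightarrow> dotp (a j) w = 0" "\<And>j. dotp (a j) p = 1"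
    by metis
  let ?f = "\<Prod>j<d. lin_form (a j)"
  have "(\<Prod>j<k. lin_form (a j)) \<in> homogeneous_part k" for k
  proof (induction k)
    case 0
    then show ?case using homogeneous_part_const[of 1] by simp
  next
    case (Suc k)
    then show ?case
      using homogeneous_part_mult[OF Suc lin_form_homogeneous[of "a k"]] by simp
  qed
  moreover have "eval_mpoly ?f (($) p) \<noteq> 0" using a(2) by simp
  moreover have "eval_mpoly ?f (($) q) = 0" if q: "q \<in> ?E" for q
  proof -
    have "dotp (a (c q)) q = 0" by (rule a(1)) (use q in \<open>auto intro: vec.span_base\<close>)
    then show ?thesis using c(1)[OF q] by auto
  qed
  ultimately show "\<exists>f\<in>homogeneous_part d. eval_mpoly f (($) p) \<noteq> 0 \<and> (\<forall>q\<in>?E. eval_mpoly f (($) q) = 0)"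
    by blast
qed

text \<open>The maximal subspaces in which the bound is attained meet pairwise in \<open>0\<close>, because the bound
  is modular and the cardinality of the intersection with \<open>I\<close> is supermodular.\<close>

lemma maximal_bounded_set_cover:
  fixes I V :: "('a::field ^ 'n::finite) set"
  assumes I: "finite I" and IV: "I \<subseteq> V" and V: "0 \<notin> V"
    and bound: "\<And>H. vec.subspace H \<Longrightarrow> vec.dim H \<ge> 1 \<Longrightarrow> card (I \<inter> H) \<le> d * (vec.dim H - 1) + 1"
    and max: "\<And>z. z \<in> V - I \<Longrightarrow> \<exists>H. vec.subspace H \<and> vec.dim H \<ge> 1 \<and>
      card (insert z I \<inter> H) > d * (vec.dim H - 1) + 1"
  shows "\<exists>\<H>. finite \<H> \<and> (\<forall>H\<in>\<H>. vec.subspace H \<and> vec.dim H \<ge> 1) \<and> V \<subseteq> \<Union>\<H> \<and>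
    (\<Sum>H\<in>\<H>. d * (vec.dim H - 1) + 1) \<le> card I"
proof -
  define tight where "tight H \<longleftrightarrow> vec.subspace H \<and> vec.dim H \<ge> 1 \<and> card (I \<inter> H) = d * (vec.dim H - 1) + 1"
    for H :: "('a ^ 'n) set"
  \<comment> \<open>For a point of I its own line attains the bound 1. For any other z a subspace
    violating the bound for \<open>insert z I\<close> must contain z and attain the bound for
    I.\<close>
  have ex: "\<exists>H. tight H \<and> z \<in> H" if z: "z \<in> V" for z
  proof (cases "z \<in> I")
    case True
    have dim: "vec.dim (vec.span {z}) = 1" using z V by auto
    have "I \<inter> vec.span {z} \<noteq> {}" using True vec.span_base[of z "{z}"] by blast
    then have "card (I \<inter> vec.span {z}) \<ge> 1" using I by (simp add: Suc_leI card_gt_0_iff)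
    moreover have "card (I \<inter> vec.span {z}) \<le> 1" using bound[of "vec.span {z}"] dim by simp
    ultimately have "tight (vec.span {z})" using dim unfolding tight_def by simp
    then show ?thesis using vec.span_base[of z "{z}"] by blast
  next
    case False
    then obtain H where H: "vec.subspace H" "vec.dim H \<ge> 1" "card (insert z I \<inter> H) > d * (vec.dim H - 1) + 1"
      using max z by blast
    have "z \<in> H"
    proof (rule ccontr)
      assume "z \<notin> H"
      then have "insert z I \<inter> H = I \<inter> H" by blast
      then show False using bound[OF H(1,2)] H(3) by simp
    qed
    then have "card (insert z I \<inter> H) = Suc (card (I \<inter> H))" using False I by simp
    then have "tight H" using bound[OF H(1,2)] H unfolding tight_def by simp
    then show ?thesis using \<open>z \<in> H\<close> by blast
  qed
  have sum_tight: "\<exists>S. tight S \<and> H1 \<subseteq> S \<and> H2 \<subseteq> S"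
    if H: "tight H1" "tight H2" and nz: "\<not> H1 \<inter> H2 \<subseteq> {0}" for H1 H2
  proof -
    let ?S = "{x + y |x y. x \<in> H1 \<and> y \<in> H2}"
    have s: "vec.subspace H1" "vec.subspace H2" using H by (auto simp: tight_def)
    have S: "vec.subspace ?S" by (rule vec.subspace_sums[OF s])
    have "x + 0 \<in> ?S" if "x \<in> H1" for x using that vec.subspace_0[OF s(2)] by blast
    then have sub1: "H1 \<subseteq> ?S" by auto
    have "0 + x \<in> ?S" if "x \<in> H2" for x using that vec.subspace_0[OF s(1)] by blast
    then have sub2: "H2 \<subseteq> ?S" by auto
    have dims: "vec.dim ?S + vec.dim (H1 \<inter> H2) = vec.dim H1 + vec.dim H2"
      by (rule vec.dim_sums_Int[OF s])
    have d1: "vec.dim H1 \<ge> 1" "vec.dim H2 \<ge> 1" using H by (auto simp: tight_def)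
    have dI: "vec.dim (H1 \<inter> H2) \<ge> 1" using nz vec.dim_eq_0[of "H1 \<inter> H2"] by linarith
    have dS: "vec.dim ?S \<ge> 1" using vec.dim_subset[OF sub1] d1 by linarith
    have "card (I \<inter> H1 \<union> I \<inter> H2) + card (I \<inter> H1 \<inter> (I \<inter> H2)) = card (I \<inter> H1) + card (I \<inter> H2)"
      using I by (intro card_Un_Int[symmetric]) auto
    moreover have "card (I \<inter> H1 \<union> I \<inter> H2) \<le> card (I \<inter> ?S)"
      using I sub1 sub2 by (intro card_mono) auto
    moreover have "card (I \<inter> H1 \<inter> (I \<inter> H2)) = card (I \<inter> (H1 \<inter> H2))"
      by (rule arg_cong[of _ _ card]) blast
    moreover have "card (I \<inter> (H1 \<inter> H2)) \<le> d * (vec.dim (H1 \<inter> H2) - 1) + 1"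
      using s dI by (intro bound vec.subspace_inter)
    moreover have "card (I \<inter> H1) = d * (vec.dim H1 - 1) + 1" "card (I \<inter> H2) = d * (vec.dim H2 - 1) + 1"
      using H by (auto simp: tight_def)
    \<comment> \<open>The truncated subtractions balance only because the intersection has dimension
      at least 1. For subspaces meeting in 0 modularity would fail by d.\<close>
    moreover have "d * (vec.dim ?S - 1) + d * (vec.dim (H1 \<inter> H2) - 1) =
        d * (vec.dim H1 - 1) + d * (vec.dim H2 - 1)"
    proof -
      have "(vec.dim ?S - 1) + (vec.dim (H1 \<inter> H2) - 1) = (vec.dim H1 - 1) + (vec.dim H2 - 1)"
        using dims d1 dI dS by linarith
      then show ?thesis by (metis add_mult_distrib2)
    qed
    ultimately have "card (I \<inter> ?S) \<ge> d * (vec.dim ?S - 1) + 1" by linarith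
    then have "tight ?S" using bound[OF S dS] S dS unfolding tight_def by simp
    then show ?thesis using sub1 sub2 by blast
  qed
  define \<H> where "\<H> = {H. tight H \<and> (\<forall>H'. tight H' \<longrightarrow> H \<subseteq> H' \<longrightarrow> H' = H)}"
  have ext: "\<exists>M\<in>\<H>. H \<subseteq> M" if H: "tight H" for H
  proof -
    have "vec.dim M < Suc (CARD('n))" for M :: "('a ^ 'n) set"
      using vec.dim_subset[OF subset_UNIV, of M] by (simp add: card_cart_basis)
    then obtain M where M: "tight M" "H \<subseteq> M" "\<And>M'. tight M' \<and> H \<subseteq> M' \<Longrightarrow> vec.dim M' \<le> vec.dim M"
      using ex_has_greatest_nat[of "\<lambda>M. tight M \<and> H \<subseteq> M" H vec.dim "Suc (CARD('n))"] H by blast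
    have "M' = M" if "tight M'" "M \<subseteq> M'" for M'
      using vec.subspace_dim_equal[of M M'] M that by (auto simp: tight_def)
    then show ?thesis using M unfolding \<H>_def by blast
  qed
  have disj: "H1 \<inter> H2 \<subseteq> {0}" if H: "H1 \<in> \<H>" "H2 \<in> \<H>" "H1 \<noteq> H2" for H1 H2
  proof (rule ccontr)
    assume "\<not> ?thesis"
    then obtain S where "tight S" "H1 \<subseteq> S" "H2 \<subseteq> S"
      using sum_tight[of H1 H2] H unfolding \<H>_def by blast
    then show False using H unfolding \<H>_def by blast
  qed
  have disjI: "(I \<inter> H1) \<inter> (I \<inter> H2) = {}" if "H1 \<in> \<H>" "H2 \<in> \<H>" "H1 \<noteq> H2" for H1 H2
    using disj[OF that] IV V by blast
  have ne: "I \<inter> H \<noteq> {}" if "H \<in> \<H>" for H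
    using that unfolding \<H>_def tight_def by auto
  \<comment> \<open>The traces on I are nonempty and disjoint, so they determine the subspaces. This
    gives finiteness, and adding up their sizes gives at most \<open>card I\<close>.\<close>
  have "inj_on (\<lambda>H. I \<inter> H) \<H>"
    by (rule inj_onI) (metis disjI ne inf.idem)
  moreover have "(\<lambda>H. I \<inter> H) ` \<H> \<subseteq> Pow I" by blast
  ultimately have fin: "finite \<H>" using I by (meson finite_Pow_iff finite_imageD finite_subset)
  have "(\<Sum>H\<in>\<H>. d * (vec.dim H - 1) + 1) = (\<Sum>H\<in>\<H>. card (I \<inter> H))"
    by (intro sum.cong) (auto simp: \<H>_def tight_def)
  also have "\<dots> = card (\<Union>H\<in>\<H>. I \<inter> H)"
    using fin I disjI by (intro card_UN_disjoint[symmetric]) auto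
  also have "\<dots> \<le> card I" using I by (intro card_mono) auto
  finally have "(\<Sum>H\<in>\<H>. d * (vec.dim H - 1) + 1) \<le> card I" .
  moreover have "V \<subseteq> \<Union>\<H>" using ex ext by blast
  moreover have "\<forall>H\<in>\<H>. vec.subspace H \<and> vec.dim H \<ge> 1" unfolding \<H>_def tight_def by blast
  ultimately show ?thesis using fin by blast
qed

section \<open>Very unexpected hypersurfaces\<close>

lemma proj_rep_image_Int:
  assumes "U \<subseteq> proj_points" "vec.subspace H"
  shows "proj_rep ` (U \<inter> points_of H) = proj_rep ` U \<inter> H"
  using assms proj_point_subset_iff[OF _ assms(2)] by (auto simp: points_of_def)

lemma card_proj_rep_image: "U \<subseteq> proj_points \<Longrightarrow> card (proj_rep ` U) = card U"
  by (rule card_image) (rule inj_on_subset[OF inj_on_proj_rep])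

lemma card_Int_points_of:
  assumes "U \<subseteq> proj_points" "vec.subspace H"
  shows "card (U \<inter> points_of H) = card (proj_rep ` U \<inter> H)"
proof -
  have "U \<inter> points_of H \<subseteq> proj_points" using assms(1) by blast
  from card_proj_rep_image[OF this] show ?thesis by (simp add: proj_rep_image_Int[OF assms])
qed

lemma card_Int_points_of_dim_one:
  assumes "vec.subspace H" "vec.dim H = 1"
  shows "card (U \<inter> points_of H) \<le> 1"
proof -
  have "p = H" if "p \<in> points_of H" for p
    using that assms by (intro vec.subspace_dim_equal) (auto simp: points_of_def proj_points_def)
  then have "U \<inter> points_of H \<subseteq> {H}" by blast
  then have "card (U \<inter> points_of H) \<le> card {H}" by (rule card_mono[rotated]) simp
  then show ?thesis by simp
qed

lemma ExC_le:
  assumes "finite \<H>" "\<forall>H\<in>\<H>. vec.subspace H \<and> vec.dim H \<ge> 1" "Z \<subseteq> (\<Union>H\<in>\<H>. points_of H)"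
  shows "ExC Z d \<le> (\<Sum>H\<in>\<H>. d * (vec.dim H - 1) + 1)"
  unfolding ExC_def using assms by (intro Least_le) blast

text \<open>The points of Z themselves form a covering collection, so the minimum is over a nonempty
  set.\<close>

lemma ExC_attained:
  assumes "finite Z" "Z \<subseteq> proj_points"
  obtains \<H> where "finite \<H>" "\<And>H. H \<in> \<H> \<Longrightarrow> vec.subspace H" "\<And>H. H \<in> \<H> \<Longrightarrow> vec.dim H \<ge> 1"
    "Z \<subseteq> (\<Union>H\<in>\<H>. points_of H)" "ExC Z d = (\<Sum>H\<in>\<H>. d * (vec.dim H - 1) + 1)"
proof -
  let ?P = "\<lambda>m. \<exists>\<H>. finite \<H> \<and> (\<forall>H\<in>\<H>. vec.subspace H \<and> vec.dim H \<ge> 1) \<and>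
     Z \<subseteq> (\<Union>H\<in>\<H>. points_of H) \<and> m = (\<Sum>H\<in>\<H>. d * (vec.dim H - 1) + 1)"
  have "?P (\<Sum>H\<in>Z. d * (vec.dim H - 1) + 1)"
    using assms by (intro exI[of _ Z]) (auto simp: proj_points_def points_of_def)
  then have "?P (ExC Z d)" unfolding ExC_def by (rule LeastI)
  then show thesis using that by blast
qed

context
  fixes d :: nat and fat :: "('a::alg_closed_field ^ 'n::finite) set \<Rightarrow> ('a, 'n) mpoly set"
  assumes card: "CARD('n) \<ge> 3" and d: "d \<ge> 1"
  defines "fat \<equiv> \<lambda>Q. graded_part (fat_ideal Q d) d"
begin

private lemma two: "CARD('n) \<ge> 2"
  using card by simp

private lemma fat_eq: "graded_part (fat_ideal Q d) d = fat Q"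
  by (simp add: fat_def)

private lemma fat_homogeneous: "fat Q \<subseteq> homogeneous_part d"
  by (auto simp: fat_def graded_part_def)

private lemma fat_subspace: "mpoly.subspace (fat Q)"
  unfolding fat_def by (rule subspace_graded_fat)

private lemmas quot_dim_fat = quot_dim_vanishing_on[OF fat_subspace fat_homogeneous]

private lemma graded_quot_dim_fat:
  assumes "Y \<subseteq> proj_points"
  shows "graded_quot_dim (fat_ideal Q d) (vanishing_ideal Y \<inter> fat_ideal Q d) d =
    quot_dim (fat Q) (vanishing_on (fat Q) (proj_rep ` Y))"
  by (simp add: graded_quot_dim_def fat_def graded_part_vanishing_Int[OF assms])

private lemma graded_quot_dim_UNIV:
  assumes "Y \<subseteq> proj_points"
  shows "graded_quot_dim UNIV (vanishing_ideal Y) d =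
    quot_dim (homogeneous_part d) (vanishing_on (homogeneous_part d) (proj_rep ` Y))"
  using graded_part_vanishing_Int[OF assms, of UNIV d] by (simp add: graded_quot_dim_def graded_part_def)

private lemma quot_dim_fat_eq:
  assumes "Y \<subseteq> proj_points"
  shows "int (mpoly.dim (graded_part (fat_ideal Q d) d)) -
    int (mpoly.dim (graded_part (fat_ideal Q d \<inter> vanishing_ideal Y) d)) =
    int (quot_dim (fat Q) (vanishing_on (fat Q) (proj_rep ` Y)))"
  using quot_dim_fat(2)[of Q "proj_rep ` Y"] graded_part_vanishing_Int[OF assms, of "fat_ideal Q d" d]
  by (simp add: fat_def Int_commute)

text \<open>Generality means that a minor on H is nonzero, so H must have vector dimension at least
  2. Points are handled by direct counting.\<close>

private lemma generic_independent_card_le: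
  assumes H: "vec.subspace H" "vec.dim H \<ge> 2"
  shows "for_general_codim2 (\<lambda>Q. \<forall>I\<subseteq>H. finite I \<longrightarrow> independent_conditions (fat Q) I \<longrightarrow>
    card I \<le> d * (vec.dim H - 1) + 1)"
proof -
  obtain v w a b where vw: "v \<in> H" "w \<in> H" "minor2 a b v w \<noteq> 0"
    using exists_minor2_nonzero[OF H] by blast
  show ?thesis
    unfolding for_general_codim2_iff[OF two]
    using fat_forms_card_le[OF H(1) vw(1,2) _ d card] vw(3)
    by (intro exI[of _ "\<lambda>a b. minor2 a b v w"]) (auto simp: fat_def)
qed

private lemma independent_conditions_subset:
  assumes "independent_conditions A I" "J \<subseteq> I"
  shows "independent_conditions A J"
  unfolding independent_conditions_def
proof
  fix p assume p: "p \<in> J"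
  then obtain f where "f \<in> A" "eval_mpoly f (($) p) \<noteq> 0" "\<forall>q\<in>I - {p}. eval_mpoly f (($) q) = 0"
    using assms unfolding independent_conditions_def by blast
  then show "\<exists>f\<in>A. eval_mpoly f (($) p) \<noteq> 0 \<and> (\<forall>q\<in>J - {p}. eval_mpoly f (($) q) = 0)"
    using assms(2) by blast
qed

text \<open>For general Q, r_Q(Z) = r_Q(U) by (I), this is less than the number of conditions of U
  on all forms of degree d by (III), and that number is at most |U|. Condition (II) for linear
  subspaces bounds |U| by the cost of any cover.\<close>

private lemma quot_dim_le_ExC:
  assumes Z: "Z \<subseteq> proj_points" "finite Z" and "very_unexpected Z d"
  shows "for_general_codim2 (\<lambda>Q. quot_dim (fat Q) (vanishing_on (fat Q) (proj_rep ` Z)) < ExC Z d)"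
proof -
  obtain U where U: "U \<subseteq> Z" and
    1: "for_general_codim2 (\<lambda>Q. graded_part (vanishing_ideal Z \<inter> fat_ideal Q d) d =
       graded_part (vanishing_ideal U \<inter> fat_ideal Q d) d)" and
    2: "\<And>X. irreducible_subvariety X \<Longrightarrow> for_general_codim2 (\<lambda>Q.
       card (U \<inter> X) \<le> graded_quot_dim (fat_ideal Q d) (vanishing_ideal X \<inter> fat_ideal Q d) d)" and
    3: "for_general_codim2 (\<lambda>Q. graded_quot_dim UNIV (vanishing_ideal U) d >
       graded_quot_dim (fat_ideal Q d) (vanishing_ideal U \<inter> fat_ideal Q d) d)"
    using assms(3) unfolding very_unexpected_def by blast
  have Up: "U \<subseteq> proj_points" "finite U" using U Z finite_subset by auto
  have sub: "card (U \<inter> points_of H) \<le> d * (vec.dim H - 1) + 1"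
    if H: "vec.subspace H" "vec.dim H \<ge> 1" for H
  proof (cases "vec.dim H = 1")
    case True
    then show ?thesis using card_Int_points_of_dim_one[OF H(1)] by simp
  next
    case False
    then have H2: "vec.dim H \<ge> 2" using H(2) by simp
    from for_general_codim2_witness[OF for_general_codim2_conj[OF two
        2[OF irreducible_linear_subspace[OF H]] generic_independent_card_le[OF H(1) H2]]]
    obtain Q where Q: "card (U \<inter> points_of H) \<le>
        graded_quot_dim (fat_ideal Q d) (vanishing_ideal (points_of H) \<inter> fat_ideal Q d) d"
      and le: "\<forall>I\<subseteq>H. finite I \<longrightarrow> independent_conditions (fat Q) I \<longrightarrow> card I \<le> d * (vec.dim H - 1) + 1"
      by blast
    have pH: "points_of H \<subseteq> proj_points" by (auto simp: points_of_def)
    obtain I where I: "I \<subseteq> proj_rep ` points_of H" "finite I" "independent_conditions (fat Q) I"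
      "quot_dim (fat Q) (vanishing_on (fat Q) (proj_rep ` points_of H)) = card I"
      using quot_dim_fat(1)[of "proj_rep ` points_of H" Q] by blast
    have "I \<subseteq> H" using I(1) proj_rep(1) by (auto simp: points_of_def)
    then show ?thesis using Q le I by (auto simp: graded_quot_dim_fat[OF pH])
  qed
  have "card U \<le> ExC Z d"
  proof -
    obtain \<H> where \<H>: "finite \<H>" "\<And>H. H \<in> \<H> \<Longrightarrow> vec.subspace H" "\<And>H. H \<in> \<H> \<Longrightarrow> vec.dim H \<ge> 1"
      "Z \<subseteq> (\<Union>H\<in>\<H>. points_of H)" "ExC Z d = (\<Sum>H\<in>\<H>. d * (vec.dim H - 1) + 1)"
      by (rule ExC_attained[OF Z(2,1)]) (rule that)
    have "U = (\<Union>H\<in>\<H>. U \<inter> points_of H)" using U \<H>(4) by blast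
    then have "card U \<le> (\<Sum>H\<in>\<H>. card (U \<inter> points_of H))"
      using card_UN_le[OF \<H>(1), of "\<lambda>H. U \<inter> points_of H"] by simp
    also have "\<dots> \<le> ExC Z d"
      unfolding \<H>(5) by (intro sum_mono sub \<H>(2,3))
    finally show ?thesis .
  qed
  moreover have "graded_quot_dim UNIV (vanishing_ideal U) d \<le> card U"
  proof -
    obtain I where I: "I \<subseteq> proj_rep ` U"
      "quot_dim (homogeneous_part d) (vanishing_on (homogeneous_part d) (proj_rep ` U)) = card I"
      using quot_dim_vanishing_on(1)[OF homogeneous_part_subspace order_refl, where V = "proj_rep ` U"] by blast
    have "card I \<le> card (proj_rep ` U)" using I(1) Up(2) by (intro card_mono) auto
    then show ?thesis using I(2) by (simp add: graded_quot_dim_UNIV[OF Up(1)] card_proj_rep_image[OF Up(1)])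
  qed
  ultimately have le: "graded_quot_dim UNIV (vanishing_ideal U) d \<le> ExC Z d" by simp
  show ?thesis
  proof (rule for_general_codim2_mono[OF for_general_codim2_conj[OF two 1 3]])
    fix Q
    assume *: "graded_part (vanishing_ideal Z \<inter> fat_ideal Q d) d =
        graded_part (vanishing_ideal U \<inter> fat_ideal Q d) d \<and>
      graded_quot_dim (fat_ideal Q d) (vanishing_ideal U \<inter> fat_ideal Q d) d <
        graded_quot_dim UNIV (vanishing_ideal U) d"
    then have "graded_quot_dim (fat_ideal Q d) (vanishing_ideal Z \<inter> fat_ideal Q d) d < ExC Z d"
      using le by (simp add: graded_quot_dim_def)
    then show "quot_dim (fat Q) (vanishing_on (fat Q) (proj_rep ` Z)) < ExC Z d"
      by (simp add: graded_quot_dim_fat[OF Z(1)])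
  qed
qed

private lemma very_unexpectedI:
  assumes Z: "Z \<subseteq> proj_points" "finite Z" and
    gen: "for_general_codim2 (\<lambda>Q. quot_dim (fat Q) (vanishing_on (fat Q) (proj_rep ` Z)) < ExC Z d)"
  shows "very_unexpected Z d"
proof -
  let ?V = "proj_rep ` Z"
  \<comment> \<open>I depends on Z only, which allows U to be built from it before Q is
    chosen.\<close>
  obtain I D e where IV: "I \<subseteq> ?V" and finI: "finite I" and D: "pair_poly D" "\<exists>a b. D a b \<noteq> 0"
    and DI: "\<And>a b. cut_out a b \<in> codim2_subspaces \<Longrightarrow> D a b \<noteq> 0 \<Longrightarrow>
       independent_conditions (fat (cut_out a b)) I \<and>
       vanishing_on (fat (cut_out a b)) I = vanishing_on (fat (cut_out a b)) ?V"
    unfolding fat_def by (rule generic_interpolation[OF card d, of ?V]) blast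
  have genI: "for_general_codim2 (\<lambda>Q. independent_conditions (fat Q) I \<and> vanishing_on (fat Q) I = vanishing_on (fat Q) ?V)"
    unfolding for_general_codim2_iff[OF two] using D DI by blast
  have rank: "quot_dim (fat Q) (vanishing_on (fat Q) ?V) = card I"
    if "independent_conditions (fat Q) I \<and> vanishing_on (fat Q) I = vanishing_on (fat Q) ?V" for Q
  proof (rule antisym)
    obtain I' where I': "I' \<subseteq> I" "quot_dim (fat Q) (vanishing_on (fat Q) I) = card I'"
      using quot_dim_fat(1)[of I Q] by blast
    show "quot_dim (fat Q) (vanishing_on (fat Q) ?V) \<le> card I"
      using that I' card_mono[OF finI I'(1)] by simp
    show "card I \<le> quot_dim (fat Q) (vanishing_on (fat Q) ?V)"
      using that quot_dim_fat(3)[OF IV finI] by blast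
  qed
  \<comment> \<open>Neither side involves Q any more, so a single Q satisfying both general
    conditions is enough.\<close>
  have lt: "card I < ExC Z d"
    using for_general_codim2_witness[OF for_general_codim2_conj[OF two genI gen]] rank by metis
  have V0: "0 \<notin> ?V" using proj_rep(2) Z(1) by fastforce
  have point: "card (B \<inter> H) \<le> d * (vec.dim H - 1) + 1"
    if "B \<subseteq> ?V" "vec.subspace H" "vec.dim H = 1" for B H
  proof -
    have "card (B \<inter> H) \<le> card (?V \<inter> H)" using that(1) Z(2) by (intro card_mono) auto
    also have "\<dots> \<le> 1"
      using card_Int_points_of[OF Z(1) that(2)] card_Int_points_of_dim_one[OF that(2,3), of Z] by simp
    finally show ?thesis by simp
  qed
  have boundI: "card (I \<inter> H) \<le> d * (vec.dim H - 1) + 1" if H: "vec.subspace H" "vec.dim H \<ge> 1" for H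
  proof (cases "vec.dim H = 1")
    case True
    then show ?thesis using point[OF IV H(1)] by blast
  next
    case False
    then have "vec.dim H \<ge> 2" using H(2) by simp
    from for_general_codim2_witness[OF for_general_codim2_conj[OF two genI
        generic_independent_card_le[OF H(1) this]]]
    obtain Q where Q: "independent_conditions (fat Q) I"
      "\<forall>I\<subseteq>H. finite I \<longrightarrow> independent_conditions (fat Q) I \<longrightarrow> card I \<le> d * (vec.dim H - 1) + 1"
      by blast
    then show ?thesis using independent_conditions_subset[OF Q(1), of "I \<inter> H"] finI by simp
  qed
  \<comment> \<open>If no z could be added, the maximal tight subspaces would cover Z at cost at
    most \<open>card I\<close>, less than the minimum \<open>ExC Z d\<close>.\<close>
  obtain z where z: "z \<in> ?V - I" and
    boundz: "\<And>H. vec.subspace H \<Longrightarrow> vec.dim H \<ge> 1 \<Longrightarrow> card (insert z I \<inter> H) \<le> d * (vec.dim H - 1) + 1"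
  proof (rule ccontr)
    assume "\<not> thesis"
    then have "\<And>z. z \<in> ?V - I \<Longrightarrow> \<exists>H. vec.subspace H \<and> vec.dim H \<ge> 1 \<and>
        card (insert z I \<inter> H) > d * (vec.dim H - 1) + 1"
      using that by (meson not_le)
    from maximal_bounded_set_cover[OF finI IV V0 boundI this]
    obtain \<H> where \<H>: "finite \<H>" "\<forall>H\<in>\<H>. vec.subspace H \<and> vec.dim H \<ge> 1" "?V \<subseteq> \<Union>\<H>"
      "(\<Sum>H\<in>\<H>. d * (vec.dim H - 1) + 1) \<le> card I" by blast
    have "Z \<subseteq> (\<Union>H\<in>\<H>. points_of H)"
    proof
      fix p assume p: "p \<in> Z"
      then obtain H where H: "H \<in> \<H>" "proj_rep p \<in> H" using \<H>(3) by blast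
      then have "p \<in> points_of H"
        using proj_point_subset_iff[of p H] p Z(1) \<H>(2) by (auto simp: points_of_def)
      then show "p \<in> (\<Union>H\<in>\<H>. points_of H)" using H(1) by blast
    qed
    then have "ExC Z d \<le> card I" using ExC_le[OF \<H>(1,2)] \<H>(4) by (meson order_trans)
    then show False using lt by simp
  qed
  let ?B = "insert z I"
  define U where "U = {p \<in> Z. proj_rep p \<in> ?B}"
  have UZ: "U \<subseteq> Z" and Up: "U \<subseteq> proj_points" using Z(1) by (auto simp: U_def)
  have UB: "proj_rep ` U = ?B" using IV z by (auto simp: U_def)
  \<comment> \<open>\<open>?B\<close> lies between I and all of Z, and these impose the same
    conditions for general Q. This is condition (I).\<close>
  have vanB: "vanishing_on (fat Q) ?B = vanishing_on (fat Q) ?V"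
    if "vanishing_on (fat Q) I = vanishing_on (fat Q) ?V" for Q
    using that z IV unfolding vanishing_on_def by blast
  have cond1: "for_general_codim2 (\<lambda>Q. graded_part (vanishing_ideal Z \<inter> fat_ideal Q d) d =
       graded_part (vanishing_ideal U \<inter> fat_ideal Q d) d)"
    by (rule for_general_codim2_mono[OF genI])
      (simp add: graded_part_vanishing_Int[OF Z(1)] graded_part_vanishing_Int[OF Up] UB fat_eq vanB)
  have cond2: "for_general_codim2 (\<lambda>Q. card (U \<inter> X) \<le>
      graded_quot_dim (fat_ideal Q d) (vanishing_ideal X \<inter> fat_ideal Q d) d)"
    if X: "irreducible_subvariety X" for X
  proof -
    have Xp: "X \<subseteq> proj_points" by (rule irreducible_subvariety_subset[OF X])
    let ?W = "vec.span (proj_rep ` X)"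
    obtain p where p: "p \<in> X" using X unfolding irreducible_subvariety_def by blast
    have "vec.dim ?W \<noteq> 0"
      using p Xp proj_rep(2)[of p] by auto
    \<comment> \<open>The bound on the linear span of X suffices, since X imposes at least that many
      conditions for general Q.\<close>
    then have "card (?B \<inter> ?W) \<le> d * (vec.dim ?W - 1) + 1"
      by (intro boundz vec.subspace_span) linarith
    moreover have "card (U \<inter> X) = card (proj_rep ` (U \<inter> X))"
      using Up by (intro card_proj_rep_image[symmetric]) blast
    moreover have "card (proj_rep ` (U \<inter> X)) \<le> card (?B \<inter> ?W)"
      using finI UB by (intro card_mono) (auto intro: vec.span_base)
    ultimately have le: "card (U \<inter> X) \<le> d * (vec.dim ?W - 1) + 1" by linarith
    show ?thesis
      by (rule for_general_codim2_mono[OF generic_rank_irreducible[OF X card d]])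
        (use le in \<open>simp add: graded_quot_dim_fat[OF Xp] fat_def\<close>)
  qed
  \<comment> \<open>All \<open>card I + 1\<close> points of \<open>?B\<close> are independent on
    forms of degree d, whereas their rank on the fat forms is still \<open>card I\<close>.\<close>
  have "independent_conditions (homogeneous_part d) ?B"
    by (rule independent_conditions_of_subspace_bound[OF _ _ boundz]) (use finI V0 IV z in auto)
  then have "card ?B \<le> graded_quot_dim UNIV (vanishing_ideal U) d"
    unfolding graded_quot_dim_UNIV[OF Up] UB using finI
    by (intro quot_dim_vanishing_on(3)[OF homogeneous_part_subspace order_refl]) auto
  then have hU: "card I < graded_quot_dim UNIV (vanishing_ideal U) d"
    using z finI by simp
  have cond3: "for_general_codim2 (\<lambda>Q. graded_quot_dim UNIV (vanishing_ideal U) d >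
       graded_quot_dim (fat_ideal Q d) (vanishing_ideal U \<inter> fat_ideal Q d) d)"
    by (rule for_general_codim2_mono[OF genI])
      (use hU in \<open>simp add: graded_quot_dim_fat[OF Up] UB vanB rank\<close>)
  show ?thesis
    unfolding very_unexpected_def using UZ cond1 cond2 cond3 by blast
qed

lemma very_unexpected_iff_quot_dim:
  fixes Z :: "('a ^ 'n) set set"
  assumes "Z \<subseteq> proj_points" "finite Z"
  shows "very_unexpected Z d \<longleftrightarrow> for_general_codim2 (\<lambda>Q.
      int (mpoly.dim (graded_part (fat_ideal Q d) d))
        - int (mpoly.dim (graded_part (fat_ideal Q d \<inter> vanishing_ideal Z) d))
      < int (ExC Z d))"
  unfolding quot_dim_fat_eq[OF assms(1)] of_nat_less_iff
  using quot_dim_le_ExC[OF assms] very_unexpectedI[OF assms] by blast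

end

theorem theorem5p21:
  fixes Z :: "('a::alg_closed_field ^ 'n::finite) set set" and n d :: nat
  assumes "CARD('n) = n + 1" and "n \<ge> 2"
    and "Z \<subseteq> proj_points" and "finite Z" and "d \<ge> 1"
  shows "very_unexpected Z d \<longleftrightarrow>
    for_general_codim2 (\<lambda>Q.
      int (mpoly.dim (graded_part (fat_ideal Q d) d))
        - int (mpoly.dim (graded_part (fat_ideal Q d \<inter> vanishing_ideal Z) d))
      < int (ExC Z d))"
  using assms by (intro very_unexpected_iff_quot_dim) auto

end
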